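(* Let $\mathcal{S}$ be a small category admitting binary products, let $\mathbb{H}_1,\mathbb{H}_2$ be two $\mathcal{S}$-fibered categories and let $R:\mathbb{H}_1\to\mathbb{H}_2$ be a morphism of $\mathcal{S}$-fibered categories. For $j=1,2$, let $(\otimes_j,m_j^i)$ be a (unitary, symmetric, associative) internal tensor structure on $\mathbb{H}_j$, and let $(\boxtimes_j,m_j^e)$ denote the (unitary, symmetric, associative) external tensor structure on $\mathbb{H}_j$ corresponding to it under the canonical bijection between equivalence classes of (unitary, symmetric, associative) internal and external tensor structures on $\mathbb{H}_j$. Then there exist canonical bijections between (unitary, symmetric, associative) internal tensor structures on $R$ (with respect to $(\otimes_1,m_1^i)$ and $(\otimes_2,m_2^i)$) and (unitary, symmetric, associative) external tensor structures on $R$ (with respect to $(\boxtimes_1,m_1^e)$ and $(\boxtimes_2,m_2^e)$). Here each of the bracketed properties may be included or omitted, in any combination, the same one throughout.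
   Context: **Fibered categories.** An $\mathcal{S}$-fibered category $\mathbb{H}$ consists of a category $\mathbb{H}(S)$ for each object $S$ of $\mathcal{S}$, a functor $f^*:\mathbb{H}(S)\to\mathbb{H}(T)$ for each $f:T\to S$, and a natural isomorphism $\mathrm{conn}_{f,g}:(gf)^*A\to f^*g^*A$ (connection isomorphism) for each composable pair $f:T\to S$, $g:S\to V$, such that $\mathrm{id}_S^*=\mathrm{id}_{\mathbb{H}(S)}$ and $f^*(\mathrm{conn}_{g,h})\circ\mathrm{conn}_{f,hg}=\mathrm{conn}_{f,g}\circ\mathrm{conn}_{gf,h}$ for composable $f,g,h$. Connection isomorphisms are written as equalities. A section $A$ of $\mathbb{H}$ consists of objects $A_S\in\mathbb{H}(S)$ and isomorphisms $A_f^*:f^*A_S\to A_T$ for $f:T\to S$ with $A^*_{gf}=A_f^*\circ f^*(A_g^* )$. An isomorphism of sections $w:A\to B$ is a family of isomorphisms $w_S:A_S\to B_S$ with $B_f^*\circ f^*(w_S)=w_T\circ A_f^*$. A morphism $R:\mathbb{H}_1\to\mathbb{H}_2$ of $\mathcal{S}$-fibered categories consists of functors $R_S:\mathbb{H}_1(S)\to\mathbb{H}_2(S)$ and natural isomorphisms $\theta_f:f^*R_S(A)\to R_T(f^*A)$ for $f:T\to S$ with $\theta_{gf}=\theta_f\circ f^*(\theta_g)$. The image of a section $A$ of $\mathbb{H}_1$ is the section $R(A)$ of $\mathbb{H}_2$ with $R(A)_S=R_S(A_S)$ and $R(A)_f^*=R_T(A_f^* )\circ\theta_f$. **Products.** $pr^{12}_i:S_1\times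 S_2\to S_i$, $pr^{123}_{12}$, $pr^{123}_i$ etc. are the projections, $\Delta_S:S\to S\times S$ and $\Delta_S^{(3)}:S\to S\times S\times S$ the diagonals, $\tau:S_1\times S_2\to S_2\times S_1$ the permutation isomorphism. Iterated products are identified along the canonical associativity isomorphisms. **Internal tensor structures.** An internal tensor structure $(\otimes,m)$ on $\mathbb{H}$ consists of functors $\otimes=\otimes_S:\mathbb{H}(S)\times\mathbb{H}(S)\to\mathbb{H}(S)$ and, for $f:T\to S$, natural isomorphisms $m_f:f^*A\otimes f^*B\to f^*(A\otimes B)$ with $m_{gf}=f^*(m_g)\circ m_f$ for composable $f,g$. - It is associative if equipped with an associativity constraint: natural isomorphisms $a_S:(A\otimes B)\otimes C\to A\otimes(B\otimes C)$ satisfying the pentagon $a_{A,B,C\otimes D}\circ a_{A\otimes B,C,D}=(A\otimes a_{B,C,D})\circ a_{A,B\otimes C,D}\circ(a_{A,B,C}\otimes D)$ and, for $f:T\to S$, $f^*(a)\circ m_f\circ(m_f\otimes\mathrm{id})=m_f\circ(\mathrm{id}\otimes m_f)\circ a$. - It is symmetric if equipped with a commutativity constraint: natural isomorphisms $c_S:A\otimes B\to B\otimes A$ with $c_{B,A}\circ c_{A,B}=\mathrm{id}$ and $f^*(c)\circ m_f=m_f\circ c$. - It is unitary if equipped with a unit constraint $u$: a section $\mathbf{1}$ of $\mathbb{H}$ (unit section) and natural isomorphisms $u_r:A\otimes\mathbf{1}_S\to A$, $u_l:\mathbf{1}_S\otimes B\to B$ such that $u_r=u_l$ on $\mathbf{1}_S\otimes\mathbf{1}_S$,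 $f^*(u_r)\circ m_f=u_r\circ(\mathrm{id}\otimes\mathbf{1}_f^* )$ and $f^*(u_l)\circ m_f=u_l\circ(\mathbf{1}_f^*\otimes\mathrm{id})$. - If several constraints are present, any two must be compatible. For $a,c$: $(B\otimes c_{A,C})\circ a_{B,A,C}\circ(c_{A,B}\otimes C)=a_{B,C,A}\circ c_{A,B\otimes C}\circ a_{A,B,C}$. For $a,u$: $u_l\circ a_{\mathbf{1},B,C}=u_l\otimes C$, $(A\otimes u_l)\circ a_{A,\mathbf{1},C}=u_r\otimes C$, $(A\otimes u_r)\circ a_{A,B,\mathbf{1}}=u_r$. For $c,u$: $u_r\circ c_{\mathbf{1},B}=u_l$. An equivalence $e:(\otimes,m)\to(\otimes',m')$ is a family of natural isomorphisms $e_S:A\otimes B\to A\otimes'B$ with $f^*(e_S)\circ m_f=m'_f\circ e_T$ for $f:T\to S$. In the associative case one also requires $a'\circ e\circ(e\otimes\mathrm{id})=e\circ(\mathrm{id}\otimes e)\circ a$; in the symmetric case $c'\circ e=e\circ c$; in the unitary case the equivalence also includes an isomorphism of unit sections $w:\mathbf{1}\to\mathbf{1}'$ with $u'_r\circ e\circ(\mathrm{id}\otimes w_S)=u_r$ and $u'_l\circ e\circ(w_S\otimes\mathrm{id})=u_l$. **External tensor structures.** An external tensor structure $(\boxtimes,m)$ on $\mathbb{H}$ consists of functors $\boxtimes=\boxtimes_{S_1,S_2}:\mathbb{H}(S_1)\times\mathbb{H}(S_2)\to\mathbb{H}(S_1\times S_2)$ and, for $f_i:T_i\to S_i$ ($i=1,2$),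 natural isomorphisms $m_{f_1,f_2}:f_1^*A_1\boxtimes f_2^*A_2\to(f_1\times f_2)^*(A_1\boxtimes A_2)$ with $m_{g_1f_1,g_2f_2}=(f_1\times f_2)^*(m_{g_1,g_2})\circ m_{f_1,f_2}$ for composable $f_i,g_i$. - It is associative if equipped with an associativity constraint: natural isomorphisms $a:(A_1\boxtimes A_2)\boxtimes A_3\to A_1\boxtimes(A_2\boxtimes A_3)$ in $\mathbb{H}(S_1\times S_2\times S_3)$ satisfying the pentagon $a_{A_1,A_2,A_3\boxtimes A_4}\circ a_{A_1\boxtimes A_2,A_3,A_4}=(A_1\boxtimes a)\circ a_{A_1,A_2\boxtimes A_3,A_4}\circ(a\boxtimes A_4)$ and, for $f_i:T_i\to S_i$ ($i=1,2,3$), $(f_1\times f_2\times f_3)^*(a)\circ m_{f_1\times f_2,f_3}\circ(m_{f_1,f_2}\boxtimes\mathrm{id})=m_{f_1,f_2\times f_3}\circ(\mathrm{id}\boxtimes m_{f_2,f_3})\circ a$. - It is symmetric if equipped with a commutativity constraint: natural isomorphisms $c_{S_1,S_2}:A_1\boxtimes A_2\to\tau^*(A_2\boxtimes A_1)$ such that $\tau^*(c_{S_2,S_1})\circ c_{S_1,S_2}$ is the identification $A_1\boxtimes A_2=\tau^*\tau^*(A_1\boxtimes A_2)$ and, for $f_i:T_i\to S_i$, $(f_1\times f_2)^*(c)\circ m_{f_1,f_2}$ equals $f_1^*A_1\boxtimes f_2^*A_2\xrightarrow{c}\tau^*(f_2^*A_2\boxtimes f_1^*A_1)\xrightarrow{m}\tau^*(f_2\times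 f_1)^*(A_2\boxtimes A_1)=(f_1\times f_2)^*\tau^*(A_2\boxtimes A_1)$. - It is unitary if equipped with a unit constraint $u$: a section $\mathbf{1}$ of $\mathbb{H}$ (unit section) and natural isomorphisms $u_r:A_1\boxtimes\mathbf{1}_{S_2}\to pr^{12,*}_1A_1$, $u_l:\mathbf{1}_{S_1}\boxtimes A_2\to pr^{12,*}_2A_2$ such that $\mathbf{1}^*_{pr^{12}_1}\circ u_r=\mathbf{1}^*_{pr^{12}_2}\circ u_l:\mathbf{1}_{S_1}\boxtimes\mathbf{1}_{S_2}\to\mathbf{1}_{S_1\times S_2}$ and, for $f_i:T_i\to S_i$, $(f_1\times f_2)^*(u_r)\circ m_{f_1,f_2}=u_r\circ(\mathrm{id}\boxtimes\mathbf{1}^*_{f_2})$ on $f_1^*A_1\boxtimes f_2^*\mathbf{1}_{S_2}$ and $(f_1\times f_2)^*(u_l)\circ m_{f_1,f_2}=u_l\circ(\mathbf{1}^*_{f_1}\boxtimes\mathrm{id})$ on $f_1^*\mathbf{1}_{S_1}\boxtimes f_2^*A_2$. - If several constraints are present, any two must be compatible. For $a,c$: writing $\tau_{1,23}:S_1\times(S_2\times S_3)\to(S_2\times S_3)\times S_1$ for the permutation isomorphism, the composites $(A_1\boxtimes A_2)\boxtimes A_3\xrightarrow{c}\tau^*(A_2\boxtimes A_1)\boxtimes A_3\xrightarrow{m}(\tau\times\mathrm{id})^*((A_2\boxtimes A_1)\boxtimes A_3)\xrightarrow{a}(\tau\times\mathrm{id})^*(A_2\boxtimes(A_1\boxtimes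 A_3))\xrightarrow{c}(\tau\times\mathrm{id})^*(A_2\boxtimes\tau^*(A_3\boxtimes A_1))\xrightarrow{m}(\tau\times\mathrm{id})^*(\mathrm{id}\times\tau)^*(A_2\boxtimes(A_3\boxtimes A_1))$ and $(A_1\boxtimes A_2)\boxtimes A_3\xrightarrow{a}A_1\boxtimes(A_2\boxtimes A_3)\xrightarrow{c}\tau_{1,23}^*((A_2\boxtimes A_3)\boxtimes A_1)\xrightarrow{a}\tau_{1,23}^*(A_2\boxtimes(A_3\boxtimes A_1))$ agree modulo the identification of targets. For $a,u$: $u_l\circ a=m_{pr^{12}_2,\mathrm{id}}\circ(u_l\boxtimes\mathrm{id})$ on $(\mathbf{1}_{S_1}\boxtimes A_2)\boxtimes A_3$; $m_{\mathrm{id},pr^{23}_3}\circ(\mathrm{id}\boxtimes u_l)\circ a=m_{pr^{12}_1,\mathrm{id}}\circ(u_r\boxtimes\mathrm{id})$ on $(A_1\boxtimes\mathbf{1}_{S_2})\boxtimes A_3$; $m_{\mathrm{id},pr^{23}_2}\circ(\mathrm{id}\boxtimes u_r)\circ a=u_r$ on $(A_1\boxtimes A_2)\boxtimes\mathbf{1}_{S_3}$. For $c,u$: $\mathbf{1}_{S_1}\boxtimes B_2\xrightarrow{c}\tau^*(B_2\boxtimes\mathbf{1}_{S_1})\xrightarrow{u_r}\tau^*pr^{21,*}_2B_2=pr^{12,*}_2B_2$ equals $u_l$. An equivalence $e:(\boxtimes',m')\to(\boxtimes,m)$ is a family of natural isomorphisms $e_{S_1,S_2}:A_1\boxtimes'A_2\to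 A_1\boxtimes A_2$ with $(f_1\times f_2)^*(e)\circ m'_{f_1,f_2}=m_{f_1,f_2}\circ e$. In the associative case one also requires $a\circ e\circ(e\boxtimes'\mathrm{id})=e\circ(\mathrm{id}\boxtimes'e)\circ a'$; in the symmetric case $c\circ e=\tau^*(e)\circ c'$; in the unitary case the equivalence also includes an isomorphism of unit sections $w:\mathbf{1}'\to\mathbf{1}$ with $u_r\circ e\circ(\mathrm{id}\boxtimes'w_{S_2})=u'_r$ and $u_l\circ e\circ(w_{S_1}\boxtimes'\mathrm{id})=u'_l$. **The bijection between equivalence classes.** It is induced by the following constructions, which are mutually inverse up to canonical equivalence. From internal to external ($E$): $A_1\boxtimes A_2:=pr^{12,*}_1A_1\otimes pr^{12,*}_2A_2$; the external monoidality isomorphism is $pr_1^{12,*}f_1^*A_1\otimes pr_2^{12,*}f_2^*A_2=(f_1\times f_2)^*pr_1^{12,*}A_1\otimes(f_1\times f_2)^*pr_2^{12,*}A_2\xrightarrow{m}(f_1\times f_2)^*(A_1\boxtimes A_2)$; the associativity constraint is the composite of the inverse of $(pr^{123,*}_1A_1\otimes pr^{123,*}_2A_2)\otimes pr^{123,*}_3A_3\xrightarrow{m}pr^{123,*}_{12}(pr^{12,*}_1A_1\otimes pr^{12,*}_2A_2)\otimes pr^{123,*}_3A_3=(A_1\boxtimes A_2)\boxtimes A_3$, of $a$, and of $pr^{123,*}_1A_1\otimes(pr^{123,*}_2A_2\otimes pr^{123,*}_3A_3)\xrightarrow{m}pr^{123,*}_1A_1\otimes pr^{123,*}_{23}(pr^{23,*}_2A_2\otimes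 pr^{23,*}_3A_3)=A_1\boxtimes(A_2\boxtimes A_3)$; the commutativity constraint is $pr^{12,*}_1A_1\otimes pr^{12,*}_2A_2=\tau^*pr^{21,*}_1A_1\otimes\tau^*pr^{21,*}_2A_2\xrightarrow{c}\tau^*pr^{21,*}_2A_2\otimes\tau^*pr^{21,*}_1A_1\xrightarrow{m}\tau^*(A_2\boxtimes A_1)$; the unit section is unchanged, with $pr_1^{12,*}A_1\otimes pr_2^{12,*}\mathbf{1}_{S_2}\xrightarrow{\mathbf{1}^*}pr_1^{12,*}A_1\otimes\mathbf{1}_{S_1\times S_2}\xrightarrow{u_r}pr_1^{12,*}A_1$ and $pr_1^{12,*}\mathbf{1}_{S_1}\otimes pr_2^{12,*}A_2\xrightarrow{\mathbf{1}^*}\mathbf{1}_{S_1\times S_2}\otimes pr_2^{12,*}A_2\xrightarrow{u_l}pr_2^{12,*}A_2$. From external to internal ($I$): $A\otimes B:=\Delta_S^*(A\boxtimes B)$; the internal monoidality isomorphism is $\Delta_T^*(f^*A\boxtimes f^*B)\xrightarrow{m}\Delta_T^*(f\times f)^*(A\boxtimes B)=f^*\Delta_S^*(A\boxtimes B)$; the associativity constraint is $\Delta_S^*(\Delta_S^*(A\boxtimes B)\boxtimes C)\xrightarrow{m}\Delta_S^*(\Delta_S\times\mathrm{id}_S)^*((A\boxtimes B)\boxtimes C)=\Delta_S^{(3),*}((A\boxtimes B)\boxtimes C)\xrightarrow{a}\Delta_S^{(3),*}(A\boxtimes(B\boxtimes C))=\Delta_S^*(\mathrm{id}_S\times\Delta_S)^*(A\boxtimes(B\boxtimes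 C))\xrightarrow{m^{-1}}\Delta_S^*(A\boxtimes\Delta_S^*(B\boxtimes C))$; the commutativity constraint is $\Delta_S^*(A\boxtimes B)\xrightarrow{c}\Delta_S^*\tau^*(B\boxtimes A)=\Delta_S^*(B\boxtimes A)$; the unit section is unchanged, with $\Delta_S^*(A\boxtimes\mathbf{1}_S)\xrightarrow{u_r}\Delta_S^*pr_1^{12,*}A=A$ and $\Delta_S^*(\mathbf{1}_S\boxtimes B)\xrightarrow{u_l}\Delta_S^*pr_2^{12,*}B=B$. Thus $(\boxtimes_j,m_j^e)$ corresponds to $(\otimes_j,m_j^i)$ when it is equivalent (respecting the constraints considered) to $E(\otimes_j,m_j^i)$, or, what is the same, when $I(\boxtimes_j,m_j^e)$ is equivalent to $(\otimes_j,m_j^i)$. The bijections in the claim are taken relative to the equivalences witnessing this correspondence. **Tensor structures on $R$.** An internal tensor structure $\rho$ on $R$ with respect to $(\otimes_1,m_1)$ and $(\otimes_2,m_2)$ is a family of natural isomorphisms $\rho_S:R_S(A)\otimes_2R_S(B)\to R_S(A\otimes_1B)$ such that, for $f:T\to S$, $\theta_f\circ f^*(\rho_S)\circ m_{2,f}=R_T(m_{1,f})\circ\rho_T\circ(\theta_f\otimes_2\theta_f)$. It is associative if $R_S(a_1)\circ\rho\circ(\rho\otimes_2\mathrm{id})=\rho\circ(\mathrm{id}\otimes_2\rho)\circ a_2$; symmetric if $R_S(c_1)\circ\rho=\rho\circ c_2$; unitary via an isomorphism of sections $w:R(\mathbf{1}^{(1)})\to\mathbf{1}^{(2)}$ (where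 $\mathbf{1}^{(j)}$ is the unit section on $\mathbb{H}_j$) if $u_{2,r}\circ(\mathrm{id}\otimes_2w_S)=R_S(u_{1,r})\circ\rho$ and $u_{2,l}\circ(w_S\otimes_2\mathrm{id})=R_S(u_{1,l})\circ\rho$. An external tensor structure $\rho$ on $R$ with respect to $(\boxtimes_1,m_1)$ and $(\boxtimes_2,m_2)$ is a family of natural isomorphisms $\rho_{S_1,S_2}:R_{S_1}(A_1)\boxtimes_2R_{S_2}(A_2)\to R_{S_1\times S_2}(A_1\boxtimes_1A_2)$ such that, for $f_i:T_i\to S_i$, $\theta_{f_1\times f_2}\circ(f_1\times f_2)^*(\rho)\circ m_2=R_{T_1\times T_2}(m_1)\circ\rho\circ(\theta_{f_1}\boxtimes_2\theta_{f_2})$. It is associative if $R(a_1)\circ\rho\circ(\rho\boxtimes_2\mathrm{id})=\rho\circ(\mathrm{id}\boxtimes_2\rho)\circ a_2$; symmetric if $R(c_1)\circ\rho=\theta_\tau\circ\tau^*(\rho)\circ c_2$; unitary via an isomorphism of sections $w:R(\mathbf{1}^{(1)})\to\mathbf{1}^{(2)}$ if $\theta_{pr^{12}_1}\circ u_{2,r}\circ(\mathrm{id}\boxtimes_2w_{S_2})=R(u_{1,r})\circ\rho$ and $\theta_{pr^{12}_2}\circ u_{2,l}\circ(w_{S_1}\boxtimes_2\mathrm{id})=R(u_{1,l})\circ\rho$. "Unitary" in the claim means unitary via a fixed $w$, the same on the internal and external sides when the unit sections coincide, and otherwise transported along the isomorphisms of unit sections contained in the witnessing equivalences. *)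

theory Defs
  imports Main
begin

section \<open>Categories\<close>

record ('o, 'm) cat =
  Obj :: "'o set"
  Arr :: "'m set"
  Dom :: "'m \<Rightarrow> 'o"
  Cod :: "'m \<Rightarrow> 'o"
  Idm :: "'o \<Rightarrow> 'm"
  Cmp :: "'m \<Rightarrow> 'm \<Rightarrow> 'm"  (infixr "\<cdot>\<index>" 70)

definition hom :: "('o, 'm, 'z) cat_scheme \<Rightarrow> 'o \<Rightarrow> 'o \<Rightarrow> 'm set" where
  "hom C X Y = {f \<in> Arr C. Dom C f = X \<and> Cod C f = Y}"

locale category =
  fixes C :: "('o, 'm, 'z) cat_scheme"
  assumes dom_obj: "f \<in> Arr C \<Longrightarrow> Dom C f \<in> Obj C"
    and cod_obj: "f \<in> Arr C \<Longrightarrow> Cod C f \<in> Obj C"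
    and id_hom: "X \<in> Obj C \<Longrightarrow> Idm C X \<in> hom C X X"
    and comp_hom: "\<lbrakk>f \<in> hom C X Y; g \<in> hom C Y Z\<rbrakk> \<Longrightarrow> g \<cdot>\<^bsub>C\<^esub> f \<in> hom C X Z"
    and id_left: "f \<in> hom C X Y \<Longrightarrow> Idm C Y \<cdot>\<^bsub>C\<^esub> f = f"
    and id_right: "f \<in> hom C X Y \<Longrightarrow> f \<cdot>\<^bsub>C\<^esub> Idm C X = f"
    and comp_assoc: "\<lbrakk>f \<in> hom C W X; g \<in> hom C X Y; h \<in> hom C Y Z\<rbrakk>
      \<Longrightarrow> (h \<cdot>\<^bsub>C\<^esub> g) \<cdot>\<^bsub>C\<^esub> f = h \<cdot>\<^bsub>C\<^esub> (g \<cdot>\<^bsub>C\<^esub> f)"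

definition inverse_of :: "('o, 'm, 'z) cat_scheme \<Rightarrow> 'm \<Rightarrow> 'm \<Rightarrow> bool" where
  "inverse_of C f g \<longleftrightarrow> f \<in> Arr C \<and> g \<in> hom C (Cod C f) (Dom C f)
     \<and> g \<cdot>\<^bsub>C\<^esub> f = Idm C (Dom C f) \<and> f \<cdot>\<^bsub>C\<^esub> g = Idm C (Cod C f)"

definition iso :: "('o, 'm, 'z) cat_scheme \<Rightarrow> 'o \<Rightarrow> 'o \<Rightarrow> 'm set" where
  "iso C X Y = {f \<in> hom C X Y. \<exists>g. inverse_of C f g}"

definition inv_arr :: "('o, 'm, 'z) cat_scheme \<Rightarrow> 'm \<Rightarrow> 'm" where
  "inv_arr C f = (THE g. inverse_of C f g)"

definition prod_cat :: "('o, 'm) cat \<Rightarrow> ('p, 'n) cat \<Rightarrow> ('o \<times> 'p, 'm \<times> 'n) cat" where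
  "prod_cat C D = \<lparr>Obj = Obj C \<times> Obj D, Arr = Arr C \<times> Arr D,
     Dom = (\<lambda>(f, g). (Dom C f, Dom D g)), Cod = (\<lambda>(f, g). (Cod C f, Cod D g)),
     Idm = (\<lambda>(X, Y). (Idm C X, Idm D Y)),
     Cmp = (\<lambda>(f', g') (f, g). (f' \<cdot>\<^bsub>C\<^esub> f, g' \<cdot>\<^bsub>D\<^esub> g))\<rparr>"

definition is_functor :: "('o, 'm) cat \<Rightarrow> ('p, 'n) cat \<Rightarrow> ('o \<Rightarrow> 'p) \<Rightarrow> ('m \<Rightarrow> 'n) \<Rightarrow> bool" where
  "is_functor C D FO FA \<longleftrightarrow>
     (\<forall>X \<in> Obj C. FO X \<in> Obj D \<and> FA (Idm C X) = Idm D (FO X)) \<and>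
     (\<forall>X Y. \<forall>f \<in> hom C X Y. FA f \<in> hom D (FO X) (FO Y)) \<and>
     (\<forall>X Y Z. \<forall>f \<in> hom C X Y. \<forall>g \<in> hom C Y Z. FA (g \<cdot>\<^bsub>C\<^esub> f) = FA g \<cdot>\<^bsub>D\<^esub> FA f)"

definition is_natural_iso :: "('o, 'm) cat \<Rightarrow> ('p, 'n) cat \<Rightarrow> ('o \<Rightarrow> 'p) \<Rightarrow> ('m \<Rightarrow> 'n) \<Rightarrow>
    ('o \<Rightarrow> 'p) \<Rightarrow> ('m \<Rightarrow> 'n) \<Rightarrow> ('o \<Rightarrow> 'n) \<Rightarrow> bool" where
  "is_natural_iso C D FO FA GO GA \<eta> \<longleftrightarrow>
     (\<forall>X \<in> Obj C. \<eta> X \<in> iso D (FO X) (GO X)) \<and>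
     (\<forall>X Y. \<forall>f \<in> hom C X Y. GA f \<cdot>\<^bsub>D\<^esub> \<eta> X = \<eta> Y \<cdot>\<^bsub>D\<^esub> FA f)"


section \<open>Base category with binary products\<close>

record ('o, 'm) pcat = "('o, 'm) cat" +
  prd :: "'o \<Rightarrow> 'o \<Rightarrow> 'o"
  prj1 :: "'o \<Rightarrow> 'o \<Rightarrow> 'm"
  prj2 :: "'o \<Rightarrow> 'o \<Rightarrow> 'm"

locale category_with_products = category B for B :: "('o, 'm) pcat" +
  assumes prd_obj: "\<lbrakk>S1 \<in> Obj B; S2 \<in> Obj B\<rbrakk> \<Longrightarrow> prd B S1 S2 \<in> Obj B"
    and prj1_hom: "\<lbrakk>S1 \<in> Obj B; S2 \<in> Obj B\<rbrakk> \<Longrightarrow> prj1 B S1 S2 \<in> hom B (prd B S1 S2) S1"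
    and prj2_hom: "\<lbrakk>S1 \<in> Obj B; S2 \<in> Obj B\<rbrakk> \<Longrightarrow> prj2 B S1 S2 \<in> hom B (prd B S1 S2) S2"
    and prd_universal: "\<lbrakk>f1 \<in> hom B T S1; f2 \<in> hom B T S2\<rbrakk> \<Longrightarrow>
      \<exists>!h. h \<in> hom B T (prd B S1 S2) \<and> prj1 B S1 S2 \<cdot>\<^bsub>B\<^esub> h = f1 \<and> prj2 B S1 S2 \<cdot>\<^bsub>B\<^esub> h = f2"

definition tuple :: "('o, 'm) pcat \<Rightarrow> 'm \<Rightarrow> 'm \<Rightarrow> 'm" where
  "tuple B f1 f2 = (THE h. h \<in> hom B (Dom B f1) (prd B (Cod B f1) (Cod B f2))
     \<and> prj1 B (Cod B f1) (Cod B f2) \<cdot>\<^bsub>B\<^esub> h = f1 \<and> prj2 B (Cod B f1) (Cod B f2) \<cdot>\<^bsub>B\<^esub> h = f2)"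

definition cross :: "('o, 'm) pcat \<Rightarrow> 'm \<Rightarrow> 'm \<Rightarrow> 'm" where
  "cross B f1 f2 = tuple B (f1 \<cdot>\<^bsub>B\<^esub> prj1 B (Dom B f1) (Dom B f2)) (f2 \<cdot>\<^bsub>B\<^esub> prj2 B (Dom B f1) (Dom B f2))"

definition diag :: "('o, 'm) pcat \<Rightarrow> 'o \<Rightarrow> 'm" where
  "diag B S = tuple B (Idm B S) (Idm B S)"

definition perm :: "('o, 'm) pcat \<Rightarrow> 'o \<Rightarrow> 'o \<Rightarrow> 'm" where
  "perm B S1 S2 = tuple B (prj2 B S1 S2) (prj1 B S1 S2)"

definition reassoc :: "('o, 'm) pcat \<Rightarrow> 'o \<Rightarrow> 'o \<Rightarrow> 'o \<Rightarrow> 'm" where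
  \<comment> \<open>\<open>(S1 \<times> S2) \<times> S3 \<rightarrow> S1 \<times> (S2 \<times> S3)\<close>; iterated products are identified along it, and
    \<open>S1 \<times> S2 \<times> S3\<close> is realised as \<open>(S1 \<times> S2) \<times> S3\<close>.\<close>
  "reassoc B S1 S2 S3 =
     tuple B (prj1 B S1 S2 \<cdot>\<^bsub>B\<^esub> prj1 B (prd B S1 S2) S3)
       (tuple B (prj2 B S1 S2 \<cdot>\<^bsub>B\<^esub> prj1 B (prd B S1 S2) S3) (prj2 B (prd B S1 S2) S3))"


section \<open>Fibered categories, sections, morphisms\<close>

record ('o, 'm, 'x, 'h) fibcat =
  Fib :: "'o \<Rightarrow> ('x, 'h) cat"
  pbO :: "'m \<Rightarrow> 'x \<Rightarrow> 'x"
  pbA :: "'m \<Rightarrow> 'h \<Rightarrow> 'h"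
  conn :: "'m \<Rightarrow> 'm \<Rightarrow> 'x \<Rightarrow> 'h"

locale fibered_category = category_with_products B
  for B :: "('o, 'm) pcat" and H :: "('o, 'm, 'x, 'h) fibcat" +
  assumes fib_category: "S \<in> Obj B \<Longrightarrow> category (Fib H S)"
    and pb_functor: "f \<in> hom B T S \<Longrightarrow> is_functor (Fib H S) (Fib H T) (pbO H f) (pbA H f)"
    and pb_id_obj: "\<lbrakk>S \<in> Obj B; A \<in> Obj (Fib H S)\<rbrakk> \<Longrightarrow> pbO H (Idm B S) A = A"
    and pb_id_arr: "\<lbrakk>S \<in> Obj B; u \<in> Arr (Fib H S)\<rbrakk> \<Longrightarrow> pbA H (Idm B S) u = u"
    and conn_natural: "\<lbrakk>f \<in> hom B T S; g \<in> hom B S V\<rbrakk> \<Longrightarrow>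
      is_natural_iso (Fib H V) (Fib H T) (pbO H (g \<cdot>\<^bsub>B\<^esub> f)) (pbA H (g \<cdot>\<^bsub>B\<^esub> f))
        (\<lambda>A. pbO H f (pbO H g A)) (\<lambda>u. pbA H f (pbA H g u)) (conn H f g)"
    and conn_cocycle: "\<lbrakk>f \<in> hom B T S; g \<in> hom B S V; h \<in> hom B V W; A \<in> Obj (Fib H W)\<rbrakk> \<Longrightarrow>
      pbA H f (conn H g h A) \<cdot>\<^bsub>Fib H T\<^esub> conn H f (h \<cdot>\<^bsub>B\<^esub> g) A
        = conn H f g (pbO H h A) \<cdot>\<^bsub>Fib H T\<^esub> conn H (g \<cdot>\<^bsub>B\<^esub> f) h A"

text \<open>
  Identifications are spelled out through the connection isomorphisms. The axioms give
  \<open>conn id h = conn id id\<close> and \<open>conn f id = f\<^sup>*(conn id id)\<close> on objects, but they do not force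
  \<open>conn id id\<close> to be the identity. The identification of \<open>A\<close> with \<open>id\<^sup>* A\<close> that is coherent with the
  other ones is therefore \<open>conn id id A\<close>; it is the identity arrow for a normalised connection.
\<close>

definition idn :: "('o, 'm) pcat \<Rightarrow> ('o, 'm, 'x, 'h) fibcat \<Rightarrow> 'o \<Rightarrow> 'x \<Rightarrow> 'h" where
  "idn B H S A = conn H (Idm B S) (Idm B S) A"

definition swap :: "('o, 'm) pcat \<Rightarrow> ('o, 'm, 'x, 'h) fibcat \<Rightarrow> 'm \<Rightarrow> 'm \<Rightarrow> 'm \<Rightarrow> 'm \<Rightarrow> 'x \<Rightarrow> 'h" where
  \<comment> \<open>\<open>f\<^sup>* g\<^sup>* A = f'\<^sup>* g'\<^sup>* A\<close>, for \<open>g \<circ> f = g' \<circ> f'\<close>\<close>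
  "swap B H f g f' g' A =
     conn H f' g' A \<cdot>\<^bsub>Fib H (Dom B f)\<^esub> inv_arr (Fib H (Dom B f)) (conn H f g A)"

definition conn3 :: "('o, 'm) pcat \<Rightarrow> ('o, 'm, 'x, 'h) fibcat \<Rightarrow> 'm \<Rightarrow> 'm \<Rightarrow> 'm \<Rightarrow> 'x \<Rightarrow> 'h" where
  \<comment> \<open>\<open>(h \<circ> g \<circ> f)\<^sup>* A = f\<^sup>* g\<^sup>* h\<^sup>* A\<close>\<close>
  "conn3 B H f g h A =
     pbA H f (conn H g h A) \<cdot>\<^bsub>Fib H (Dom B f)\<^esub> conn H f (h \<cdot>\<^bsub>B\<^esub> g) A"

record ('o, 'm, 'x, 'h) sect =
  secO :: "'o \<Rightarrow> 'x"
  secA :: "'m \<Rightarrow> 'h"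

locale fib_section = fibered_category B H
  for B :: "('o, 'm) pcat" and H :: "('o, 'm, 'x, 'h) fibcat" +
  fixes A :: "('o, 'm, 'x, 'h) sect"
  assumes sec_obj: "S \<in> Obj B \<Longrightarrow> secO A S \<in> Obj (Fib H S)"
    and sec_iso: "f \<in> hom B T S \<Longrightarrow> secA A f \<in> iso (Fib H T) (pbO H f (secO A S)) (secO A T)"
    and sec_comp: "\<lbrakk>f \<in> hom B T S; g \<in> hom B S V\<rbrakk> \<Longrightarrow>
      secA A (g \<cdot>\<^bsub>B\<^esub> f)
        = secA A f \<cdot>\<^bsub>Fib H T\<^esub> pbA H f (secA A g) \<cdot>\<^bsub>Fib H T\<^esub> conn H f g (secO A V)"

definition section_iso :: "('o, 'm) pcat \<Rightarrow> ('o, 'm, 'x, 'h) fibcat \<Rightarrow>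
    ('o, 'm, 'x, 'h) sect \<Rightarrow> ('o, 'm, 'x, 'h) sect \<Rightarrow> ('o \<Rightarrow> 'h) \<Rightarrow> bool" where
  "section_iso B H A A' w \<longleftrightarrow>
     (\<forall>S \<in> Obj B. w S \<in> iso (Fib H S) (secO A S) (secO A' S)) \<and>
     (\<forall>T S. \<forall>f \<in> hom B T S.
        secA A' f \<cdot>\<^bsub>Fib H T\<^esub> pbA H f (w S) = w T \<cdot>\<^bsub>Fib H T\<^esub> secA A f)"

record ('o, 'm, 'x1, 'h1, 'x2, 'h2) fibmor =
  morO :: "'o \<Rightarrow> 'x1 \<Rightarrow> 'x2"
  morA :: "'o \<Rightarrow> 'h1 \<Rightarrow> 'h2"
  theta :: "'m \<Rightarrow> 'x1 \<Rightarrow> 'h2"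

locale fibered_morphism = H1: fibered_category B H1 + H2: fibered_category B H2
  for B :: "('o, 'm) pcat" and H1 :: "('o, 'm, 'x1, 'h1) fibcat"
    and H2 :: "('o, 'm, 'x2, 'h2) fibcat" +
  fixes R :: "('o, 'm, 'x1, 'h1, 'x2, 'h2) fibmor"
  assumes mor_functor: "S \<in> Obj B \<Longrightarrow> is_functor (Fib H1 S) (Fib H2 S) (morO R S) (morA R S)"
    and theta_natural: "f \<in> hom B T S \<Longrightarrow>
      is_natural_iso (Fib H1 S) (Fib H2 T)
        (\<lambda>A. pbO H2 f (morO R S A)) (\<lambda>h. pbA H2 f (morA R S h))
        (\<lambda>A. morO R T (pbO H1 f A)) (\<lambda>h. morA R T (pbA H1 f h)) (theta R f)"
    and theta_comp: "\<lbrakk>f \<in> hom B T S; g \<in> hom B S V; A \<in> Obj (Fib H1 V)\<rbrakk> \<Longrightarrow>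
      morA R T (conn H1 f g A) \<cdot>\<^bsub>Fib H2 T\<^esub> theta R (g \<cdot>\<^bsub>B\<^esub> f) A
        = theta R f (pbO H1 g A) \<cdot>\<^bsub>Fib H2 T\<^esub> pbA H2 f (theta R g A)
            \<cdot>\<^bsub>Fib H2 T\<^esub> conn H2 f g (morO R V A)"

definition image_section :: "('o, 'm) pcat \<Rightarrow> ('o, 'm, 'x2, 'h2) fibcat \<Rightarrow>
    ('o, 'm, 'x1, 'h1, 'x2, 'h2) fibmor \<Rightarrow> ('o, 'm, 'x1, 'h1) sect \<Rightarrow> ('o, 'm, 'x2, 'h2) sect" where
  "image_section B H2 R A = \<lparr>secO = (\<lambda>S. morO R S (secO A S)),
     secA = (\<lambda>f. morA R (Dom B f) (secA A f) \<cdot>\<^bsub>Fib H2 (Dom B f)\<^esub> theta R f (secO A (Cod B f)))\<rparr>"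


section \<open>Internal tensor structures\<close>

record ('o, 'm, 'x, 'h) itensor =
  itO :: "'o \<Rightarrow> 'x \<Rightarrow> 'x \<Rightarrow> 'x"
  itA :: "'o \<Rightarrow> 'h \<Rightarrow> 'h \<Rightarrow> 'h"
  itM :: "'m \<Rightarrow> 'x \<Rightarrow> 'x \<Rightarrow> 'h"
  itAss :: "'o \<Rightarrow> 'x \<Rightarrow> 'x \<Rightarrow> 'x \<Rightarrow> 'h"
  itCom :: "'o \<Rightarrow> 'x \<Rightarrow> 'x \<Rightarrow> 'h"
  itUnit :: "('o, 'm, 'x, 'h) sect"
  itUr :: "'o \<Rightarrow> 'x \<Rightarrow> 'h"
  itUl :: "'o \<Rightarrow> 'x \<Rightarrow> 'h"

locale internal_tensor = fibered_category B H
  for B :: "('o, 'm) pcat" and H :: "('o, 'm, 'x, 'h) fibcat" +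
  fixes T :: "('o, 'm, 'x, 'h) itensor"
  assumes it_functor: "S \<in> Obj B \<Longrightarrow>
      is_functor (prod_cat (Fib H S) (Fib H S)) (Fib H S)
        (\<lambda>(A, A'). itO T S A A') (\<lambda>(h, h'). itA T S h h')"
    and it_mon_natural: "f \<in> hom B S' S \<Longrightarrow>
      is_natural_iso (prod_cat (Fib H S) (Fib H S)) (Fib H S')
        (\<lambda>(A, A'). itO T S' (pbO H f A) (pbO H f A')) (\<lambda>(h, h'). itA T S' (pbA H f h) (pbA H f h'))
        (\<lambda>(A, A'). pbO H f (itO T S A A')) (\<lambda>(h, h'). pbA H f (itA T S h h'))
        (\<lambda>(A, A'). itM T f A A')"
    and it_mon_comp: "\<lbrakk>f \<in> hom B S' S; g \<in> hom B S V; A \<in> Obj (Fib H V); A' \<in> Obj (Fib H V)\<rbrakk> \<Longrightarrow>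
      conn H f g (itO T V A A') \<cdot>\<^bsub>Fib H S'\<^esub> itM T (g \<cdot>\<^bsub>B\<^esub> f) A A'
        = pbA H f (itM T g A A') \<cdot>\<^bsub>Fib H S'\<^esub> itM T f (pbO H g A) (pbO H g A')
            \<cdot>\<^bsub>Fib H S'\<^esub> itA T S' (conn H f g A) (conn H f g A')"

definition itensor_associative :: "('o, 'm) pcat \<Rightarrow> ('o, 'm, 'x, 'h) fibcat \<Rightarrow>
    ('o, 'm, 'x, 'h) itensor \<Rightarrow> bool" where
  "itensor_associative B H T \<longleftrightarrow>
     (\<forall>S \<in> Obj B.
        is_natural_iso (prod_cat (Fib H S) (prod_cat (Fib H S) (Fib H S))) (Fib H S)
          (\<lambda>(A1, A2, A3). itO T S (itO T S A1 A2) A3) (\<lambda>(h1, h2, h3). itA T S (itA T S h1 h2) h3)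
          (\<lambda>(A1, A2, A3). itO T S A1 (itO T S A2 A3)) (\<lambda>(h1, h2, h3). itA T S h1 (itA T S h2 h3))
          (\<lambda>(A1, A2, A3). itAss T S A1 A2 A3)) \<and>
     (\<forall>S \<in> Obj B. \<forall>A1 \<in> Obj (Fib H S). \<forall>A2 \<in> Obj (Fib H S). \<forall>A3 \<in> Obj (Fib H S). \<forall>A4 \<in> Obj (Fib H S).
        itAss T S A1 A2 (itO T S A3 A4) \<cdot>\<^bsub>Fib H S\<^esub> itAss T S (itO T S A1 A2) A3 A4
          = itA T S (Idm (Fib H S) A1) (itAss T S A2 A3 A4)
              \<cdot>\<^bsub>Fib H S\<^esub> itAss T S A1 (itO T S A2 A3) A4
              \<cdot>\<^bsub>Fib H S\<^esub> itA T S (itAss T S A1 A2 A3) (Idm (Fib H S) A4)) \<and>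
     (\<forall>S' S. \<forall>f \<in> hom B S' S. \<forall>A1 \<in> Obj (Fib H S). \<forall>A2 \<in> Obj (Fib H S). \<forall>A3 \<in> Obj (Fib H S).
        pbA H f (itAss T S A1 A2 A3)
            \<cdot>\<^bsub>Fib H S'\<^esub> itM T f (itO T S A1 A2) A3
            \<cdot>\<^bsub>Fib H S'\<^esub> itA T S' (itM T f A1 A2) (Idm (Fib H S') (pbO H f A3))
          = itM T f A1 (itO T S A2 A3)
              \<cdot>\<^bsub>Fib H S'\<^esub> itA T S' (Idm (Fib H S') (pbO H f A1)) (itM T f A2 A3)
              \<cdot>\<^bsub>Fib H S'\<^esub> itAss T S' (pbO H f A1) (pbO H f A2) (pbO H f A3))"

definition itensor_symmetric :: "('o, 'm) pcat \<Rightarrow> ('o, 'm, 'x, 'h) fibcat \<Rightarrow>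
    ('o, 'm, 'x, 'h) itensor \<Rightarrow> bool" where
  "itensor_symmetric B H T \<longleftrightarrow>
     (\<forall>S \<in> Obj B.
        is_natural_iso (prod_cat (Fib H S) (Fib H S)) (Fib H S)
          (\<lambda>(A, A'). itO T S A A') (\<lambda>(h, h'). itA T S h h')
          (\<lambda>(A, A'). itO T S A' A) (\<lambda>(h, h'). itA T S h' h)
          (\<lambda>(A, A'). itCom T S A A')) \<and>
     (\<forall>S \<in> Obj B. \<forall>A1 \<in> Obj (Fib H S). \<forall>A2 \<in> Obj (Fib H S).
        itCom T S A2 A1 \<cdot>\<^bsub>Fib H S\<^esub> itCom T S A1 A2 = Idm (Fib H S) (itO T S A1 A2)) \<and>
     (\<forall>S' S. \<forall>f \<in> hom B S' S. \<forall>A1 \<in> Obj (Fib H S). \<forall>A2 \<in> Obj (Fib H S).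
        pbA H f (itCom T S A1 A2) \<cdot>\<^bsub>Fib H S'\<^esub> itM T f A1 A2
          = itM T f A2 A1 \<cdot>\<^bsub>Fib H S'\<^esub> itCom T S' (pbO H f A1) (pbO H f A2))"

definition itensor_unitary :: "('o, 'm) pcat \<Rightarrow> ('o, 'm, 'x, 'h) fibcat \<Rightarrow>
    ('o, 'm, 'x, 'h) itensor \<Rightarrow> bool" where
  "itensor_unitary B H T \<longleftrightarrow>
     fib_section B H (itUnit T) \<and>
     (\<forall>S \<in> Obj B.
        is_natural_iso (Fib H S) (Fib H S)
          (\<lambda>A. itO T S A (secO (itUnit T) S))
          (\<lambda>h. itA T S h (Idm (Fib H S) (secO (itUnit T) S)))
          (\<lambda>A. A) (\<lambda>h. h) (itUr T S) \<and>
        is_natural_iso (Fib H S) (Fib H S)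
          (\<lambda>A. itO T S (secO (itUnit T) S) A)
          (\<lambda>h. itA T S (Idm (Fib H S) (secO (itUnit T) S)) h)
          (\<lambda>A. A) (\<lambda>h. h) (itUl T S) \<and>
        itUr T S (secO (itUnit T) S) = itUl T S (secO (itUnit T) S)) \<and>
     (\<forall>S' S. \<forall>f \<in> hom B S' S. \<forall>A \<in> Obj (Fib H S).
        pbA H f (itUr T S A) \<cdot>\<^bsub>Fib H S'\<^esub> itM T f A (secO (itUnit T) S)
          = itUr T S' (pbO H f A)
              \<cdot>\<^bsub>Fib H S'\<^esub> itA T S' (Idm (Fib H S') (pbO H f A)) (secA (itUnit T) f) \<and>
        pbA H f (itUl T S A) \<cdot>\<^bsub>Fib H S'\<^esub> itM T f (secO (itUnit T) S) A
          = itUl T S' (pbO H f A)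
              \<cdot>\<^bsub>Fib H S'\<^esub> itA T S' (secA (itUnit T) f) (Idm (Fib H S') (pbO H f A)))"

definition itensor_compat_ac :: "('o, 'm) pcat \<Rightarrow> ('o, 'm, 'x, 'h) fibcat \<Rightarrow>
    ('o, 'm, 'x, 'h) itensor \<Rightarrow> bool" where
  "itensor_compat_ac B H T \<longleftrightarrow>
     (\<forall>S \<in> Obj B. \<forall>A1 \<in> Obj (Fib H S). \<forall>A2 \<in> Obj (Fib H S). \<forall>A3 \<in> Obj (Fib H S).
        itA T S (Idm (Fib H S) A2) (itCom T S A1 A3)
            \<cdot>\<^bsub>Fib H S\<^esub> itAss T S A2 A1 A3
            \<cdot>\<^bsub>Fib H S\<^esub> itA T S (itCom T S A1 A2) (Idm (Fib H S) A3)
          = itAss T S A2 A3 A1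
              \<cdot>\<^bsub>Fib H S\<^esub> itCom T S A1 (itO T S A2 A3)
              \<cdot>\<^bsub>Fib H S\<^esub> itAss T S A1 A2 A3)"

definition itensor_compat_au :: "('o, 'm) pcat \<Rightarrow> ('o, 'm, 'x, 'h) fibcat \<Rightarrow>
    ('o, 'm, 'x, 'h) itensor \<Rightarrow> bool" where
  "itensor_compat_au B H T \<longleftrightarrow>
     (\<forall>S \<in> Obj B. \<forall>A \<in> Obj (Fib H S). \<forall>A' \<in> Obj (Fib H S).
        itUl T S (itO T S A A') \<cdot>\<^bsub>Fib H S\<^esub> itAss T S (secO (itUnit T) S) A A'
          = itA T S (itUl T S A) (Idm (Fib H S) A') \<and>
        itA T S (Idm (Fib H S) A) (itUl T S A') \<cdot>\<^bsub>Fib H S\<^esub> itAss T S A (secO (itUnit T) S) A'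
          = itA T S (itUr T S A) (Idm (Fib H S) A') \<and>
        itA T S (Idm (Fib H S) A) (itUr T S A') \<cdot>\<^bsub>Fib H S\<^esub> itAss T S A A' (secO (itUnit T) S)
          = itUr T S (itO T S A A'))"

definition itensor_compat_cu :: "('o, 'm) pcat \<Rightarrow> ('o, 'm, 'x, 'h) fibcat \<Rightarrow>
    ('o, 'm, 'x, 'h) itensor \<Rightarrow> bool" where
  "itensor_compat_cu B H T \<longleftrightarrow>
     (\<forall>S \<in> Obj B. \<forall>A \<in> Obj (Fib H S).
        itUr T S A \<cdot>\<^bsub>Fib H S\<^esub> itCom T S (secO (itUnit T) S) A = itUl T S A)"

text \<open>
  The flags say which of the bracketed properties (associative, symmetric, unitary) are considered;
  the record fields of a constraint that is not considered are arbitrary.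
\<close>

definition internal_structure :: "bool \<Rightarrow> bool \<Rightarrow> bool \<Rightarrow> ('o, 'm) pcat \<Rightarrow>
    ('o, 'm, 'x, 'h) fibcat \<Rightarrow> ('o, 'm, 'x, 'h) itensor \<Rightarrow> bool" where
  "internal_structure ass com uni B H T \<longleftrightarrow>
     internal_tensor B H T \<and>
     (ass \<longrightarrow> itensor_associative B H T) \<and>
     (com \<longrightarrow> itensor_symmetric B H T) \<and>
     (uni \<longrightarrow> itensor_unitary B H T) \<and>
     (ass \<and> com \<longrightarrow> itensor_compat_ac B H T) \<and>
     (ass \<and> uni \<longrightarrow> itensor_compat_au B H T) \<and>
     (com \<and> uni \<longrightarrow> itensor_compat_cu B H T)"


section \<open>External tensor structures\<close>

record ('o, 'm, 'x, 'h) etensor =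
  etO :: "'o \<Rightarrow> 'o \<Rightarrow> 'x \<Rightarrow> 'x \<Rightarrow> 'x"
  etA :: "'o \<Rightarrow> 'o \<Rightarrow> 'h \<Rightarrow> 'h \<Rightarrow> 'h"
  etM :: "'m \<Rightarrow> 'm \<Rightarrow> 'x \<Rightarrow> 'x \<Rightarrow> 'h"
  etAss :: "'o \<Rightarrow> 'o \<Rightarrow> 'o \<Rightarrow> 'x \<Rightarrow> 'x \<Rightarrow> 'x \<Rightarrow> 'h"
  etCom :: "'o \<Rightarrow> 'o \<Rightarrow> 'x \<Rightarrow> 'x \<Rightarrow> 'h"
  etUnit :: "('o, 'm, 'x, 'h) sect"
  etUr :: "'o \<Rightarrow> 'o \<Rightarrow> 'x \<Rightarrow> 'h"
  etUl :: "'o \<Rightarrow> 'o \<Rightarrow> 'x \<Rightarrow> 'h"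

locale external_tensor = fibered_category B H
  for B :: "('o, 'm) pcat" and H :: "('o, 'm, 'x, 'h) fibcat" +
  fixes X :: "('o, 'm, 'x, 'h) etensor"
  assumes et_functor: "\<lbrakk>S1 \<in> Obj B; S2 \<in> Obj B\<rbrakk> \<Longrightarrow>
      is_functor (prod_cat (Fib H S1) (Fib H S2)) (Fib H (prd B S1 S2))
        (\<lambda>(A1, A2). etO X S1 S2 A1 A2) (\<lambda>(h1, h2). etA X S1 S2 h1 h2)"
    and et_mon_natural: "\<lbrakk>f1 \<in> hom B T1 S1; f2 \<in> hom B T2 S2\<rbrakk> \<Longrightarrow>
      is_natural_iso (prod_cat (Fib H S1) (Fib H S2)) (Fib H (prd B T1 T2))
        (\<lambda>(A1, A2). etO X T1 T2 (pbO H f1 A1) (pbO H f2 A2))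
        (\<lambda>(h1, h2). etA X T1 T2 (pbA H f1 h1) (pbA H f2 h2))
        (\<lambda>(A1, A2). pbO H (cross B f1 f2) (etO X S1 S2 A1 A2))
        (\<lambda>(h1, h2). pbA H (cross B f1 f2) (etA X S1 S2 h1 h2))
        (\<lambda>(A1, A2). etM X f1 f2 A1 A2)"
    and et_mon_comp: "\<lbrakk>f1 \<in> hom B T1 S1; g1 \<in> hom B S1 V1; f2 \<in> hom B T2 S2; g2 \<in> hom B S2 V2;
        A1 \<in> Obj (Fib H V1); A2 \<in> Obj (Fib H V2)\<rbrakk> \<Longrightarrow>
      conn H (cross B f1 f2) (cross B g1 g2) (etO X V1 V2 A1 A2)
          \<cdot>\<^bsub>Fib H (prd B T1 T2)\<^esub> etM X (g1 \<cdot>\<^bsub>B\<^esub> f1) (g2 \<cdot>\<^bsub>B\<^esub> f2) A1 A2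
        = pbA H (cross B f1 f2) (etM X g1 g2 A1 A2)
            \<cdot>\<^bsub>Fib H (prd B T1 T2)\<^esub> etM X f1 f2 (pbO H g1 A1) (pbO H g2 A2)
            \<cdot>\<^bsub>Fib H (prd B T1 T2)\<^esub> etA X T1 T2 (conn H f1 g1 A1) (conn H f2 g2 A2)"

definition etM_id_right :: "('o, 'm) pcat \<Rightarrow> ('o, 'm, 'x, 'h) fibcat \<Rightarrow>
    ('o, 'm, 'x, 'h) etensor \<Rightarrow> 'm \<Rightarrow> 'o \<Rightarrow> 'x \<Rightarrow> 'x \<Rightarrow> 'h" where
  \<comment> \<open>\<open>m_{f,id} : f\<^sup>* A1 \<boxtimes> A2 \<rightarrow> (f \<times> id)\<^sup>* (A1 \<boxtimes> A2)\<close>, for \<open>A2\<close> over \<open>S\<close>\<close>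
  "etM_id_right B H X f S A1 A2 =
     etM X f (Idm B S) A1 A2
       \<cdot>\<^bsub>Fib H (prd B (Dom B f) S)\<^esub>
     etA X (Dom B f) S (Idm (Fib H (Dom B f)) (pbO H f A1)) (idn B H S A2)"

definition etM_id_left :: "('o, 'm) pcat \<Rightarrow> ('o, 'm, 'x, 'h) fibcat \<Rightarrow>
    ('o, 'm, 'x, 'h) etensor \<Rightarrow> 'o \<Rightarrow> 'm \<Rightarrow> 'x \<Rightarrow> 'x \<Rightarrow> 'h" where
  \<comment> \<open>\<open>m_{id,f} : A1 \<boxtimes> f\<^sup>* A2 \<rightarrow> (id \<times> f)\<^sup>* (A1 \<boxtimes> A2)\<close>, for \<open>A1\<close> over \<open>S\<close>\<close>
  "etM_id_left B H X S f A1 A2 =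
     etM X (Idm B S) f A1 A2
       \<cdot>\<^bsub>Fib H (prd B S (Dom B f))\<^esub>
     etA X S (Dom B f) (idn B H S A1) (Idm (Fib H (Dom B f)) (pbO H f A2))"

text \<open>
  The associativity constraint is an isomorphism
  \<open>(A1 \<boxtimes> A2) \<boxtimes> A3 \<rightarrow> reassoc\<^sup>* (A1 \<boxtimes> (A2 \<boxtimes> A3))\<close> over \<open>(S1 \<times> S2) \<times> S3\<close>.
\<close>

definition etensor_associative :: "('o, 'm) pcat \<Rightarrow> ('o, 'm, 'x, 'h) fibcat \<Rightarrow>
    ('o, 'm, 'x, 'h) etensor \<Rightarrow> bool" where
  "etensor_associative B H X \<longleftrightarrow>
     (\<forall>S1 \<in> Obj B. \<forall>S2 \<in> Obj B. \<forall>S3 \<in> Obj B.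
        is_natural_iso (prod_cat (Fib H S1) (prod_cat (Fib H S2) (Fib H S3)))
          (Fib H (prd B (prd B S1 S2) S3))
          (\<lambda>(A1, A2, A3). etO X (prd B S1 S2) S3 (etO X S1 S2 A1 A2) A3)
          (\<lambda>(h1, h2, h3). etA X (prd B S1 S2) S3 (etA X S1 S2 h1 h2) h3)
          (\<lambda>(A1, A2, A3). pbO H (reassoc B S1 S2 S3) (etO X S1 (prd B S2 S3) A1 (etO X S2 S3 A2 A3)))
          (\<lambda>(h1, h2, h3). pbA H (reassoc B S1 S2 S3) (etA X S1 (prd B S2 S3) h1 (etA X S2 S3 h2 h3)))
          (\<lambda>(A1, A2, A3). etAss X S1 S2 S3 A1 A2 A3)) \<and>
     (\<forall>S1 \<in> Obj B. \<forall>S2 \<in> Obj B. \<forall>S3 \<in> Obj B. \<forall>S4 \<in> Obj B.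
      \<forall>A1 \<in> Obj (Fib H S1). \<forall>A2 \<in> Obj (Fib H S2). \<forall>A3 \<in> Obj (Fib H S3). \<forall>A4 \<in> Obj (Fib H S4).
        let D = Fib H (prd B (prd B (prd B S1 S2) S3) S4);
            p1 = reassoc B (prd B S1 S2) S3 S4;
            p2 = reassoc B S1 S2 (prd B S3 S4);
            q1 = cross B (reassoc B S1 S2 S3) (Idm B S4);
            q2 = reassoc B S1 (prd B S2 S3) S4;
            q3 = cross B (Idm B S1) (reassoc B S2 S3 S4);
            Z = etO X S1 (prd B S2 (prd B S3 S4)) A1 (etO X S2 (prd B S3 S4) A2 (etO X S3 S4 A3 A4))
        in inv_arr D (conn H p1 p2 Z)
             \<cdot>\<^bsub>D\<^esub> pbA H p1 (etAss X S1 S2 (prd B S3 S4) A1 A2 (etO X S3 S4 A3 A4))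
             \<cdot>\<^bsub>D\<^esub> etAss X (prd B S1 S2) S3 S4 (etO X S1 S2 A1 A2) A3 A4
           = inv_arr D (conn3 B H q1 q2 q3 Z)
             \<cdot>\<^bsub>D\<^esub> pbA H q1 (pbA H q2
                 (etM_id_left B H X S1 (reassoc B S2 S3 S4) A1
                   (etO X S2 (prd B S3 S4) A2 (etO X S3 S4 A3 A4))))
             \<cdot>\<^bsub>D\<^esub> pbA H q1 (pbA H q2
                 (etA X S1 (prd B (prd B S2 S3) S4) (Idm (Fib H S1) A1) (etAss X S2 S3 S4 A2 A3 A4)))
             \<cdot>\<^bsub>D\<^esub> pbA H q1 (etAss X S1 (prd B S2 S3) S4 A1 (etO X S2 S3 A2 A3) A4)
             \<cdot>\<^bsub>D\<^esub> etM_id_right B H X (reassoc B S1 S2 S3) S4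
                 (etO X S1 (prd B S2 S3) A1 (etO X S2 S3 A2 A3)) A4
             \<cdot>\<^bsub>D\<^esub> etA X (prd B (prd B S1 S2) S3) S4 (etAss X S1 S2 S3 A1 A2 A3) (Idm (Fib H S4) A4)) \<and>
     (\<forall>T1 S1 T2 S2 T3 S3. \<forall>f1 \<in> hom B T1 S1. \<forall>f2 \<in> hom B T2 S2. \<forall>f3 \<in> hom B T3 S3.
      \<forall>A1 \<in> Obj (Fib H S1). \<forall>A2 \<in> Obj (Fib H S2). \<forall>A3 \<in> Obj (Fib H S3).
        let D = Fib H (prd B (prd B T1 T2) T3);
            r = reassoc B T1 T2 T3;
            r' = reassoc B S1 S2 S3
        in pbA H (cross B (cross B f1 f2) f3) (etAss X S1 S2 S3 A1 A2 A3)
             \<cdot>\<^bsub>D\<^esub> etM X (cross B f1 f2) f3 (etO X S1 S2 A1 A2) A3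
             \<cdot>\<^bsub>D\<^esub> etA X (prd B T1 T2) T3 (etM X f1 f2 A1 A2) (Idm (Fib H T3) (pbO H f3 A3))
           = swap B H r (cross B f1 (cross B f2 f3)) (cross B (cross B f1 f2) f3) r'
                 (etO X S1 (prd B S2 S3) A1 (etO X S2 S3 A2 A3))
             \<cdot>\<^bsub>D\<^esub> pbA H r (etM X f1 (cross B f2 f3) A1 (etO X S2 S3 A2 A3))
             \<cdot>\<^bsub>D\<^esub> pbA H r (etA X T1 (prd B T2 T3) (Idm (Fib H T1) (pbO H f1 A1)) (etM X f2 f3 A2 A3))
             \<cdot>\<^bsub>D\<^esub> etAss X T1 T2 T3 (pbO H f1 A1) (pbO H f2 A2) (pbO H f3 A3))"

definition etensor_symmetric :: "('o, 'm) pcat \<Rightarrow> ('o, 'm, 'x, 'h) fibcat \<Rightarrow>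
    ('o, 'm, 'x, 'h) etensor \<Rightarrow> bool" where
  "etensor_symmetric B H X \<longleftrightarrow>
     (\<forall>S1 \<in> Obj B. \<forall>S2 \<in> Obj B.
        is_natural_iso (prod_cat (Fib H S1) (Fib H S2)) (Fib H (prd B S1 S2))
          (\<lambda>(A1, A2). etO X S1 S2 A1 A2) (\<lambda>(h1, h2). etA X S1 S2 h1 h2)
          (\<lambda>(A1, A2). pbO H (perm B S1 S2) (etO X S2 S1 A2 A1))
          (\<lambda>(h1, h2). pbA H (perm B S1 S2) (etA X S2 S1 h2 h1))
          (\<lambda>(A1, A2). etCom X S1 S2 A1 A2)) \<and>
     (\<forall>S1 \<in> Obj B. \<forall>S2 \<in> Obj B. \<forall>A1 \<in> Obj (Fib H S1). \<forall>A2 \<in> Obj (Fib H S2).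
        let D = Fib H (prd B S1 S2)
        in pbA H (perm B S1 S2) (etCom X S2 S1 A2 A1) \<cdot>\<^bsub>D\<^esub> etCom X S1 S2 A1 A2
           = conn H (perm B S1 S2) (perm B S2 S1) (etO X S1 S2 A1 A2)
             \<cdot>\<^bsub>D\<^esub> idn B H (prd B S1 S2) (etO X S1 S2 A1 A2)) \<and>
     (\<forall>T1 S1 T2 S2. \<forall>f1 \<in> hom B T1 S1. \<forall>f2 \<in> hom B T2 S2.
      \<forall>A1 \<in> Obj (Fib H S1). \<forall>A2 \<in> Obj (Fib H S2).
        let D = Fib H (prd B T1 T2)
        in pbA H (cross B f1 f2) (etCom X S1 S2 A1 A2) \<cdot>\<^bsub>D\<^esub> etM X f1 f2 A1 A2
           = swap B H (perm B T1 T2) (cross B f2 f1) (cross B f1 f2) (perm B S1 S2) (etO X S2 S1 A2 A1)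
             \<cdot>\<^bsub>D\<^esub> pbA H (perm B T1 T2) (etM X f2 f1 A2 A1)
             \<cdot>\<^bsub>D\<^esub> etCom X T1 T2 (pbO H f1 A1) (pbO H f2 A2))"

definition etensor_unitary :: "('o, 'm) pcat \<Rightarrow> ('o, 'm, 'x, 'h) fibcat \<Rightarrow>
    ('o, 'm, 'x, 'h) etensor \<Rightarrow> bool" where
  "etensor_unitary B H X \<longleftrightarrow>
     fib_section B H (etUnit X) \<and>
     (\<forall>S1 \<in> Obj B. \<forall>S2 \<in> Obj B.
        is_natural_iso (Fib H S1) (Fib H (prd B S1 S2))
          (\<lambda>A. etO X S1 S2 A (secO (etUnit X) S2))
          (\<lambda>h. etA X S1 S2 h (Idm (Fib H S2) (secO (etUnit X) S2)))
          (pbO H (prj1 B S1 S2)) (pbA H (prj1 B S1 S2)) (etUr X S1 S2) \<and>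
        is_natural_iso (Fib H S2) (Fib H (prd B S1 S2))
          (\<lambda>A. etO X S1 S2 (secO (etUnit X) S1) A)
          (\<lambda>h. etA X S1 S2 (Idm (Fib H S1) (secO (etUnit X) S1)) h)
          (pbO H (prj2 B S1 S2)) (pbA H (prj2 B S1 S2)) (etUl X S1 S2) \<and>
        secA (etUnit X) (prj1 B S1 S2) \<cdot>\<^bsub>Fib H (prd B S1 S2)\<^esub> etUr X S1 S2 (secO (etUnit X) S1)
          = secA (etUnit X) (prj2 B S1 S2)
              \<cdot>\<^bsub>Fib H (prd B S1 S2)\<^esub> etUl X S1 S2 (secO (etUnit X) S2)) \<and>
     (\<forall>T1 S1 T2 S2. \<forall>f1 \<in> hom B T1 S1. \<forall>f2 \<in> hom B T2 S2.
        let D = Fib H (prd B T1 T2)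
        in (\<forall>A1 \<in> Obj (Fib H S1).
              pbA H (cross B f1 f2) (etUr X S1 S2 A1) \<cdot>\<^bsub>D\<^esub> etM X f1 f2 A1 (secO (etUnit X) S2)
                = swap B H (prj1 B T1 T2) f1 (cross B f1 f2) (prj1 B S1 S2) A1
                  \<cdot>\<^bsub>D\<^esub> etUr X T1 T2 (pbO H f1 A1)
                  \<cdot>\<^bsub>D\<^esub> etA X T1 T2 (Idm (Fib H T1) (pbO H f1 A1)) (secA (etUnit X) f2)) \<and>
           (\<forall>A2 \<in> Obj (Fib H S2).
              pbA H (cross B f1 f2) (etUl X S1 S2 A2) \<cdot>\<^bsub>D\<^esub> etM X f1 f2 (secO (etUnit X) S1) A2
                = swap B H (prj2 B T1 T2) f2 (cross B f1 f2) (prj2 B S1 S2) A2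
                  \<cdot>\<^bsub>D\<^esub> etUl X T1 T2 (pbO H f2 A2)
                  \<cdot>\<^bsub>D\<^esub> etA X T1 T2 (secA (etUnit X) f1) (Idm (Fib H T2) (pbO H f2 A2))))"

definition etensor_compat_ac :: "('o, 'm) pcat \<Rightarrow> ('o, 'm, 'x, 'h) fibcat \<Rightarrow>
    ('o, 'm, 'x, 'h) etensor \<Rightarrow> bool" where
  "etensor_compat_ac B H X \<longleftrightarrow>
     (\<forall>S1 \<in> Obj B. \<forall>S2 \<in> Obj B. \<forall>S3 \<in> Obj B.
      \<forall>A1 \<in> Obj (Fib H S1). \<forall>A2 \<in> Obj (Fib H S2). \<forall>A3 \<in> Obj (Fib H S3).
        let D = Fib H (prd B (prd B S1 S2) S3);
            p1 = cross B (perm B S1 S2) (Idm B S3);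
            p2 = reassoc B S2 S1 S3;
            p3 = cross B (Idm B S2) (perm B S1 S3);
            q1 = reassoc B S1 S2 S3;
            q2 = perm B S1 (prd B S2 S3);
            q3 = reassoc B S2 S3 S1;
            Z = etO X S2 (prd B S3 S1) A2 (etO X S3 S1 A3 A1)
        in inv_arr D (conn3 B H p1 p2 p3 Z)
             \<cdot>\<^bsub>D\<^esub> pbA H p1 (pbA H p2
                 (etM_id_left B H X S2 (perm B S1 S3) A2 (etO X S3 S1 A3 A1)))
             \<cdot>\<^bsub>D\<^esub> pbA H p1 (pbA H p2
                 (etA X S2 (prd B S1 S3) (Idm (Fib H S2) A2) (etCom X S1 S3 A1 A3)))
             \<cdot>\<^bsub>D\<^esub> pbA H p1 (etAss X S2 S1 S3 A2 A1 A3)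
             \<cdot>\<^bsub>D\<^esub> etM_id_right B H X (perm B S1 S2) S3 (etO X S2 S1 A2 A1) A3
             \<cdot>\<^bsub>D\<^esub> etA X (prd B S1 S2) S3 (etCom X S1 S2 A1 A2) (Idm (Fib H S3) A3)
           = inv_arr D (conn3 B H q1 q2 q3 Z)
             \<cdot>\<^bsub>D\<^esub> pbA H q1 (pbA H q2 (etAss X S2 S3 S1 A2 A3 A1))
             \<cdot>\<^bsub>D\<^esub> pbA H q1 (etCom X S1 (prd B S2 S3) A1 (etO X S2 S3 A2 A3))
             \<cdot>\<^bsub>D\<^esub> etAss X S1 S2 S3 A1 A2 A3)"

definition etensor_compat_au :: "('o, 'm) pcat \<Rightarrow> ('o, 'm, 'x, 'h) fibcat \<Rightarrow>
    ('o, 'm, 'x, 'h) etensor \<Rightarrow> bool" where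
  "etensor_compat_au B H X \<longleftrightarrow>
     (\<forall>S1 \<in> Obj B. \<forall>S2 \<in> Obj B. \<forall>S3 \<in> Obj B.
        let D = Fib H (prd B (prd B S1 S2) S3);
            r = reassoc B S1 S2 S3;
            U = secO (etUnit X)
        in (\<forall>A2 \<in> Obj (Fib H S2). \<forall>A3 \<in> Obj (Fib H S3).
              pbA H r (etUl X S1 (prd B S2 S3) (etO X S2 S3 A2 A3)) \<cdot>\<^bsub>D\<^esub> etAss X S1 S2 S3 (U S1) A2 A3
                = conn H r (prj2 B S1 (prd B S2 S3)) (etO X S2 S3 A2 A3)
                  \<cdot>\<^bsub>D\<^esub> etM_id_right B H X (prj2 B S1 S2) S3 A2 A3
                  \<cdot>\<^bsub>D\<^esub> etA X (prd B S1 S2) S3 (etUl X S1 S2 A2) (Idm (Fib H S3) A3)) \<and>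
           (\<forall>A1 \<in> Obj (Fib H S1). \<forall>A3 \<in> Obj (Fib H S3).
              pbA H r (etM_id_left B H X S1 (prj2 B S2 S3) A1 A3)
                  \<cdot>\<^bsub>D\<^esub> pbA H r (etA X S1 (prd B S2 S3) (Idm (Fib H S1) A1) (etUl X S2 S3 A3))
                  \<cdot>\<^bsub>D\<^esub> etAss X S1 S2 S3 A1 (U S2) A3
                = conn H r (cross B (Idm B S1) (prj2 B S2 S3)) (etO X S1 S3 A1 A3)
                  \<cdot>\<^bsub>D\<^esub> etM_id_right B H X (prj1 B S1 S2) S3 A1 A3
                  \<cdot>\<^bsub>D\<^esub> etA X (prd B S1 S2) S3 (etUr X S1 S2 A1) (Idm (Fib H S3) A3)) \<and>
           (\<forall>A1 \<in> Obj (Fib H S1). \<forall>A2 \<in> Obj (Fib H S2).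
              pbA H r (etM_id_left B H X S1 (prj1 B S2 S3) A1 A2)
                  \<cdot>\<^bsub>D\<^esub> pbA H r (etA X S1 (prd B S2 S3) (Idm (Fib H S1) A1) (etUr X S2 S3 A2))
                  \<cdot>\<^bsub>D\<^esub> etAss X S1 S2 S3 A1 A2 (U S3)
                = conn H r (cross B (Idm B S1) (prj1 B S2 S3)) (etO X S1 S2 A1 A2)
                  \<cdot>\<^bsub>D\<^esub> etUr X (prd B S1 S2) S3 (etO X S1 S2 A1 A2)))"

definition etensor_compat_cu :: "('o, 'm) pcat \<Rightarrow> ('o, 'm, 'x, 'h) fibcat \<Rightarrow>
    ('o, 'm, 'x, 'h) etensor \<Rightarrow> bool" where
  "etensor_compat_cu B H X \<longleftrightarrow>
     (\<forall>S1 \<in> Obj B. \<forall>S2 \<in> Obj B. \<forall>A2 \<in> Obj (Fib H S2).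
        let D = Fib H (prd B S1 S2)
        in pbA H (perm B S1 S2) (etUr X S2 S1 A2) \<cdot>\<^bsub>D\<^esub> etCom X S1 S2 (secO (etUnit X) S1) A2
           = conn H (perm B S1 S2) (prj1 B S2 S1) A2 \<cdot>\<^bsub>D\<^esub> etUl X S1 S2 A2)"

definition external_structure :: "bool \<Rightarrow> bool \<Rightarrow> bool \<Rightarrow> ('o, 'm) pcat \<Rightarrow>
    ('o, 'm, 'x, 'h) fibcat \<Rightarrow> ('o, 'm, 'x, 'h) etensor \<Rightarrow> bool" where
  "external_structure ass com uni B H X \<longleftrightarrow>
     external_tensor B H X \<and>
     (ass \<longrightarrow> etensor_associative B H X) \<and>
     (com \<longrightarrow> etensor_symmetric B H X) \<and>
     (uni \<longrightarrow> etensor_unitary B H X) \<and>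
     (ass \<and> com \<longrightarrow> etensor_compat_ac B H X) \<and>
     (ass \<and> uni \<longrightarrow> etensor_compat_au B H X) \<and>
     (com \<and> uni \<longrightarrow> etensor_compat_cu B H X)"

definition external_equivalence :: "bool \<Rightarrow> bool \<Rightarrow> bool \<Rightarrow> ('o, 'm) pcat \<Rightarrow>
    ('o, 'm, 'x, 'h) fibcat \<Rightarrow> ('o, 'm, 'x, 'h) etensor \<Rightarrow> ('o, 'm, 'x, 'h) etensor \<Rightarrow>
    ('o \<Rightarrow> 'o \<Rightarrow> 'x \<Rightarrow> 'x \<Rightarrow> 'h) \<Rightarrow> ('o \<Rightarrow> 'h) \<Rightarrow> bool" where
  \<comment> \<open>\<open>e\<close>, together with \<open>v\<close> on unit sections, is an equivalence from \<open>X'\<close> to \<open>X\<close>\<close>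
  "external_equivalence ass com uni B H X' X e v \<longleftrightarrow>
     (\<forall>S1 \<in> Obj B. \<forall>S2 \<in> Obj B.
        is_natural_iso (prod_cat (Fib H S1) (Fib H S2)) (Fib H (prd B S1 S2))
          (\<lambda>(A1, A2). etO X' S1 S2 A1 A2) (\<lambda>(h1, h2). etA X' S1 S2 h1 h2)
          (\<lambda>(A1, A2). etO X S1 S2 A1 A2) (\<lambda>(h1, h2). etA X S1 S2 h1 h2)
          (\<lambda>(A1, A2). e S1 S2 A1 A2)) \<and>
     (\<forall>T1 S1 T2 S2. \<forall>f1 \<in> hom B T1 S1. \<forall>f2 \<in> hom B T2 S2.
      \<forall>A1 \<in> Obj (Fib H S1). \<forall>A2 \<in> Obj (Fib H S2).
        let D = Fib H (prd B T1 T2)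
        in pbA H (cross B f1 f2) (e S1 S2 A1 A2) \<cdot>\<^bsub>D\<^esub> etM X' f1 f2 A1 A2
           = etM X f1 f2 A1 A2 \<cdot>\<^bsub>D\<^esub> e T1 T2 (pbO H f1 A1) (pbO H f2 A2)) \<and>
     (ass \<longrightarrow>
       (\<forall>S1 \<in> Obj B. \<forall>S2 \<in> Obj B. \<forall>S3 \<in> Obj B.
        \<forall>A1 \<in> Obj (Fib H S1). \<forall>A2 \<in> Obj (Fib H S2). \<forall>A3 \<in> Obj (Fib H S3).
          let D = Fib H (prd B (prd B S1 S2) S3);
              r = reassoc B S1 S2 S3
          in etAss X S1 S2 S3 A1 A2 A3
               \<cdot>\<^bsub>D\<^esub> e (prd B S1 S2) S3 (etO X S1 S2 A1 A2) A3
               \<cdot>\<^bsub>D\<^esub> etA X' (prd B S1 S2) S3 (e S1 S2 A1 A2) (Idm (Fib H S3) A3)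
             = pbA H r (e S1 (prd B S2 S3) A1 (etO X S2 S3 A2 A3))
               \<cdot>\<^bsub>D\<^esub> pbA H r (etA X' S1 (prd B S2 S3) (Idm (Fib H S1) A1) (e S2 S3 A2 A3))
               \<cdot>\<^bsub>D\<^esub> etAss X' S1 S2 S3 A1 A2 A3)) \<and>
     (com \<longrightarrow>
       (\<forall>S1 \<in> Obj B. \<forall>S2 \<in> Obj B. \<forall>A1 \<in> Obj (Fib H S1). \<forall>A2 \<in> Obj (Fib H S2).
          let D = Fib H (prd B S1 S2)
          in etCom X S1 S2 A1 A2 \<cdot>\<^bsub>D\<^esub> e S1 S2 A1 A2
             = pbA H (perm B S1 S2) (e S2 S1 A2 A1) \<cdot>\<^bsub>D\<^esub> etCom X' S1 S2 A1 A2)) \<and>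
     (uni \<longrightarrow>
       section_iso B H (etUnit X') (etUnit X) v \<and>
       (\<forall>S1 \<in> Obj B. \<forall>S2 \<in> Obj B.
          let D = Fib H (prd B S1 S2)
          in (\<forall>A1 \<in> Obj (Fib H S1).
                etUr X S1 S2 A1 \<cdot>\<^bsub>D\<^esub> e S1 S2 A1 (secO (etUnit X) S2)
                    \<cdot>\<^bsub>D\<^esub> etA X' S1 S2 (Idm (Fib H S1) A1) (v S2)
                  = etUr X' S1 S2 A1) \<and>
             (\<forall>A2 \<in> Obj (Fib H S2).
                etUl X S1 S2 A2 \<cdot>\<^bsub>D\<^esub> e S1 S2 (secO (etUnit X) S1) A2
                    \<cdot>\<^bsub>D\<^esub> etA X' S1 S2 (v S1) (Idm (Fib H S2) A2)
                  = etUl X' S1 S2 A2)))"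


section \<open>From internal to external tensor structures\<close>

definition E_ass :: "('o, 'm) pcat \<Rightarrow> ('o, 'm, 'x, 'h) fibcat \<Rightarrow> ('o, 'm, 'x, 'h) itensor \<Rightarrow>
    'o \<Rightarrow> 'o \<Rightarrow> 'o \<Rightarrow> 'x \<Rightarrow> 'x \<Rightarrow> 'x \<Rightarrow> 'h" where
  "E_ass B H T S1 S2 S3 A1 A2 A3 =
     (let P = prd B (prd B S1 S2) S3; D = Fib H P;
          p12 = prj1 B (prd B S1 S2) S3; p3 = prj2 B (prd B S1 S2) S3;
          q1 = prj1 B S1 S2; q2 = prj2 B S1 S2;
          r = reassoc B S1 S2 S3; s1 = prj1 B S1 (prd B S2 S3); p23 = prj2 B S1 (prd B S2 S3) \<cdot>\<^bsub>B\<^esub> r;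
          t2 = prj1 B S2 S3; t3 = prj2 B S2 S3;
          X1 = pbO H (q1 \<cdot>\<^bsub>B\<^esub> p12) A1; X2 = pbO H (q2 \<cdot>\<^bsub>B\<^esub> p12) A2; X3 = pbO H p3 A3;
          A12 = itO T (prd B S1 S2) (pbO H q1 A1) (pbO H q2 A2);
          A23 = itO T (prd B S2 S3) (pbO H t2 A2) (pbO H t3 A3);
          \<mu> = itA T P (itM T p12 (pbO H q1 A1) (pbO H q2 A2)) (Idm D X3)
                \<cdot>\<^bsub>D\<^esub> itA T P (itA T P (conn H p12 q1 A1) (conn H p12 q2 A2)) (Idm D X3);
          \<nu> = itA T P (Idm D X1) (itM T p23 (pbO H t2 A2) (pbO H t3 A3))
                \<cdot>\<^bsub>D\<^esub> itA T P (Idm D X1) (itA T P (conn H p23 t2 A2) (conn H p23 t3 A3));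
          \<alpha> = itM T r (pbO H s1 A1) (pbO H (prj2 B S1 (prd B S2 S3)) A23)
                \<cdot>\<^bsub>D\<^esub> itA T P (conn H r s1 A1) (conn H r (prj2 B S1 (prd B S2 S3)) A23)
      in \<alpha> \<cdot>\<^bsub>D\<^esub> \<nu> \<cdot>\<^bsub>D\<^esub> itAss T P X1 X2 X3 \<cdot>\<^bsub>D\<^esub> inv_arr D \<mu>)"

text \<open>
  In \<open>E_ass\<close>, \<open>\<alpha>\<close> is the identification of \<open>X1 \<otimes> p23\<^sup>* A23\<close> with \<open>A1 \<boxtimes> (A2 \<boxtimes> A3)\<close> along
  \<open>reassoc\<close>.
\<close>

definition E_ext :: "('o, 'm) pcat \<Rightarrow> ('o, 'm, 'x, 'h) fibcat \<Rightarrow> ('o, 'm, 'x, 'h) itensor \<Rightarrow>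
    ('o, 'm, 'x, 'h) etensor" where
  "E_ext B H T = \<lparr>
     etO = (\<lambda>S1 S2 A1 A2. itO T (prd B S1 S2) (pbO H (prj1 B S1 S2) A1) (pbO H (prj2 B S1 S2) A2)),
     etA = (\<lambda>S1 S2 h1 h2. itA T (prd B S1 S2) (pbA H (prj1 B S1 S2) h1) (pbA H (prj2 B S1 S2) h2)),
     etM = (\<lambda>f1 f2 A1 A2.
       let T1 = Dom B f1; T2 = Dom B f2; S1 = Cod B f1; S2 = Cod B f2
       in itM T (cross B f1 f2) (pbO H (prj1 B S1 S2) A1) (pbO H (prj2 B S1 S2) A2)
            \<cdot>\<^bsub>Fib H (prd B T1 T2)\<^esub>
          itA T (prd B T1 T2)
            (swap B H (prj1 B T1 T2) f1 (cross B f1 f2) (prj1 B S1 S2) A1)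
            (swap B H (prj2 B T1 T2) f2 (cross B f1 f2) (prj2 B S1 S2) A2)),
     etAss = E_ass B H T,
     etCom = (\<lambda>S1 S2 A1 A2.
       let P = prd B S1 S2; t = perm B S1 S2; q1 = prj1 B S2 S1; q2 = prj2 B S2 S1
       in itM T t (pbO H q1 A2) (pbO H q2 A1)
            \<cdot>\<^bsub>Fib H P\<^esub> itCom T P (pbO H t (pbO H q2 A1)) (pbO H t (pbO H q1 A2))
            \<cdot>\<^bsub>Fib H P\<^esub> itA T P (conn H t q2 A1) (conn H t q1 A2)),
     etUnit = itUnit T,
     etUr = (\<lambda>S1 S2 A1.
       let P = prd B S1 S2; X1 = pbO H (prj1 B S1 S2) A1
       in itUr T P X1
            \<cdot>\<^bsub>Fib H P\<^esub> itA T P (Idm (Fib H P) X1) (secA (itUnit T) (prj2 B S1 S2))),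
     etUl = (\<lambda>S1 S2 A2.
       let P = prd B S1 S2; X2 = pbO H (prj2 B S1 S2) A2
       in itUl T P X2
            \<cdot>\<^bsub>Fib H P\<^esub> itA T P (secA (itUnit T) (prj1 B S1 S2)) (Idm (Fib H P) X2))\<rparr>"


section \<open>Tensor structures on a morphism\<close>

text \<open>
  A tensor structure on \<open>R\<close> is a family indexed by objects of the fibers. It is represented by a
  function on the ambient types that is \<open>undefined\<close> outside the index range, so that
  equality of functions is equality of families.
\<close>

definition internal_tensor_structures_on :: "bool \<Rightarrow> bool \<Rightarrow> bool \<Rightarrow> ('o, 'm) pcat \<Rightarrow>
    ('o, 'm, 'x1, 'h1) fibcat \<Rightarrow> ('o, 'm, 'x2, 'h2) fibcat \<Rightarrow> ('o, 'm, 'x1, 'h1, 'x2, 'h2) fibmor \<Rightarrow>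
    ('o, 'm, 'x1, 'h1) itensor \<Rightarrow> ('o, 'm, 'x2, 'h2) itensor \<Rightarrow> ('o \<Rightarrow> 'h2) \<Rightarrow>
    ('o \<Rightarrow> 'x1 \<Rightarrow> 'x1 \<Rightarrow> 'h2) set" where
  "internal_tensor_structures_on ass com uni B H1 H2 R T1 T2 w = {\<rho>.
     (\<forall>S A A'. \<not> (S \<in> Obj B \<and> A \<in> Obj (Fib H1 S) \<and> A' \<in> Obj (Fib H1 S)) \<longrightarrow> \<rho> S A A' = undefined) \<and>
     (\<forall>S \<in> Obj B.
        is_natural_iso (prod_cat (Fib H1 S) (Fib H1 S)) (Fib H2 S)
          (\<lambda>(A, A'). itO T2 S (morO R S A) (morO R S A')) (\<lambda>(g, h). itA T2 S (morA R S g) (morA R S h))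
          (\<lambda>(A, A'). morO R S (itO T1 S A A')) (\<lambda>(g, h). morA R S (itA T1 S g h))
          (\<lambda>(A, A'). \<rho> S A A')) \<and>
     (\<forall>T S. \<forall>f \<in> hom B T S. \<forall>A \<in> Obj (Fib H1 S). \<forall>A' \<in> Obj (Fib H1 S).
        theta R f (itO T1 S A A')
            \<cdot>\<^bsub>Fib H2 T\<^esub> pbA H2 f (\<rho> S A A')
            \<cdot>\<^bsub>Fib H2 T\<^esub> itM T2 f (morO R S A) (morO R S A')
          = morA R T (itM T1 f A A')
              \<cdot>\<^bsub>Fib H2 T\<^esub> \<rho> T (pbO H1 f A) (pbO H1 f A')
              \<cdot>\<^bsub>Fib H2 T\<^esub> itA T2 T (theta R f A) (theta R f A')) \<and>
     (ass \<longrightarrow>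
       (\<forall>S \<in> Obj B. \<forall>A1 \<in> Obj (Fib H1 S). \<forall>A2 \<in> Obj (Fib H1 S). \<forall>A3 \<in> Obj (Fib H1 S).
          morA R S (itAss T1 S A1 A2 A3)
              \<cdot>\<^bsub>Fib H2 S\<^esub> \<rho> S (itO T1 S A1 A2) A3
              \<cdot>\<^bsub>Fib H2 S\<^esub> itA T2 S (\<rho> S A1 A2) (Idm (Fib H2 S) (morO R S A3))
            = \<rho> S A1 (itO T1 S A2 A3)
                \<cdot>\<^bsub>Fib H2 S\<^esub> itA T2 S (Idm (Fib H2 S) (morO R S A1)) (\<rho> S A2 A3)
                \<cdot>\<^bsub>Fib H2 S\<^esub> itAss T2 S (morO R S A1) (morO R S A2) (morO R S A3))) \<and>
     (com \<longrightarrow>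
       (\<forall>S \<in> Obj B. \<forall>A1 \<in> Obj (Fib H1 S). \<forall>A2 \<in> Obj (Fib H1 S).
          morA R S (itCom T1 S A1 A2) \<cdot>\<^bsub>Fib H2 S\<^esub> \<rho> S A1 A2
            = \<rho> S A2 A1 \<cdot>\<^bsub>Fib H2 S\<^esub> itCom T2 S (morO R S A1) (morO R S A2))) \<and>
     (uni \<longrightarrow>
       (\<forall>S \<in> Obj B. \<forall>A \<in> Obj (Fib H1 S).
          itUr T2 S (morO R S A) \<cdot>\<^bsub>Fib H2 S\<^esub> itA T2 S (Idm (Fib H2 S) (morO R S A)) (w S)
            = morA R S (itUr T1 S A) \<cdot>\<^bsub>Fib H2 S\<^esub> \<rho> S A (secO (itUnit T1) S) \<and>
          itUl T2 S (morO R S A) \<cdot>\<^bsub>Fib H2 S\<^esub> itA T2 S (w S) (Idm (Fib H2 S) (morO R S A))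
            = morA R S (itUl T1 S A) \<cdot>\<^bsub>Fib H2 S\<^esub> \<rho> S (secO (itUnit T1) S) A))}"

definition external_tensor_structures_on :: "bool \<Rightarrow> bool \<Rightarrow> bool \<Rightarrow> ('o, 'm) pcat \<Rightarrow>
    ('o, 'm, 'x1, 'h1) fibcat \<Rightarrow> ('o, 'm, 'x2, 'h2) fibcat \<Rightarrow> ('o, 'm, 'x1, 'h1, 'x2, 'h2) fibmor \<Rightarrow>
    ('o, 'm, 'x1, 'h1) etensor \<Rightarrow> ('o, 'm, 'x2, 'h2) etensor \<Rightarrow> ('o \<Rightarrow> 'h2) \<Rightarrow>
    ('o \<Rightarrow> 'o \<Rightarrow> 'x1 \<Rightarrow> 'x1 \<Rightarrow> 'h2) set" where
  "external_tensor_structures_on ass com uni B H1 H2 R X1 X2 w = {\<rho>.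
     (\<forall>S1 S2 A1 A2. \<not> (S1 \<in> Obj B \<and> S2 \<in> Obj B \<and> A1 \<in> Obj (Fib H1 S1) \<and> A2 \<in> Obj (Fib H1 S2))
        \<longrightarrow> \<rho> S1 S2 A1 A2 = undefined) \<and>
     (\<forall>S1 \<in> Obj B. \<forall>S2 \<in> Obj B.
        is_natural_iso (prod_cat (Fib H1 S1) (Fib H1 S2)) (Fib H2 (prd B S1 S2))
          (\<lambda>(A1, A2). etO X2 S1 S2 (morO R S1 A1) (morO R S2 A2))
          (\<lambda>(h1, h2). etA X2 S1 S2 (morA R S1 h1) (morA R S2 h2))
          (\<lambda>(A1, A2). morO R (prd B S1 S2) (etO X1 S1 S2 A1 A2))
          (\<lambda>(h1, h2). morA R (prd B S1 S2) (etA X1 S1 S2 h1 h2))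
          (\<lambda>(A1, A2). \<rho> S1 S2 A1 A2)) \<and>
     (\<forall>T1 S1 T2 S2. \<forall>f1 \<in> hom B T1 S1. \<forall>f2 \<in> hom B T2 S2.
      \<forall>A1 \<in> Obj (Fib H1 S1). \<forall>A2 \<in> Obj (Fib H1 S2).
        let D = Fib H2 (prd B T1 T2)
        in theta R (cross B f1 f2) (etO X1 S1 S2 A1 A2)
             \<cdot>\<^bsub>D\<^esub> pbA H2 (cross B f1 f2) (\<rho> S1 S2 A1 A2)
             \<cdot>\<^bsub>D\<^esub> etM X2 f1 f2 (morO R S1 A1) (morO R S2 A2)
           = morA R (prd B T1 T2) (etM X1 f1 f2 A1 A2)
             \<cdot>\<^bsub>D\<^esub> \<rho> T1 T2 (pbO H1 f1 A1) (pbO H1 f2 A2)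
             \<cdot>\<^bsub>D\<^esub> etA X2 T1 T2 (theta R f1 A1) (theta R f2 A2)) \<and>
     (ass \<longrightarrow>
       (\<forall>S1 \<in> Obj B. \<forall>S2 \<in> Obj B. \<forall>S3 \<in> Obj B.
        \<forall>A1 \<in> Obj (Fib H1 S1). \<forall>A2 \<in> Obj (Fib H1 S2). \<forall>A3 \<in> Obj (Fib H1 S3).
          let P = prd B (prd B S1 S2) S3; D = Fib H2 P; r = reassoc B S1 S2 S3
          in morA R P (etAss X1 S1 S2 S3 A1 A2 A3)
               \<cdot>\<^bsub>D\<^esub> \<rho> (prd B S1 S2) S3 (etO X1 S1 S2 A1 A2) A3
               \<cdot>\<^bsub>D\<^esub> etA X2 (prd B S1 S2) S3 (\<rho> S1 S2 A1 A2) (Idm (Fib H2 S3) (morO R S3 A3))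
             = theta R r (etO X1 S1 (prd B S2 S3) A1 (etO X1 S2 S3 A2 A3))
               \<cdot>\<^bsub>D\<^esub> pbA H2 r (\<rho> S1 (prd B S2 S3) A1 (etO X1 S2 S3 A2 A3))
               \<cdot>\<^bsub>D\<^esub> pbA H2 r (etA X2 S1 (prd B S2 S3) (Idm (Fib H2 S1) (morO R S1 A1)) (\<rho> S2 S3 A2 A3))
               \<cdot>\<^bsub>D\<^esub> etAss X2 S1 S2 S3 (morO R S1 A1) (morO R S2 A2) (morO R S3 A3))) \<and>
     (com \<longrightarrow>
       (\<forall>S1 \<in> Obj B. \<forall>S2 \<in> Obj B. \<forall>A1 \<in> Obj (Fib H1 S1). \<forall>A2 \<in> Obj (Fib H1 S2).
          let P = prd B S1 S2; D = Fib H2 P; t = perm B S1 S2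
          in morA R P (etCom X1 S1 S2 A1 A2) \<cdot>\<^bsub>D\<^esub> \<rho> S1 S2 A1 A2
             = theta R t (etO X1 S2 S1 A2 A1)
               \<cdot>\<^bsub>D\<^esub> pbA H2 t (\<rho> S2 S1 A2 A1)
               \<cdot>\<^bsub>D\<^esub> etCom X2 S1 S2 (morO R S1 A1) (morO R S2 A2))) \<and>
     (uni \<longrightarrow>
       (\<forall>S1 \<in> Obj B. \<forall>S2 \<in> Obj B.
          let P = prd B S1 S2; D = Fib H2 P
          in (\<forall>A1 \<in> Obj (Fib H1 S1).
                theta R (prj1 B S1 S2) A1 \<cdot>\<^bsub>D\<^esub> etUr X2 S1 S2 (morO R S1 A1)
                    \<cdot>\<^bsub>D\<^esub> etA X2 S1 S2 (Idm (Fib H2 S1) (morO R S1 A1)) (w S2)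
                  = morA R P (etUr X1 S1 S2 A1) \<cdot>\<^bsub>D\<^esub> \<rho> S1 S2 A1 (secO (etUnit X1) S2)) \<and>
             (\<forall>A2 \<in> Obj (Fib H1 S2).
                theta R (prj2 B S1 S2) A2 \<cdot>\<^bsub>D\<^esub> etUl X2 S1 S2 (morO R S2 A2)
                    \<cdot>\<^bsub>D\<^esub> etA X2 S1 S2 (w S1) (Idm (Fib H2 S2) (morO R S2 A2))
                  = morA R P (etUl X1 S1 S2 A2) \<cdot>\<^bsub>D\<^esub> \<rho> S1 S2 (secO (etUnit X1) S1) A2)))}"


section \<open>The canonical correspondences\<close>

text \<open>
  Relative to equivalences \<open>e\<^sub>j\<close> from \<open>\<boxtimes>\<^sub>j\<close> to \<open>E(\<otimes>\<^sub>j)\<close>, an internal structure \<open>\<rho>\<close> on \<open>R\<close> is sent to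
  \<open>R A1 \<boxtimes>\<^sub>2 R A2 \<rightarrow> pr\<^sub>1\<^sup>* R A1 \<otimes>\<^sub>2 pr\<^sub>2\<^sup>* R A2 \<rightarrow> R pr\<^sub>1\<^sup>* A1 \<otimes>\<^sub>2 R pr\<^sub>2\<^sup>* A2 \<rightarrow> R (pr\<^sub>1\<^sup>* A1 \<otimes>\<^sub>1 pr\<^sub>2\<^sup>* A2)
  \<rightarrow> R (A1 \<boxtimes>\<^sub>1 A2)\<close>.
\<close>

definition to_external :: "('o, 'm) pcat \<Rightarrow>
    ('o, 'm, 'x1, 'h1) fibcat \<Rightarrow> ('o, 'm, 'x2, 'h2) fibcat \<Rightarrow> ('o, 'm, 'x1, 'h1, 'x2, 'h2) fibmor \<Rightarrow>
    ('o, 'm, 'x2, 'h2) itensor \<Rightarrow>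
    ('o \<Rightarrow> 'o \<Rightarrow> 'x1 \<Rightarrow> 'x1 \<Rightarrow> 'h1) \<Rightarrow> ('o \<Rightarrow> 'o \<Rightarrow> 'x2 \<Rightarrow> 'x2 \<Rightarrow> 'h2) \<Rightarrow>
    ('o \<Rightarrow> 'x1 \<Rightarrow> 'x1 \<Rightarrow> 'h2) \<Rightarrow> ('o \<Rightarrow> 'o \<Rightarrow> 'x1 \<Rightarrow> 'x1 \<Rightarrow> 'h2)" where
  "to_external B H1 H2 R T2 e1 e2 \<rho> = (\<lambda>S1 S2 A1 A2.
     if S1 \<in> Obj B \<and> S2 \<in> Obj B \<and> A1 \<in> Obj (Fib H1 S1) \<and> A2 \<in> Obj (Fib H1 S2) then
       let P = prd B S1 S2; D = Fib H2 P; q1 = prj1 B S1 S2; q2 = prj2 B S1 S2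
       in morA R P (inv_arr (Fib H1 P) (e1 S1 S2 A1 A2))
            \<cdot>\<^bsub>D\<^esub> \<rho> P (pbO H1 q1 A1) (pbO H1 q2 A2)
            \<cdot>\<^bsub>D\<^esub> itA T2 P (theta R q1 A1) (theta R q2 A2)
            \<cdot>\<^bsub>D\<^esub> e2 S1 S2 (morO R S1 A1) (morO R S2 A2)
     else undefined)"

definition diag_comparison :: "('o, 'm) pcat \<Rightarrow> ('o, 'm, 'x, 'h) fibcat \<Rightarrow> ('o, 'm, 'x, 'h) itensor \<Rightarrow>
    ('o \<Rightarrow> 'o \<Rightarrow> 'x \<Rightarrow> 'x \<Rightarrow> 'h) \<Rightarrow> 'o \<Rightarrow> 'x \<Rightarrow> 'x \<Rightarrow> 'h" where
  \<comment> \<open>the isomorphism \<open>A \<otimes> A' \<rightarrow> \<Delta>\<^sup>* (A \<boxtimes> A')\<close> induced by an equivalence \<open>e\<close> from \<open>\<boxtimes>\<close> to \<open>E(\<otimes>)\<close>\<close>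
  "diag_comparison B H T e S A A' =
     (let D = Fib H S; d = diag B S; q1 = prj1 B S S; q2 = prj2 B S S
      in pbA H d (inv_arr (Fib H (prd B S S)) (e S S A A'))
           \<cdot>\<^bsub>D\<^esub> itM T d (pbO H q1 A) (pbO H q2 A')
           \<cdot>\<^bsub>D\<^esub> itA T S (conn H d q1 A \<cdot>\<^bsub>D\<^esub> idn B H S A) (conn H d q2 A' \<cdot>\<^bsub>D\<^esub> idn B H S A'))"

text \<open>
  Conversely, an external structure \<open>\<sigma>\<close> on \<open>R\<close> is sent to
  \<open>R A \<otimes>\<^sub>2 R A' \<rightarrow> \<Delta>\<^sup>* (R A \<boxtimes>\<^sub>2 R A') \<rightarrow> \<Delta>\<^sup>* R (A \<boxtimes>\<^sub>1 A') \<rightarrow> R \<Delta>\<^sup>* (A \<boxtimes>\<^sub>1 A') \<rightarrow> R (A \<otimes>\<^sub>1 A')\<close>.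
\<close>

definition to_internal :: "('o, 'm) pcat \<Rightarrow>
    ('o, 'm, 'x1, 'h1) fibcat \<Rightarrow> ('o, 'm, 'x2, 'h2) fibcat \<Rightarrow> ('o, 'm, 'x1, 'h1, 'x2, 'h2) fibmor \<Rightarrow>
    ('o, 'm, 'x1, 'h1) itensor \<Rightarrow> ('o, 'm, 'x2, 'h2) itensor \<Rightarrow> ('o, 'm, 'x1, 'h1) etensor \<Rightarrow>
    ('o \<Rightarrow> 'o \<Rightarrow> 'x1 \<Rightarrow> 'x1 \<Rightarrow> 'h1) \<Rightarrow> ('o \<Rightarrow> 'o \<Rightarrow> 'x2 \<Rightarrow> 'x2 \<Rightarrow> 'h2) \<Rightarrow>
    ('o \<Rightarrow> 'o \<Rightarrow> 'x1 \<Rightarrow> 'x1 \<Rightarrow> 'h2) \<Rightarrow> ('o \<Rightarrow> 'x1 \<Rightarrow> 'x1 \<Rightarrow> 'h2)" where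
  "to_internal B H1 H2 R T1 T2 X1 e1 e2 \<sigma> = (\<lambda>S A A'.
     if S \<in> Obj B \<and> A \<in> Obj (Fib H1 S) \<and> A' \<in> Obj (Fib H1 S) then
       let D = Fib H2 S; d = diag B S
       in morA R S (inv_arr (Fib H1 S) (diag_comparison B H1 T1 e1 S A A'))
            \<cdot>\<^bsub>D\<^esub> theta R d (etO X1 S S A A')
            \<cdot>\<^bsub>D\<^esub> pbA H2 d (\<sigma> S S A A')
            \<cdot>\<^bsub>D\<^esub> diag_comparison B H2 T2 e2 S (morO R S A) (morO R S A')
     else undefined)"

definition transport_unit_iso :: "('o, 'm, 'x2, 'h2) fibcat \<Rightarrow>
    ('o, 'm, 'x1, 'h1, 'x2, 'h2) fibmor \<Rightarrow> ('o \<Rightarrow> 'h1) \<Rightarrow> ('o \<Rightarrow> 'h2) \<Rightarrow> ('o \<Rightarrow> 'h2) \<Rightarrow> 'o \<Rightarrow> 'h2" where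
  \<comment> \<open>for \<open>v\<^sub>j\<close> from the unit section of \<open>\<boxtimes>\<^sub>j\<close> to that of \<open>\<otimes>\<^sub>j\<close>, the composite \<open>v\<^sub>2\<^sup>-\<^sup>1 \<circ> w \<circ> R(v\<^sub>1)\<close>\<close>
  "transport_unit_iso H2 R v1 v2 w S =
     inv_arr (Fib H2 S) (v2 S) \<cdot>\<^bsub>Fib H2 S\<^esub> w S \<cdot>\<^bsub>Fib H2 S\<^esub> morA R S (v1 S)"

end

theory Submission
  imports Defs
begin

text \<open>
  Fix the morphism \<open>R\<close>. Over an object \<open>S\<close> consider the triples \<open>(X, Y, \<phi>)\<close> of an object \<open>X\<close> of \<open>H1(S)\<close>,
  an object \<open>Y\<close> of \<open>H2(S)\<close> and an isomorphism \<open>\<phi> : Y \<rightarrow> R X\<close>; call them glued objects. A pair of arrows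
  \<open>(s, t)\<close> between the first and the second components is an arrow of glued objects, and is said to lift,
  if it commutes with the third components: \<open>\<phi>' \<circ> t = R(s) \<circ> \<phi>\<close>. Lifting pairs are closed under composition
  and inverses. By means of \<open>\<theta>\<close> glued objects can be pulled back, pullbacks of lifting pairs lift, and
  so do the connection isomorphisms of \<open>H1\<close> and \<open>H2\<close>, taken as a pair (\<open>glued_iso_conn\<close>,
  \<open>glued_iso_idn\<close>). In other words, glued objects form the iso-comma category of \<open>R\<close>, which is fibered again.

  A natural family \<open>\<rho>\<close> is a way to multiply glued objects:
  \<open>(X, Y, \<phi>) \<otimes> (X', Y', \<phi>') = (X \<otimes>\<^sub>1 X', Y \<otimes>\<^sub>2 Y', \<rho> \<circ> (\<phi> \<otimes>\<^sub>2 \<phi>'))\<close>. Every axiom on \<open>\<rho>\<close> says that the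
  corresponding structural arrows of \<open>\<otimes>\<^sub>1\<close> and \<open>\<otimes>\<^sub>2\<close> (monoidality, associativity, commutativity, unit)
  lift as a pair at the glued objects \<open>(A, R A, id)\<close>, and by naturality at all others. An external
  family \<open>\<sigma>\<close> has the same description with \<open>\<boxtimes>\<close>. No diagram that involves \<open>R\<close> has to be chased: a
  structural arrow that is a composite of arrows that lift does lift.

  The two constructions are now forced. Given \<open>\<rho>\<close>, there is exactly one \<open>\<sigma>\<close> for which the
  equivalences \<open>e : A \<boxtimes> B \<rightarrow> q\<^sub>1\<^sup>*A \<otimes> q\<^sub>2\<^sup>*B\<close> lift, and this is \<open>to_external\<close>. Given \<open>\<sigma>\<close>, there is exactly one
  \<open>\<rho>\<close> for which the comparisons \<open>A \<otimes> B \<rightarrow> \<Delta>\<^sup>*(A \<boxtimes> B)\<close> lift, and this is \<open>to_internal\<close>. It remains to see that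
  the two conditions on a pair \<open>(\<rho>, \<sigma>)\<close> agree, and that \<open>\<rho>\<close> satisfies the axioms if and only if \<open>\<sigma>\<close> does.

  For the first point, both kinds of arrows belong to the family of isomorphisms
  \<open>\<kappa>\<^sub>h : (q\<^sub>1h)\<^sup>*A \<otimes> (q\<^sub>2h)\<^sup>*B \<rightarrow> h\<^sup>*(A \<boxtimes> B)\<close> (\<open>comparison\<close>), for arbitrary \<open>h\<close> into a product. If \<open>\<rho>\<close> is
  monoidal and \<open>e\<close> lifts, all \<open>\<kappa>\<^sub>h\<close> lift, and with them the external monoidality isomorphisms
  (\<open>iso_comparison\<close>, \<open>lifts_etM\<close>). If \<open>\<sigma>\<close> is monoidal and \<open>\<kappa>\<^sub>\<Delta>\<close> lifts, all \<open>\<kappa>\<^sub>h\<close> lift by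
  \<open>comparison_tuple\<close>; the case \<open>h = id\<close> is \<open>e\<close>, and the case \<open>h = \<Delta> f\<close> gives the internal monoidality
  isomorphism by \<open>diag_comparison_pullback\<close>. These identities concern one fibered category at a time and
  are where the coherence of \<open>conn\<close> and \<open>m\<close> is used.

  For the second point, the external constraint at \<open>A\<^sub>1, A\<^sub>2, \<dots>\<close> lifts if and only if the internal one
  lifts at the pullbacks of \<open>A\<^sub>1, A\<^sub>2, \<dots>\<close> to the product (\<open>ecom_iff\<close>, \<open>eunitor_iff\<close>, \<open>eass_iff\<close>). So the internal
  axiom implies the external one. Conversely the internal constraints are stable under pullback and under
  isomorphism of glued objects, and any \<open>A\<close> is the pullback along a diagonal of its pullback along a projection.
\<close>


section \<open>Isomorphisms, functors and bifunctors\<close>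

lemma homD: "f \<in> hom C X Y \<Longrightarrow> f \<in> Arr C" "f \<in> hom C X Y \<Longrightarrow> Dom C f = X" "f \<in> hom C X Y \<Longrightarrow> Cod C f = Y"
  by (auto simp: hom_def)

lemma iso_hom: "f \<in> iso C X Y \<Longrightarrow> f \<in> hom C X Y"
  by (simp add: iso_def)

context category
begin

lemma hom_obj: "f \<in> hom C X Y \<Longrightarrow> X \<in> Obj C" "f \<in> hom C X Y \<Longrightarrow> Y \<in> Obj C"
  using dom_obj cod_obj by (auto simp: hom_def)

lemma inverse_of_iff:
  assumes "f \<in> hom C X Y"
  shows "inverse_of C f g \<longleftrightarrow>
    g \<in> hom C Y X \<and> g \<cdot>\<^bsub>C\<^esub> f = Idm C X \<and> f \<cdot>\<^bsub>C\<^esub> g = Idm C Y"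
  using assms by (auto simp: inverse_of_def hom_def)

lemma inverse_unique:
  assumes f: "f \<in> hom C X Y" and "inverse_of C f g" and "inverse_of C f g'"
  shows "g = g'"
proof -
  have g: "g \<in> hom C Y X" "g \<cdot>\<^bsub>C\<^esub> f = Idm C X" and g': "g' \<in> hom C Y X" "f \<cdot>\<^bsub>C\<^esub> g' = Idm C Y"
    using assms inverse_of_iff[OF f] by auto
  have "g = g \<cdot>\<^bsub>C\<^esub> (f \<cdot>\<^bsub>C\<^esub> g')" using g g' id_right by simp
  also have "\<dots> = g'" using comp_assoc[OF g'(1) f g(1)] g(2) id_left[OF g'(1)] by simp
  finally show ?thesis .
qed

lemma inv_arr_eq:
  assumes "f \<in> hom C X Y" "g \<in> hom C Y X" "g \<cdot>\<^bsub>C\<^esub> f = Idm C X" "f \<cdot>\<^bsub>C\<^esub> g = Idm C Y"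
  shows "inv_arr C f = g"
proof -
  have g: "inverse_of C f g" using assms inverse_of_iff[OF assms(1)] by blast
  show ?thesis
    unfolding inv_arr_def by (rule the_equality[of "inverse_of C f", OF g]) (rule inverse_unique[OF assms(1) _ g])
qed

lemma isoI:
  assumes "f \<in> hom C X Y" "g \<in> hom C Y X" "g \<cdot>\<^bsub>C\<^esub> f = Idm C X" "f \<cdot>\<^bsub>C\<^esub> g = Idm C Y"
  shows "f \<in> iso C X Y"
  using assms inverse_of_iff[OF assms(1)] by (auto simp: iso_def)

lemma inv_arr:
  assumes "f \<in> iso C X Y"
  shows "inv_arr C f \<in> iso C Y X" "inv_arr C f \<in> hom C Y X"
    "inv_arr C f \<cdot>\<^bsub>C\<^esub> f = Idm C X" "f \<cdot>\<^bsub>C\<^esub> inv_arr C f = Idm C Y"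
proof -
  have f: "f \<in> hom C X Y" by (rule iso_hom[OF assms])
  obtain g where g: "g \<in> hom C Y X" "g \<cdot>\<^bsub>C\<^esub> f = Idm C X" "f \<cdot>\<^bsub>C\<^esub> g = Idm C Y"
    using assms inverse_of_iff[OF f] unfolding iso_def by blast
  have *: "inv_arr C f = g" by (rule inv_arr_eq[OF f g])
  show "inv_arr C f \<in> iso C Y X" "inv_arr C f \<in> hom C Y X"
    "inv_arr C f \<cdot>\<^bsub>C\<^esub> f = Idm C X" "f \<cdot>\<^bsub>C\<^esub> inv_arr C f = Idm C Y"
    unfolding * by (rule isoI[OF g(1) f g(3,2)], (rule g)+)
qed

lemma id_iso: "X \<in> Obj C \<Longrightarrow> Idm C X \<in> iso C X X"
  using isoI[OF id_hom id_hom] id_left[OF id_hom] by simp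

lemma inv_arr_cancel:
  assumes f: "f \<in> iso C X Y"
  shows "u \<in> hom C W X \<Longrightarrow> inv_arr C f \<cdot>\<^bsub>C\<^esub> (f \<cdot>\<^bsub>C\<^esub> u) = u"
    and "u \<in> hom C W Y \<Longrightarrow> f \<cdot>\<^bsub>C\<^esub> (inv_arr C f \<cdot>\<^bsub>C\<^esub> u) = u"
    and "v \<in> hom C Y Z \<Longrightarrow> (v \<cdot>\<^bsub>C\<^esub> f) \<cdot>\<^bsub>C\<^esub> inv_arr C f = v"
    and "v \<in> hom C X Z \<Longrightarrow> (v \<cdot>\<^bsub>C\<^esub> inv_arr C f) \<cdot>\<^bsub>C\<^esub> f = v"
  using comp_assoc[of u W X f Y "inv_arr C f" X] comp_assoc[of u W Y "inv_arr C f" X f Y]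
    comp_assoc[of "inv_arr C f" Y X f Y v Z] comp_assoc[of f X Y "inv_arr C f" X v Z]
    iso_hom[OF f] inv_arr[OF f] id_left id_right by simp_all

lemma iso_comp:
  assumes f: "f \<in> iso C X Y" and g: "g \<in> iso C Y Z"
  shows "g \<cdot>\<^bsub>C\<^esub> f \<in> iso C X Z"
proof (rule isoI)
  note f' = iso_hom[OF f] inv_arr(2-4)[OF f] and g' = iso_hom[OF g] inv_arr(2-4)[OF g]
  show gf: "g \<cdot>\<^bsub>C\<^esub> f \<in> hom C X Z" using comp_hom f' g' by blast
  show "inv_arr C f \<cdot>\<^bsub>C\<^esub> inv_arr C g \<in> hom C Z X" using comp_hom f' g' by blast
  show "(inv_arr C f \<cdot>\<^bsub>C\<^esub> inv_arr C g) \<cdot>\<^bsub>C\<^esub> g \<cdot>\<^bsub>C\<^esub> f = Idm C X"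
    using comp_assoc[OF gf g'(2) f'(2)] inv_arr_cancel(1)[OF g f'(1)] f'(3) by simp
  show "(g \<cdot>\<^bsub>C\<^esub> f) \<cdot>\<^bsub>C\<^esub> inv_arr C f \<cdot>\<^bsub>C\<^esub> inv_arr C g = Idm C Z"
    using comp_assoc[OF comp_hom[OF g'(2) f'(2)] f'(1) g'(1)] inv_arr_cancel(2)[OF f g'(2)] g'(4)
    by simp
qed

lemma iso_cancel_left:
  assumes "f \<in> iso C X Y" "u \<in> hom C W X" "v \<in> hom C W X" "f \<cdot>\<^bsub>C\<^esub> u = f \<cdot>\<^bsub>C\<^esub> v"
  shows "u = v"
  using inv_arr_cancel(1)[OF assms(1)] assms by metis

lemma iso_cancel_right:
  assumes "f \<in> iso C X Y" "u \<in> hom C Y Z" "v \<in> hom C Y Z" "u \<cdot>\<^bsub>C\<^esub> f = v \<cdot>\<^bsub>C\<^esub> f"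
  shows "u = v"
  using inv_arr_cancel(3)[OF assms(1)] assms by metis

lemma square_paste:
  assumes "a \<in> hom C X Y" "a' \<in> hom C X' Y'" "b \<in> hom C Y Z" "b' \<in> hom C Y' Z'"
    and "u \<in> hom C X X'" "v \<in> hom C Y Y'" "w \<in> hom C Z Z'"
    and l: "v \<cdot>\<^bsub>C\<^esub> a = a' \<cdot>\<^bsub>C\<^esub> u" and r: "w \<cdot>\<^bsub>C\<^esub> b = b' \<cdot>\<^bsub>C\<^esub> v"
  shows "w \<cdot>\<^bsub>C\<^esub> b \<cdot>\<^bsub>C\<^esub> a = (b' \<cdot>\<^bsub>C\<^esub> a') \<cdot>\<^bsub>C\<^esub> u"
proof -
  have "w \<cdot>\<^bsub>C\<^esub> b \<cdot>\<^bsub>C\<^esub> a = (b' \<cdot>\<^bsub>C\<^esub> v) \<cdot>\<^bsub>C\<^esub> a" using comp_assoc[OF assms(1,3,7)] r by simp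
  also have "\<dots> = b' \<cdot>\<^bsub>C\<^esub> a' \<cdot>\<^bsub>C\<^esub> u" using comp_assoc[OF assms(1,6,4)] l by simp
  also have "\<dots> = (b' \<cdot>\<^bsub>C\<^esub> a') \<cdot>\<^bsub>C\<^esub> u" using comp_assoc[OF assms(5,2,4)] by simp
  finally show ?thesis .
qed

lemma square_inv:
  assumes b: "b \<in> iso C Y Z" and b': "b' \<in> iso C Y' Z'" and v: "v \<in> hom C Y Y'" and w: "w \<in> hom C Z Z'"
    and sq: "w \<cdot>\<^bsub>C\<^esub> b = b' \<cdot>\<^bsub>C\<^esub> v"
  shows "v \<cdot>\<^bsub>C\<^esub> inv_arr C b = inv_arr C b' \<cdot>\<^bsub>C\<^esub> w"
proof -
  note i = inv_arr(2)[OF b] and i' = inv_arr(2)[OF b']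
  have "v \<cdot>\<^bsub>C\<^esub> inv_arr C b = inv_arr C b' \<cdot>\<^bsub>C\<^esub> b' \<cdot>\<^bsub>C\<^esub> v \<cdot>\<^bsub>C\<^esub> inv_arr C b"
    using inv_arr_cancel(1)[OF b' comp_hom[OF i v]] by simp
  also have "\<dots> = inv_arr C b' \<cdot>\<^bsub>C\<^esub> (w \<cdot>\<^bsub>C\<^esub> b) \<cdot>\<^bsub>C\<^esub> inv_arr C b"
    using comp_assoc[OF i v iso_hom[OF b']] sq by simp
  also have "\<dots> = inv_arr C b' \<cdot>\<^bsub>C\<^esub> w" using inv_arr_cancel(3)[OF b w] by simp
  finally show ?thesis .
qed

lemma inv_arr_id: "X \<in> Obj C \<Longrightarrow> inv_arr C (Idm C X) = Idm C X"
  using inv_arr_eq[OF id_hom id_hom] id_left[OF id_hom] by simp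

lemma move_iso:
  assumes k: "k \<in> iso C X Y" and x: "x \<in> hom C Y Z" and z: "z \<in> hom C X W" and y: "y \<in> hom C W Z"
  shows "x = y \<cdot>\<^bsub>C\<^esub> z \<cdot>\<^bsub>C\<^esub> inv_arr C k \<longleftrightarrow> x \<cdot>\<^bsub>C\<^esub> k = y \<cdot>\<^bsub>C\<^esub> z"
proof
  assume "x = y \<cdot>\<^bsub>C\<^esub> z \<cdot>\<^bsub>C\<^esub> inv_arr C k"
  then show "x \<cdot>\<^bsub>C\<^esub> k = y \<cdot>\<^bsub>C\<^esub> z"
    using comp_assoc[OF iso_hom[OF k] comp_hom[OF inv_arr(2)[OF k] z] y] inv_arr_cancel(4)[OF k z] by simp
next
  assume "x \<cdot>\<^bsub>C\<^esub> k = y \<cdot>\<^bsub>C\<^esub> z"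
  then show "x = y \<cdot>\<^bsub>C\<^esub> z \<cdot>\<^bsub>C\<^esub> inv_arr C k"
    using comp_assoc[OF inv_arr(2)[OF k] z y] inv_arr_cancel(3)[OF k x] by simp
qed

lemma inv_arr_inv: "f \<in> iso C X Y \<Longrightarrow> inv_arr C (inv_arr C f) = f"
  using inv_arr_eq[OF inv_arr(2) iso_hom] inv_arr(3,4) by simp

end

lemma functor_obj: "is_functor C D FO FA \<Longrightarrow> X \<in> Obj C \<Longrightarrow> FO X \<in> Obj D"
  and functor_id: "is_functor C D FO FA \<Longrightarrow> X \<in> Obj C \<Longrightarrow> FA (Idm C X) = Idm D (FO X)"
  and functor_hom: "is_functor C D FO FA \<Longrightarrow> f \<in> hom C X Y \<Longrightarrow> FA f \<in> hom D (FO X) (FO Y)"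
  and functor_comp: "is_functor C D FO FA \<Longrightarrow> f \<in> hom C X Y \<Longrightarrow> g \<in> hom C Y Z \<Longrightarrow>
    FA (g \<cdot>\<^bsub>C\<^esub> f) = FA g \<cdot>\<^bsub>D\<^esub> FA f"
  by (auto simp: is_functor_def)

lemma functor_iso:
  assumes "category C" "category D" and F: "is_functor C D FO FA" and f: "f \<in> iso C X Y"
  shows "FA f \<in> iso D (FO X) (FO Y)" "FA (inv_arr C f) = inv_arr D (FA f)"
proof -
  interpret C: category C by fact
  interpret D: category D by fact
  note f' = iso_hom[OF f] C.inv_arr(2-4)[OF f]
  have "FA f \<in> hom D (FO X) (FO Y)" "FA (inv_arr C f) \<in> hom D (FO Y) (FO X)"
    "FA (inv_arr C f) \<cdot>\<^bsub>D\<^esub> FA f = Idm D (FO X)" "FA f \<cdot>\<^bsub>D\<^esub> FA (inv_arr C f) = Idm D (FO Y)"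
    using f' functor_hom[OF F] functor_comp[OF F, symmetric] functor_id[OF F] C.hom_obj[OF f'(1)]
    by simp_all
  then show "FA f \<in> iso D (FO X) (FO Y)" "FA (inv_arr C f) = inv_arr D (FA f)"
    using D.isoI D.inv_arr_eq by metis+
qed

lemma natural_iso_iso: "is_natural_iso C D FO FA GO GA \<eta> \<Longrightarrow> X \<in> Obj C \<Longrightarrow> \<eta> X \<in> iso D (FO X) (GO X)"
  and natural_iso_square: "is_natural_iso C D FO FA GO GA \<eta> \<Longrightarrow> f \<in> hom C X Y \<Longrightarrow>
    GA f \<cdot>\<^bsub>D\<^esub> \<eta> X = \<eta> Y \<cdot>\<^bsub>D\<^esub> FA f"
  by (auto simp: is_natural_iso_def)

lemma prod_cat_simps:
  "Obj (prod_cat C D) = Obj C \<times> Obj D"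
  "hom (prod_cat C D) (X, X') (Y, Y') = hom C X Y \<times> hom D X' Y'"
  "Idm (prod_cat C D) (X, X') = (Idm C X, Idm D X')"
  "Cmp (prod_cat C D) (h', k') (h, k) = (h' \<cdot>\<^bsub>C\<^esub> h, k' \<cdot>\<^bsub>D\<^esub> k)"
  by (auto simp: prod_cat_def hom_def)

lemma bifunctor_natural_iso_iff:
  "is_natural_iso (prod_cat C C') D (\<lambda>(X, X'). FO X X') (\<lambda>(h, k). FA h k)
      (\<lambda>(X, X'). GO X X') (\<lambda>(h, k). GA h k) (\<lambda>(X, X'). \<eta> X X') \<longleftrightarrow>
   (\<forall>X \<in> Obj C. \<forall>X' \<in> Obj C'. \<eta> X X' \<in> iso D (FO X X') (GO X X')) \<and>
   (\<forall>X Y X' Y' h k. h \<in> hom C X Y \<longrightarrow> k \<in> hom C' X' Y' \<longrightarrow>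
      GA h k \<cdot>\<^bsub>D\<^esub> \<eta> X X' = \<eta> Y Y' \<cdot>\<^bsub>D\<^esub> FA h k)"
  unfolding is_natural_iso_def by (simp add: prod_cat_simps) blast

lemma trifunctor_natural_isoD:
  assumes "is_natural_iso (prod_cat C1 (prod_cat C2 C3)) D (\<lambda>(X1, X2, X3). FO X1 X2 X3)
      (\<lambda>(h1, h2, h3). FA h1 h2 h3) (\<lambda>(X1, X2, X3). GO X1 X2 X3) (\<lambda>(h1, h2, h3). GA h1 h2 h3)
      (\<lambda>(X1, X2, X3). \<eta> X1 X2 X3)"
  shows "X1 \<in> Obj C1 \<Longrightarrow> X2 \<in> Obj C2 \<Longrightarrow> X3 \<in> Obj C3 \<Longrightarrow>
      \<eta> X1 X2 X3 \<in> iso D (FO X1 X2 X3) (GO X1 X2 X3)"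
    and "h1 \<in> hom C1 X1 Y1 \<Longrightarrow> h2 \<in> hom C2 X2 Y2 \<Longrightarrow> h3 \<in> hom C3 X3 Y3 \<Longrightarrow>
      GA h1 h2 h3 \<cdot>\<^bsub>D\<^esub> \<eta> X1 X2 X3 = \<eta> Y1 Y2 Y3 \<cdot>\<^bsub>D\<^esub> FA h1 h2 h3"
  using natural_iso_iso[OF assms, of "(X1, X2, X3)"]
    natural_iso_square[OF assms, of "(h1, h2, h3)" "(X1, X2, X3)" "(Y1, Y2, Y3)"]
  by (simp_all add: prod_cat_simps)

text \<open>\<open>prod_cat\<close> makes a functor of two variables act on pairs; here its laws are available in curried form.\<close>

locale bifunctor =
  C: category C + C': category C' + D: category D
  for C :: "('o1, 'm1) cat" and C' :: "('o2, 'm2) cat" and D :: "('o3, 'm3) cat" +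
  fixes FO :: "'o1 \<Rightarrow> 'o2 \<Rightarrow> 'o3" and FA :: "'m1 \<Rightarrow> 'm2 \<Rightarrow> 'm3"
  assumes bifunctorial: "is_functor (prod_cat C C') D (\<lambda>(X, X'). FO X X') (\<lambda>(h, k). FA h k)"
begin

lemma obj: "X \<in> Obj C \<Longrightarrow> X' \<in> Obj C' \<Longrightarrow> FO X X' \<in> Obj D"
  and ident: "X \<in> Obj C \<Longrightarrow> X' \<in> Obj C' \<Longrightarrow> FA (Idm C X) (Idm C' X') = Idm D (FO X X')"
  using bifunctorial by (auto simp: is_functor_def prod_cat_simps)

lemma map_hom: "h \<in> hom C X Y \<Longrightarrow> k \<in> hom C' X' Y' \<Longrightarrow> FA h k \<in> hom D (FO X X') (FO Y Y')"
  using functor_hom[OF bifunctorial, of "(h, k)" "(X, X')" "(Y, Y')"] by (simp add: prod_cat_simps)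

lemma map_comp:
  assumes "h \<in> hom C X Y" "h' \<in> hom C Y Z" "k \<in> hom C' X' Y'" "k' \<in> hom C' Y' Z'"
  shows "FA (h' \<cdot>\<^bsub>C\<^esub> h) (k' \<cdot>\<^bsub>C'\<^esub> k) = FA h' k' \<cdot>\<^bsub>D\<^esub> FA h k"
  using functor_comp[OF bifunctorial, of "(h, k)" "(X, X')" "(Y, Y')" "(h', k')" "(Z, Z')"] assms
  by (simp add: prod_cat_simps)

lemma map_iso:
  assumes "h \<in> iso C X Y" "k \<in> iso C' X' Y'"
  shows "FA h k \<in> iso D (FO X X') (FO Y Y')"
    and "FA (inv_arr C h) (inv_arr C' k) = inv_arr D (FA h k)"
proof -
  note h = iso_hom[OF assms(1)] C.inv_arr(2-4)[OF assms(1)]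
    and k = iso_hom[OF assms(2)] C'.inv_arr(2-4)[OF assms(2)]
  have *: "FA (inv_arr C h) (inv_arr C' k) \<cdot>\<^bsub>D\<^esub> FA h k = Idm D (FO X X')"
    "FA h k \<cdot>\<^bsub>D\<^esub> FA (inv_arr C h) (inv_arr C' k) = Idm D (FO Y Y')"
    using h k map_comp[symmetric] ident C.hom_obj[OF h(1)] C'.hom_obj[OF k(1)] by simp_all
  show "FA h k \<in> iso D (FO X X') (FO Y Y')"
    by (rule D.isoI[OF map_hom[OF h(1) k(1)] map_hom[OF h(2) k(2)] *])
  show "FA (inv_arr C h) (inv_arr C' k) = inv_arr D (FA h k)"
    by (rule D.inv_arr_eq[OF map_hom[OF h(1) k(1)] map_hom[OF h(2) k(2)] *, symmetric])
qed

end


section \<open>Products and pullbacks\<close>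

context category_with_products
begin

lemma product_ext:
  assumes "h \<in> hom B T (prd B S1 S2)" "k \<in> hom B T (prd B S1 S2)" "S1 \<in> Obj B" "S2 \<in> Obj B"
    and "prj1 B S1 S2 \<cdot>\<^bsub>B\<^esub> h = prj1 B S1 S2 \<cdot>\<^bsub>B\<^esub> k" "prj2 B S1 S2 \<cdot>\<^bsub>B\<^esub> h = prj2 B S1 S2 \<cdot>\<^bsub>B\<^esub> k"
  shows "h = k"
  using prd_universal[OF comp_hom[OF assms(1) prj1_hom[OF assms(3,4)]]
      comp_hom[OF assms(1) prj2_hom[OF assms(3,4)]]] assms by metis

lemma tuple:
  assumes "f1 \<in> hom B T S1" "f2 \<in> hom B T S2"
  shows "tuple B f1 f2 \<in> hom B T (prd B S1 S2)"
    "prj1 B S1 S2 \<cdot>\<^bsub>B\<^esub> tuple B f1 f2 = f1" "prj2 B S1 S2 \<cdot>\<^bsub>B\<^esub> tuple B f1 f2 = f2"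
  using theI'[OF prd_universal[OF assms]] assms by (auto simp: tuple_def homD)

lemma cross:
  assumes "f1 \<in> hom B T1 S1" "f2 \<in> hom B T2 S2"
  shows "cross B f1 f2 \<in> hom B (prd B T1 T2) (prd B S1 S2)"
    "prj1 B S1 S2 \<cdot>\<^bsub>B\<^esub> cross B f1 f2 = f1 \<cdot>\<^bsub>B\<^esub> prj1 B T1 T2"
    "prj2 B S1 S2 \<cdot>\<^bsub>B\<^esub> cross B f1 f2 = f2 \<cdot>\<^bsub>B\<^esub> prj2 B T1 T2"
  using tuple[OF comp_hom[OF prj1_hom assms(1)] comp_hom[OF prj2_hom assms(2)]]
    hom_obj(1)[OF assms(1)] hom_obj(1)[OF assms(2)] homD(2)[OF assms(1)] homD(2)[OF assms(2)]
  by (simp_all add: cross_def)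

lemma diag:
  assumes "S \<in> Obj B"
  shows "diag B S \<in> hom B S (prd B S S)"
    "prj1 B S S \<cdot>\<^bsub>B\<^esub> diag B S = Idm B S" "prj2 B S S \<cdot>\<^bsub>B\<^esub> diag B S = Idm B S"
  using tuple[OF id_hom id_hom] assms by (simp_all add: diag_def)

lemma perm:
  assumes "S1 \<in> Obj B" "S2 \<in> Obj B"
  shows "perm B S1 S2 \<in> hom B (prd B S1 S2) (prd B S2 S1)"
    "prj1 B S2 S1 \<cdot>\<^bsub>B\<^esub> perm B S1 S2 = prj2 B S1 S2" "prj2 B S2 S1 \<cdot>\<^bsub>B\<^esub> perm B S1 S2 = prj1 B S1 S2"
  using tuple[OF prj2_hom prj1_hom] assms by (simp_all add: perm_def)

lemma reassoc:
  assumes S: "S1 \<in> Obj B" "S2 \<in> Obj B" "S3 \<in> Obj B"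
  defines "p12 \<equiv> prj1 B (prd B S1 S2) S3" and "p3 \<equiv> prj2 B (prd B S1 S2) S3"
    and "r \<equiv> reassoc B S1 S2 S3" and "p23 \<equiv> prj2 B S1 (prd B S2 S3)"
  shows "r \<in> hom B (prd B (prd B S1 S2) S3) (prd B S1 (prd B S2 S3))"
    "prj1 B S1 (prd B S2 S3) \<cdot>\<^bsub>B\<^esub> r = prj1 B S1 S2 \<cdot>\<^bsub>B\<^esub> p12"
    "prj1 B S2 S3 \<cdot>\<^bsub>B\<^esub> p23 \<cdot>\<^bsub>B\<^esub> r = prj2 B S1 S2 \<cdot>\<^bsub>B\<^esub> p12"
    "prj2 B S2 S3 \<cdot>\<^bsub>B\<^esub> p23 \<cdot>\<^bsub>B\<^esub> r = p3"
proof -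
  note P = prd_obj[OF S(1,2)]
  have *: "prj1 B S1 S2 \<cdot>\<^bsub>B\<^esub> p12 \<in> hom B (prd B (prd B S1 S2) S3) S1"
    "prj2 B S1 S2 \<cdot>\<^bsub>B\<^esub> p12 \<in> hom B (prd B (prd B S1 S2) S3) S2"
    "p3 \<in> hom B (prd B (prd B S1 S2) S3) S3"
    unfolding p12_def p3_def
    using comp_hom[OF prj1_hom[OF P S(3)] prj1_hom[OF S(1,2)]]
      comp_hom[OF prj1_hom[OF P S(3)] prj2_hom[OF S(1,2)]] prj2_hom[OF P S(3)] by auto
  note t = tuple[OF *(2,3)]
  note t' = tuple[OF *(1) t(1)]
  show "r \<in> hom B (prd B (prd B S1 S2) S3) (prd B S1 (prd B S2 S3))"
    "prj1 B S1 (prd B S2 S3) \<cdot>\<^bsub>B\<^esub> r = prj1 B S1 S2 \<cdot>\<^bsub>B\<^esub> p12"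
    "prj1 B S2 S3 \<cdot>\<^bsub>B\<^esub> p23 \<cdot>\<^bsub>B\<^esub> r = prj2 B S1 S2 \<cdot>\<^bsub>B\<^esub> p12"
    "prj2 B S2 S3 \<cdot>\<^bsub>B\<^esub> p23 \<cdot>\<^bsub>B\<^esub> r = p3"
    using t t' by (simp_all add: r_def reassoc_def p12_def p3_def p23_def)
qed

end

context fibered_category
begin

lemma pb_obj: "f \<in> hom B T S \<Longrightarrow> A \<in> Obj (Fib H S) \<Longrightarrow> pbO H f A \<in> Obj (Fib H T)"
  and pb_ident: "f \<in> hom B T S \<Longrightarrow> A \<in> Obj (Fib H S) \<Longrightarrow>
    pbA H f (Idm (Fib H S) A) = Idm (Fib H T) (pbO H f A)"
  and pb_hom: "f \<in> hom B T S \<Longrightarrow> u \<in> hom (Fib H S) A A' \<Longrightarrow>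
    pbA H f u \<in> hom (Fib H T) (pbO H f A) (pbO H f A')"
  and pb_comp: "f \<in> hom B T S \<Longrightarrow> u \<in> hom (Fib H S) A A' \<Longrightarrow> v \<in> hom (Fib H S) A' A'' \<Longrightarrow>
    pbA H f (v \<cdot>\<^bsub>Fib H S\<^esub> u) = pbA H f v \<cdot>\<^bsub>Fib H T\<^esub> pbA H f u"
  by (rule functor_obj[OF pb_functor], assumption+)
    (rule functor_id[OF pb_functor], assumption+,
      rule functor_hom[OF pb_functor], assumption+,
      rule functor_comp[OF pb_functor], assumption+)

lemma pb_iso:
  assumes "f \<in> hom B T S" "u \<in> iso (Fib H S) A A'"
  shows "pbA H f u \<in> iso (Fib H T) (pbO H f A) (pbO H f A')"
    and "pbA H f (inv_arr (Fib H S) u) = inv_arr (Fib H T) (pbA H f u)"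
  using functor_iso[OF fib_category fib_category pb_functor] hom_obj assms by blast+

lemma conn_iso:
  assumes "f \<in> hom B T S" "g \<in> hom B S V" "A \<in> Obj (Fib H V)"
  shows "conn H f g A \<in> iso (Fib H T) (pbO H (g \<cdot>\<^bsub>B\<^esub> f) A) (pbO H f (pbO H g A))"
  using natural_iso_iso[OF conn_natural] assms by blast

lemma conn_square:
  assumes "f \<in> hom B T S" "g \<in> hom B S V" "u \<in> hom (Fib H V) A A'"
  shows "pbA H f (pbA H g u) \<cdot>\<^bsub>Fib H T\<^esub> conn H f g A
    = conn H f g A' \<cdot>\<^bsub>Fib H T\<^esub> pbA H (g \<cdot>\<^bsub>B\<^esub> f) u"
  using natural_iso_square[OF conn_natural] assms by blast

lemma idn_iso:
  assumes "S \<in> Obj B" "A \<in> Obj (Fib H S)"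
  shows "idn B H S A \<in> iso (Fib H S) A A"
  using conn_iso[OF id_hom id_hom assms(2)] assms id_left[OF id_hom] by (simp add: idn_def pb_id_obj)

lemma idn_square:
  assumes S: "S \<in> Obj B" and u: "u \<in> hom (Fib H S) A A'"
  shows "u \<cdot>\<^bsub>Fib H S\<^esub> idn B H S A = idn B H S A' \<cdot>\<^bsub>Fib H S\<^esub> u"
  using conn_square[OF id_hom id_hom u] S homD(1)[OF u]
  by (simp add: idn_def pb_id_arr id_left[OF id_hom])

text \<open>Both unit laws for \<open>conn\<close> come from a cocycle identity in which the arrow in question occurs
  twice and can be cancelled once.\<close>

lemma conn_id_left:
  assumes f: "f \<in> hom B T S" and A: "A \<in> Obj (Fib H S)"
  shows "conn H (Idm B T) f A = idn B H T (pbO H f A)"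
proof -
  have T: "T \<in> Obj B" using hom_obj f by blast
  interpret D: category "Fib H T" by (rule fib_category[OF T])
  have c: "conn H (Idm B T) f A \<in> iso (Fib H T) (pbO H f A) (pbO H f A)"
    using conn_iso[OF id_hom[OF T] f A] pb_id_obj[OF T pb_obj[OF f A]] id_right[OF f] by simp
  have i: "idn B H T (pbO H f A) \<in> hom (Fib H T) (pbO H f A) (pbO H f A)"
    by (rule iso_hom[OF idn_iso[OF T pb_obj[OF f A]]])
  have "conn H (Idm B T) f A \<cdot>\<^bsub>Fib H T\<^esub> conn H (Idm B T) f A
      = idn B H T (pbO H f A) \<cdot>\<^bsub>Fib H T\<^esub> conn H (Idm B T) f A"
    using conn_cocycle[OF id_hom[OF T] id_hom[OF T] f A] homD[OF iso_hom[OF c]]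
      pb_id_arr[OF T homD(1)[OF iso_hom[OF c]]] id_right[OF f] id_left[OF id_hom[OF T]]
    by (simp add: idn_def)
  then show ?thesis using D.iso_cancel_right[OF c iso_hom[OF c] i] by blast
qed

lemma conn_id_right:
  assumes f: "f \<in> hom B T S" and A: "A \<in> Obj (Fib H S)"
  shows "conn H f (Idm B S) A = pbA H f (idn B H S A)"
proof -
  have T: "T \<in> Obj B" and S: "S \<in> Obj B" using hom_obj f by blast+
  interpret D: category "Fib H T" by (rule fib_category[OF T])
  have c: "conn H f (Idm B S) A \<in> iso (Fib H T) (pbO H f A) (pbO H f A)"
    using conn_iso[OF f id_hom[OF S] A] pb_id_obj[OF S A] id_left[OF f] by simp
  have i: "pbA H f (idn B H S A) \<in> hom (Fib H T) (pbO H f A) (pbO H f A)"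
    by (rule pb_hom[OF f iso_hom[OF idn_iso[OF S A]]])
  have "pbA H f (idn B H S A) \<cdot>\<^bsub>Fib H T\<^esub> conn H f (Idm B S) A
      = conn H f (Idm B S) A \<cdot>\<^bsub>Fib H T\<^esub> conn H f (Idm B S) A"
    using conn_cocycle[OF f id_hom[OF S] id_hom[OF S] A]
      pb_id_obj[OF S A] id_left[OF f] id_left[OF id_hom[OF S]] by (simp add: idn_def)
  then show ?thesis using D.iso_cancel_right[OF c i iso_hom[OF c]] by simp
qed

lemma swap_iso:
  assumes "f \<in> hom B T S" "g \<in> hom B S V" "f' \<in> hom B T S'" "g' \<in> hom B S' V"
    and "g \<cdot>\<^bsub>B\<^esub> f = g' \<cdot>\<^bsub>B\<^esub> f'" and A: "A \<in> Obj (Fib H V)"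
  shows "swap B H f g f' g' A \<in> iso (Fib H T) (pbO H f (pbO H g A)) (pbO H f' (pbO H g' A))"
proof -
  interpret D: category "Fib H T" using assms hom_obj fib_category by blast
  show ?thesis
    using D.iso_comp[OF D.inv_arr(1)[OF conn_iso[OF assms(1,2) A]]] conn_iso[OF assms(3,4) A] assms
    by (simp add: swap_def homD(2)[OF assms(1)])
qed

end


section \<open>Tensor structures on one fibered category\<close>

context internal_tensor
begin

lemma ten_bifunctor:
  "S \<in> Obj B \<Longrightarrow> bifunctor (Fib H S) (Fib H S) (Fib H S) (itO T S) (itA T S)"
  using it_functor fib_category by (simp add: bifunctor_def bifunctor_axioms_def)

lemmas ten_obj = bifunctor.obj[OF ten_bifunctor]
  and ten_hom = bifunctor.map_hom[OF ten_bifunctor]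
  and ten_comp = bifunctor.map_comp[OF ten_bifunctor]
  and ten_iso = bifunctor.map_iso(1)[OF ten_bifunctor]
  and ten_inv = bifunctor.map_iso(2)[OF ten_bifunctor]

lemma mon_iso: "\<lbrakk>f \<in> hom B S' S; A \<in> Obj (Fib H S); A' \<in> Obj (Fib H S)\<rbrakk> \<Longrightarrow>
    itM T f A A' \<in> iso (Fib H S') (itO T S' (pbO H f A) (pbO H f A')) (pbO H f (itO T S A A'))"
  and mon_square: "\<lbrakk>f \<in> hom B S' S; h \<in> hom (Fib H S) X Y; h' \<in> hom (Fib H S) X' Y'\<rbrakk> \<Longrightarrow>
    pbA H f (itA T S h h') \<cdot>\<^bsub>Fib H S'\<^esub> itM T f X X'
      = itM T f Y Y' \<cdot>\<^bsub>Fib H S'\<^esub> itA T S' (pbA H f h) (pbA H f h')"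
  using it_mon_natural[unfolded bifunctor_natural_iso_iff] by blast+

text \<open>In the cocycle identity for \<open>m\<close> at \<open>(id, id)\<close> the arrow \<open>m\<^sub>i\<^sub>d\<close> occurs once on one side and twice on the
  other; cancelling it leaves the claim. The identifications cannot be omitted, because \<open>conn id id\<close> may differ
  from the identity.\<close>

lemma mon_id:
  assumes S: "S \<in> Obj B" and A: "A \<in> Obj (Fib H S)" and A': "A' \<in> Obj (Fib H S)"
  shows "itM T (Idm B S) A A' \<cdot>\<^bsub>Fib H S\<^esub> itA T S (idn B H S A) (idn B H S A')
    = idn B H S (itO T S A A')"
proof -
  interpret D: category "Fib H S" by (rule fib_category[OF S])
  note AA = ten_obj[OF S A A']
  have m: "itM T (Idm B S) A A' \<in> iso (Fib H S) (itO T S A A') (itO T S A A')"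
    using mon_iso[OF id_hom[OF S] A A'] S A A' AA by (simp add: pb_id_obj)
  note i = ten_hom[OF S iso_hom[OF idn_iso[OF S A]] iso_hom[OF idn_iso[OF S A']]]
  have "itM T (Idm B S) A A' \<cdot>\<^bsub>Fib H S\<^esub> idn B H S (itO T S A A')
      = itM T (Idm B S) A A' \<cdot>\<^bsub>Fib H S\<^esub> itM T (Idm B S) A A' \<cdot>\<^bsub>Fib H S\<^esub> itA T S (idn B H S A) (idn B H S A')"
    using it_mon_comp[OF id_hom[OF S] id_hom[OF S] A A'] S A A'
      idn_square[OF S iso_hom[OF m]] homD(1)[OF iso_hom[OF m]]
    by (simp add: idn_def pb_id_obj pb_id_arr id_left[OF id_hom])
  then show ?thesis
    using D.iso_cancel_left[OF m iso_hom[OF idn_iso[OF S AA]] D.comp_hom[OF i iso_hom[OF m]]] by simp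
qed

end

context external_tensor
begin

lemma ext_bifunctor:
  "\<lbrakk>S1 \<in> Obj B; S2 \<in> Obj B\<rbrakk> \<Longrightarrow>
    bifunctor (Fib H S1) (Fib H S2) (Fib H (prd B S1 S2)) (etO X S1 S2) (etA X S1 S2)"
  using et_functor fib_category prd_obj by (simp add: bifunctor_def bifunctor_axioms_def)

lemmas ext_hom = bifunctor.map_hom[OF ext_bifunctor]
  and ext_iso = bifunctor.map_iso(1)[OF ext_bifunctor]
  and ext_inv = bifunctor.map_iso(2)[OF ext_bifunctor]

lemma emon_iso: "\<lbrakk>f1 \<in> hom B T1 S1; f2 \<in> hom B T2 S2; A1 \<in> Obj (Fib H S1); A2 \<in> Obj (Fib H S2)\<rbrakk> \<Longrightarrow>
    etM X f1 f2 A1 A2 \<in> iso (Fib H (prd B T1 T2))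
      (etO X T1 T2 (pbO H f1 A1) (pbO H f2 A2)) (pbO H (cross B f1 f2) (etO X S1 S2 A1 A2))"
  using et_mon_natural[unfolded bifunctor_natural_iso_iff] by blast

end

text \<open>\<open>(q\<^sub>1 h)\<^sup>* A1 \<otimes> (q\<^sub>2 h)\<^sup>* A2 \<rightarrow> h\<^sup>* (A1 \<boxtimes> A2)\<close>, for \<open>h\<close> into \<open>S1 \<times> S2\<close>. Up to identifications, the case
  \<open>h = id\<close> is the inverse of \<open>e\<close> and the case \<open>h = \<Delta>\<close> is \<open>diag_comparison\<close>.\<close>

definition comparison :: "('o, 'm) pcat \<Rightarrow> ('o, 'm, 'x, 'h) fibcat \<Rightarrow> ('o, 'm, 'x, 'h) itensor \<Rightarrow>
    ('o \<Rightarrow> 'o \<Rightarrow> 'x \<Rightarrow> 'x \<Rightarrow> 'h) \<Rightarrow> 'm \<Rightarrow> 'o \<Rightarrow> 'o \<Rightarrow> 'x \<Rightarrow> 'x \<Rightarrow> 'h" where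
  "comparison B H T e h S1 S2 A1 A2 =
     (let D = Fib H (Dom B h); q1 = prj1 B S1 S2; q2 = prj2 B S1 S2
      in pbA H h (inv_arr (Fib H (prd B S1 S2)) (e S1 S2 A1 A2))
           \<cdot>\<^bsub>D\<^esub> itM T h (pbO H q1 A1) (pbO H q2 A2)
           \<cdot>\<^bsub>D\<^esub> itA T (Dom B h) (conn H h q1 A1) (conn H h q2 A2))"

locale tensor_equivalence =
  T: internal_tensor B H T + X: external_tensor B H X
  for B :: "('o, 'm) pcat" and H :: "('o, 'm, 'x, 'h) fibcat" and T X +
  fixes e :: "'o \<Rightarrow> 'o \<Rightarrow> 'x \<Rightarrow> 'x \<Rightarrow> 'h"
  assumes e_natural: "\<lbrakk>S1 \<in> Obj B; S2 \<in> Obj B\<rbrakk> \<Longrightarrow>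
      is_natural_iso (prod_cat (Fib H S1) (Fib H S2)) (Fib H (prd B S1 S2))
        (\<lambda>(A1, A2). etO X S1 S2 A1 A2) (\<lambda>(h1, h2). etA X S1 S2 h1 h2)
        (\<lambda>(A1, A2). etO (E_ext B H T) S1 S2 A1 A2) (\<lambda>(h1, h2). etA (E_ext B H T) S1 S2 h1 h2)
        (\<lambda>(A1, A2). e S1 S2 A1 A2)"
    and e_monoidal: "\<lbrakk>f1 \<in> hom B T1 S1; f2 \<in> hom B T2 S2; A1 \<in> Obj (Fib H S1); A2 \<in> Obj (Fib H S2)\<rbrakk> \<Longrightarrow>
      pbA H (cross B f1 f2) (e S1 S2 A1 A2) \<cdot>\<^bsub>Fib H (prd B T1 T2)\<^esub> etM X f1 f2 A1 A2
        = etM (E_ext B H T) f1 f2 A1 A2 \<cdot>\<^bsub>Fib H (prd B T1 T2)\<^esub> e T1 T2 (pbO H f1 A1) (pbO H f2 A2)"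
begin

lemma e_iso: "\<lbrakk>S1 \<in> Obj B; S2 \<in> Obj B; A1 \<in> Obj (Fib H S1); A2 \<in> Obj (Fib H S2)\<rbrakk> \<Longrightarrow>
    e S1 S2 A1 A2 \<in> iso (Fib H (prd B S1 S2)) (etO X S1 S2 A1 A2)
      (itO T (prd B S1 S2) (pbO H (prj1 B S1 S2) A1) (pbO H (prj2 B S1 S2) A2))"
  and e_square: "\<lbrakk>S1 \<in> Obj B; S2 \<in> Obj B; u1 \<in> hom (Fib H S1) A1 A1'; u2 \<in> hom (Fib H S2) A2 A2'\<rbrakk> \<Longrightarrow>
    itA T (prd B S1 S2) (pbA H (prj1 B S1 S2) u1) (pbA H (prj2 B S1 S2) u2)
        \<cdot>\<^bsub>Fib H (prd B S1 S2)\<^esub> e S1 S2 A1 A2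
      = e S1 S2 A1' A2' \<cdot>\<^bsub>Fib H (prd B S1 S2)\<^esub> etA X S1 S2 u1 u2"
  using e_natural[unfolded bifunctor_natural_iso_iff] by (auto simp: E_ext_def)

context
  fixes S1 S2 U h q1 q2 P D
  assumes S1: "S1 \<in> Obj B" and S2: "S2 \<in> Obj B" and h: "h \<in> hom B U (prd B S1 S2)"
  defines "q1 \<equiv> prj1 B S1 S2" and "q2 \<equiv> prj2 B S1 S2" and "P \<equiv> prd B S1 S2" and "D \<equiv> Fib H U"
begin

lemma comparison_parts:
  assumes A: "A1 \<in> Obj (Fib H S1)" "A2 \<in> Obj (Fib H S2)"
  shows "comparison B H T e h S1 S2 A1 A2 = pbA H h (inv_arr (Fib H P) (e S1 S2 A1 A2))
      \<cdot>\<^bsub>D\<^esub> itM T h (pbO H q1 A1) (pbO H q2 A2) \<cdot>\<^bsub>D\<^esub> itA T U (conn H h q1 A1) (conn H h q2 A2)"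
    "pbA H h (inv_arr (Fib H P) (e S1 S2 A1 A2))
      \<in> iso D (pbO H h (itO T P (pbO H q1 A1) (pbO H q2 A2))) (pbO H h (etO X S1 S2 A1 A2))"
    "itM T h (pbO H q1 A1) (pbO H q2 A2) \<in> iso D
      (itO T U (pbO H h (pbO H q1 A1)) (pbO H h (pbO H q2 A2)))
      (pbO H h (itO T P (pbO H q1 A1) (pbO H q2 A2)))"
    "itA T U (conn H h q1 A1) (conn H h q2 A2) \<in> iso D
      (itO T U (pbO H (q1 \<cdot>\<^bsub>B\<^esub> h) A1) (pbO H (q2 \<cdot>\<^bsub>B\<^esub> h) A2))
      (itO T U (pbO H h (pbO H q1 A1)) (pbO H h (pbO H q2 A2)))"
proof -
  note q = T.prj1_hom[OF S1 S2] T.prj2_hom[OF S1 S2]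
  interpret P: category "Fib H P" using T.fib_category[OF T.prd_obj[OF S1 S2]] by (simp add: P_def)
  show "comparison B H T e h S1 S2 A1 A2 = pbA H h (inv_arr (Fib H P) (e S1 S2 A1 A2))
      \<cdot>\<^bsub>D\<^esub> itM T h (pbO H q1 A1) (pbO H q2 A2) \<cdot>\<^bsub>D\<^esub> itA T U (conn H h q1 A1) (conn H h q2 A2)"
    using homD(2)[OF h] by (simp add: comparison_def Let_def q1_def q2_def P_def D_def)
  show "pbA H h (inv_arr (Fib H P) (e S1 S2 A1 A2))
      \<in> iso D (pbO H h (itO T P (pbO H q1 A1) (pbO H q2 A2))) (pbO H h (etO X S1 S2 A1 A2))"
    using T.pb_iso(1)[OF h P.inv_arr(1)[OF e_iso[OF S1 S2 A, folded P_def], unfolded P_def]]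
    by (simp add: P_def D_def q1_def q2_def)
  show "itM T h (pbO H q1 A1) (pbO H q2 A2) \<in> iso D
      (itO T U (pbO H h (pbO H q1 A1)) (pbO H h (pbO H q2 A2)))
      (pbO H h (itO T P (pbO H q1 A1) (pbO H q2 A2)))"
    using T.mon_iso[OF h T.pb_obj[OF q(1) A(1)] T.pb_obj[OF q(2) A(2)]]
    by (simp add: P_def D_def q1_def q2_def)
  show "itA T U (conn H h q1 A1) (conn H h q2 A2) \<in> iso D
      (itO T U (pbO H (q1 \<cdot>\<^bsub>B\<^esub> h) A1) (pbO H (q2 \<cdot>\<^bsub>B\<^esub> h) A2))
      (itO T U (pbO H h (pbO H q1 A1)) (pbO H h (pbO H q2 A2)))"
    using T.ten_iso[OF T.hom_obj(1)[OF h] T.conn_iso[OF h q(1) A(1)] T.conn_iso[OF h q(2) A(2)]]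
    by (simp add: D_def q1_def q2_def)
qed

lemma comparison_iso:
  assumes A: "A1 \<in> Obj (Fib H S1)" "A2 \<in> Obj (Fib H S2)"
  shows "comparison B H T e h S1 S2 A1 A2 \<in> iso D
      (itO T U (pbO H (q1 \<cdot>\<^bsub>B\<^esub> h) A1) (pbO H (q2 \<cdot>\<^bsub>B\<^esub> h) A2)) (pbO H h (etO X S1 S2 A1 A2))"
proof -
  interpret D: category D using T.fib_category[OF T.hom_obj(1)[OF h]] by (simp add: D_def)
  show ?thesis
    unfolding comparison_parts(1)[OF A]
    by (rule D.iso_comp[OF D.iso_comp[OF comparison_parts(4,3)[OF A]] comparison_parts(2)[OF A]])
qed

lemma comparison_square:
  assumes u: "u1 \<in> hom (Fib H S1) A1 A1'" "u2 \<in> hom (Fib H S2) A2 A2'"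
  shows "pbA H h (etA X S1 S2 u1 u2) \<cdot>\<^bsub>D\<^esub> comparison B H T e h S1 S2 A1 A2
    = comparison B H T e h S1 S2 A1' A2'
        \<cdot>\<^bsub>D\<^esub> itA T U (pbA H (q1 \<cdot>\<^bsub>B\<^esub> h) u1) (pbA H (q2 \<cdot>\<^bsub>B\<^esub> h) u2)"
proof -
  note U = T.hom_obj(1)[OF h] and PO = T.prd_obj[OF S1 S2]
  interpret D: category D using T.fib_category[OF U] by (simp add: D_def)
  interpret P: category "Fib H P" using T.fib_category[OF PO] by (simp add: P_def)
  interpret F1: category "Fib H S1" using T.fib_category[OF S1] .
  interpret F2: category "Fib H S2" using T.fib_category[OF S2] .
  note q = T.prj1_hom[OF S1 S2, folded q1_def P_def] T.prj2_hom[OF S1 S2, folded q2_def P_def]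
  note h' = h[folded P_def]
  note A = F1.hom_obj(1)[OF u(1)] F2.hom_obj(1)[OF u(2)]
  note A' = F1.hom_obj(2)[OF u(1)] F2.hom_obj(2)[OF u(2)]
  note uq = T.pb_hom[OF q(1) u(1)] T.pb_hom[OF q(2) u(2)]
  have PO': "P \<in> Obj B" using PO by (simp add: P_def)
  note uqh = T.pb_hom[OF h' uq(1)] T.pb_hom[OF h' uq(2)]
  note E = e_iso[OF S1 S2 A, folded P_def q1_def q2_def]
    and E' = e_iso[OF S1 S2 A', folded P_def q1_def q2_def]
  note ext = X.ext_hom[OF S1 S2 u, folded P_def]
  note tq = T.ten_hom[OF PO' uq]
  have sq: "pbA H h (etA X S1 S2 u1 u2) \<cdot>\<^bsub>D\<^esub> pbA H h (inv_arr (Fib H P) (e S1 S2 A1 A2))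
      = pbA H h (inv_arr (Fib H P) (e S1 S2 A1' A2'))
          \<cdot>\<^bsub>D\<^esub> pbA H h (itA T P (pbA H q1 u1) (pbA H q2 u2))"
    using P.square_inv[OF E E' ext tq e_square[OF S1 S2 u, folded P_def q1_def q2_def]]
      T.pb_comp[OF h' P.inv_arr(2)[OF E] ext] T.pb_comp[OF h' tq P.inv_arr(2)[OF E']]
    by (simp add: D_def)
  have sq2: "itA T U (pbA H h (pbA H q1 u1)) (pbA H h (pbA H q2 u2)) \<cdot>\<^bsub>D\<^esub>
        itA T U (conn H h q1 A1) (conn H h q2 A2)
      = itA T U (conn H h q1 A1') (conn H h q2 A2') \<cdot>\<^bsub>D\<^esub>
        itA T U (pbA H (q1 \<cdot>\<^bsub>B\<^esub> h) u1) (pbA H (q2 \<cdot>\<^bsub>B\<^esub> h) u2)"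
    using T.ten_comp[OF U iso_hom[OF T.conn_iso[OF h' q(1) A(1)]] uqh(1)
        iso_hom[OF T.conn_iso[OF h' q(2) A(2)]] uqh(2)]
      T.ten_comp[OF U T.pb_hom[OF T.comp_hom[OF h' q(1)] u(1)] iso_hom[OF T.conn_iso[OF h' q(1) A'(1)]]
        T.pb_hom[OF T.comp_hom[OF h' q(2)] u(2)] iso_hom[OF T.conn_iso[OF h' q(2) A'(2)]]]
      T.conn_square[OF h' q(1) u(1)] T.conn_square[OF h' q(2) u(2)]
    by (simp add: D_def)
  note p = comparison_parts[OF A] and p' = comparison_parts[OF A']
  have tt: "itA T U (pbA H (q1 \<cdot>\<^bsub>B\<^esub> h) u1) (pbA H (q2 \<cdot>\<^bsub>B\<^esub> h) u2) \<in> hom D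
      (itO T U (pbO H (q1 \<cdot>\<^bsub>B\<^esub> h) A1) (pbO H (q2 \<cdot>\<^bsub>B\<^esub> h) A2))
      (itO T U (pbO H (q1 \<cdot>\<^bsub>B\<^esub> h) A1') (pbO H (q2 \<cdot>\<^bsub>B\<^esub> h) A2'))"
    using T.ten_hom[OF U T.pb_hom[OF T.comp_hom[OF h' q(1)] u(1)] T.pb_hom[OF T.comp_hom[OF h' q(2)] u(2)]]
    by (simp add: D_def)
  have tt': "itA T U (pbA H h (pbA H q1 u1)) (pbA H h (pbA H q2 u2)) \<in> hom D
      (itO T U (pbO H h (pbO H q1 A1)) (pbO H h (pbO H q2 A2)))
      (itO T U (pbO H h (pbO H q1 A1')) (pbO H h (pbO H q2 A2')))"
    using T.ten_hom[OF U uqh] by (simp add: D_def)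
  show ?thesis
    unfolding p(1) p'(1)
    by (rule D.square_paste[OF D.comp_hom[OF iso_hom[OF p(4)] iso_hom[OF p(3)]]
          D.comp_hom[OF iso_hom[OF p'(4)] iso_hom[OF p'(3)]] iso_hom[OF p(2)] iso_hom[OF p'(2)]
          tt T.pb_hom[OF h' tq, folded D_def] T.pb_hom[OF h' ext, folded D_def]
          D.square_paste[OF iso_hom[OF p(4)] iso_hom[OF p'(4)] iso_hom[OF p(3)] iso_hom[OF p'(3)]
            tt tt' T.pb_hom[OF h' tq, folded D_def] sq2 T.mon_square[OF h' uq, folded D_def]] sq])
qed

text \<open>Three squares are pasted: the cocycle identity of \<open>conn\<close> in the two factors (after naturality of \<open>m\<close>), the
  cocycle identity of \<open>m\<close>, and naturality of \<open>conn\<close> at the inverse of \<open>e\<close>.\<close>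

lemma comparison_pullback:
  assumes f: "f \<in> hom B V U" and A: "A1 \<in> Obj (Fib H S1)" "A2 \<in> Obj (Fib H S2)"
  defines "f1 \<equiv> q1 \<cdot>\<^bsub>B\<^esub> h" and "f2 \<equiv> q2 \<cdot>\<^bsub>B\<^esub> h"
  shows "conn H f h (etO X S1 S2 A1 A2) \<cdot>\<^bsub>Fib H V\<^esub> comparison B H T e (h \<cdot>\<^bsub>B\<^esub> f) S1 S2 A1 A2
    = pbA H f (comparison B H T e h S1 S2 A1 A2) \<cdot>\<^bsub>Fib H V\<^esub> itM T f (pbO H f1 A1) (pbO H f2 A2)
        \<cdot>\<^bsub>Fib H V\<^esub> itA T V (conn H f f1 A1) (conn H f f2 A2)"
proof -
  define E where "E = Fib H V"
  note V = T.hom_obj(1)[OF f] and U = T.hom_obj(1)[OF h] and PO = T.prd_obj[OF S1 S2]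
  interpret P: category "Fib H P" using T.fib_category[OF PO] by (simp add: P_def)
  interpret D: category D using T.fib_category[OF U] by (simp add: D_def)
  interpret E: category E using T.fib_category[OF V] by (simp add: E_def)
  note q = T.prj1_hom[OF S1 S2, folded q1_def P_def] T.prj2_hom[OF S1 S2, folded q2_def P_def]
  note h' = h[folded P_def]
  note fh = T.comp_hom[OF f h']
  have PO': "P \<in> Obj B" using PO by (simp add: P_def)
  have ff: "f1 \<in> hom B U S1" "f2 \<in> hom B U S2"
    using T.comp_hom[OF h' q(1)] T.comp_hom[OF h' q(2)] by (simp_all add: f1_def f2_def)
  have as: "q1 \<cdot>\<^bsub>B\<^esub> h \<cdot>\<^bsub>B\<^esub> f = f1 \<cdot>\<^bsub>B\<^esub> f" "q2 \<cdot>\<^bsub>B\<^esub> h \<cdot>\<^bsub>B\<^esub> f = f2 \<cdot>\<^bsub>B\<^esub> f"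
    using T.comp_assoc[OF f h' q(1)] T.comp_assoc[OF f h' q(2)] by (simp_all add: f1_def f2_def)
  note qA = T.pb_obj[OF q(1) A(1)] T.pb_obj[OF q(2) A(2)]
  note c1 = iso_hom[OF T.conn_iso[OF f ff(1) A(1)]] and c2 = iso_hom[OF T.conn_iso[OF f ff(2) A(2)]]
  have d: "conn H h q1 A1 \<in> hom D (pbO H f1 A1) (pbO H h (pbO H q1 A1))"
    "conn H h q2 A2 \<in> hom D (pbO H f2 A2) (pbO H h (pbO H q2 A2))"
    using iso_hom[OF T.conn_iso[OF h' q(1) A(1)]] iso_hom[OF T.conn_iso[OF h' q(2) A(2)]]
    by (simp_all add: f1_def f2_def D_def)
  note fd = T.pb_hom[OF f d(1)[unfolded D_def]] T.pb_hom[OF f d(2)[unfolded D_def]]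
  have d': "conn H (h \<cdot>\<^bsub>B\<^esub> f) q1 A1 \<in> hom E (pbO H (f1 \<cdot>\<^bsub>B\<^esub> f) A1) (pbO H (h \<cdot>\<^bsub>B\<^esub> f) (pbO H q1 A1))"
    "conn H (h \<cdot>\<^bsub>B\<^esub> f) q2 A2 \<in> hom E (pbO H (f2 \<cdot>\<^bsub>B\<^esub> f) A2) (pbO H (h \<cdot>\<^bsub>B\<^esub> f) (pbO H q2 A2))"
    using iso_hom[OF T.conn_iso[OF fh q(1) A(1)]] iso_hom[OF T.conn_iso[OF fh q(2) A(2)]]
    by (simp_all add: as E_def)
  note k = iso_hom[OF T.conn_iso[OF f h' qA(1)]] iso_hom[OF T.conn_iso[OF f h' qA(2)]]
  define u where "u = itM T f (pbO H f1 A1) (pbO H f2 A2) \<cdot>\<^bsub>E\<^esub> itA T V (conn H f f1 A1) (conn H f f2 A2)"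
  define n where "n = itM T f (pbO H h (pbO H q1 A1)) (pbO H h (pbO H q2 A2))
      \<cdot>\<^bsub>E\<^esub> itA T V (conn H f h (pbO H q1 A1)) (conn H f h (pbO H q2 A2))"
  note fA = T.pb_obj[OF ff(1) A(1)] T.pb_obj[OF ff(2) A(2)]
  note hqA = T.pb_obj[OF h' qA(1)] T.pb_obj[OF h' qA(2)]
  note m1 = iso_hom[OF T.mon_iso[OF f fA], folded E_def] and m2 = iso_hom[OF T.mon_iso[OF f hqA], folded E_def]
  note cc = T.ten_hom[OF V c1 c2, folded E_def] and kk = T.ten_hom[OF V k, folded E_def]
  have u: "u \<in> hom E (itO T V (pbO H (f1 \<cdot>\<^bsub>B\<^esub> f) A1) (pbO H (f2 \<cdot>\<^bsub>B\<^esub> f) A2))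
      (pbO H f (itO T U (pbO H f1 A1) (pbO H f2 A2)))"
    unfolding u_def by (rule E.comp_hom[OF cc m1])
  have n: "n \<in> hom E (itO T V (pbO H (h \<cdot>\<^bsub>B\<^esub> f) (pbO H q1 A1)) (pbO H (h \<cdot>\<^bsub>B\<^esub> f) (pbO H q2 A2)))
      (pbO H f (itO T U (pbO H h (pbO H q1 A1)) (pbO H h (pbO H q2 A2))))"
    unfolding n_def by (rule E.comp_hom[OF kk m2])
  note fdd = T.ten_hom[OF V fd, folded E_def] and dd' = T.ten_hom[OF V d'[unfolded E_def], folded E_def]
  note dd = T.ten_hom[OF U d[unfolded D_def]]
  have sq1: "n \<cdot>\<^bsub>E\<^esub> itA T V (conn H (h \<cdot>\<^bsub>B\<^esub> f) q1 A1) (conn H (h \<cdot>\<^bsub>B\<^esub> f) q2 A2)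
      = pbA H f (itA T U (conn H h q1 A1) (conn H h q2 A2)) \<cdot>\<^bsub>E\<^esub> u"
  proof -
    have "pbA H f (itA T U (conn H h q1 A1) (conn H h q2 A2)) \<cdot>\<^bsub>E\<^esub> u
        = itM T f (pbO H h (pbO H q1 A1)) (pbO H h (pbO H q2 A2)) \<cdot>\<^bsub>E\<^esub>
          itA T V (pbA H f (conn H h q1 A1)) (pbA H f (conn H h q2 A2)) \<cdot>\<^bsub>E\<^esub>
          itA T V (conn H f f1 A1) (conn H f f2 A2)"
      unfolding u_def
      using E.comp_assoc[OF cc m1 T.pb_hom[OF f dd, folded E_def]] E.comp_assoc[OF cc fdd m2]
        T.mon_square[OF f d[unfolded D_def]] by (simp add: E_def)
    also have "itA T V (pbA H f (conn H h q1 A1)) (pbA H f (conn H h q2 A2)) \<cdot>\<^bsub>E\<^esub>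
          itA T V (conn H f f1 A1) (conn H f f2 A2)
        = itA T V (conn H f h (pbO H q1 A1)) (conn H f h (pbO H q2 A2)) \<cdot>\<^bsub>E\<^esub>
          itA T V (conn H (h \<cdot>\<^bsub>B\<^esub> f) q1 A1) (conn H (h \<cdot>\<^bsub>B\<^esub> f) q2 A2)"
      using T.ten_comp[OF V c1 fd(1) c2 fd(2)] T.ten_comp[OF V d'(1)[unfolded E_def] k(1) d'(2)[unfolded E_def] k(2)]
        T.conn_cocycle[OF f h' q(1) A(1)] T.conn_cocycle[OF f h' q(2) A(2)]
      by (simp add: E_def f1_def f2_def)
    finally show ?thesis unfolding n_def using E.comp_assoc[OF dd' kk m2] by simp
  qed
  have sq2: "conn H f h (itO T P (pbO H q1 A1) (pbO H q2 A2)) \<cdot>\<^bsub>E\<^esub> itM T (h \<cdot>\<^bsub>B\<^esub> f) (pbO H q1 A1) (pbO H q2 A2)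
      = pbA H f (itM T h (pbO H q1 A1) (pbO H q2 A2)) \<cdot>\<^bsub>E\<^esub> n"
    unfolding n_def E_def by (rule T.it_mon_comp[OF f h' qA])
  note ei = P.inv_arr(2)[OF e_iso[OF S1 S2 A, folded P_def q1_def q2_def]]
  note sq3 = T.conn_square[OF f h' ei, folded E_def, symmetric]
  note t = P.hom_obj[OF ei]
  note ct = iso_hom[OF T.conn_iso[OF f h' t(1)], folded E_def] and ct' = iso_hom[OF T.conn_iso[OF f h' t(2)], folded E_def]
  note mh = iso_hom[OF T.mon_iso[OF h' qA]] and mfh = iso_hom[OF T.mon_iso[OF fh qA], folded E_def]
  note eih = T.pb_hom[OF h' ei]
  note fdd' = T.pb_hom[OF f dd, folded E_def] and fm = T.pb_hom[OF f mh, folded E_def]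
    and fe = T.pb_hom[OF f eih, folded E_def]
  have 1: "comparison B H T e (h \<cdot>\<^bsub>B\<^esub> f) S1 S2 A1 A2
      = pbA H (h \<cdot>\<^bsub>B\<^esub> f) (inv_arr (Fib H P) (e S1 S2 A1 A2))
      \<cdot>\<^bsub>E\<^esub> itM T (h \<cdot>\<^bsub>B\<^esub> f) (pbO H q1 A1) (pbO H q2 A2)
      \<cdot>\<^bsub>E\<^esub> itA T V (conn H (h \<cdot>\<^bsub>B\<^esub> f) q1 A1) (conn H (h \<cdot>\<^bsub>B\<^esub> f) q2 A2)"
    using homD(2)[OF fh] by (simp add: comparison_def Let_def P_def q1_def q2_def E_def)
  have 2: "pbA H f (comparison B H T e h S1 S2 A1 A2)
      = pbA H f (pbA H h (inv_arr (Fib H P) (e S1 S2 A1 A2)))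
      \<cdot>\<^bsub>E\<^esub> pbA H f (itM T h (pbO H q1 A1) (pbO H q2 A2))
      \<cdot>\<^bsub>E\<^esub> pbA H f (itA T U (conn H h q1 A1) (conn H h q2 A2))"
    unfolding comparison_parts(1)[OF A] D_def E_def
    using T.pb_comp[OF f D.comp_hom[OF dd[folded D_def] mh[folded D_def], unfolded D_def] eih]
      T.pb_comp[OF f dd mh] by simp
  show ?thesis
    unfolding 1 2 E_def[symmetric] u_def[symmetric]
    by (rule E.square_paste[OF E.comp_hom[OF dd' mfh] E.comp_hom[OF fdd' fm]
          T.pb_hom[OF fh ei, folded E_def] fe u ct ct'
          E.square_paste[OF dd' fdd' mfh fm u n ct sq1 sq2] sq3])
qed

end

text \<open>By \<open>mon_id\<close> the part of the comparison that comes from \<open>\<otimes>\<close> collapses to an identification.\<close>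

lemma comparison_id:
  assumes S1: "S1 \<in> Obj B" and S2: "S2 \<in> Obj B"
    and A: "A1 \<in> Obj (Fib H S1)" "A2 \<in> Obj (Fib H S2)"
  defines "P \<equiv> prd B S1 S2"
  shows "comparison B H T e (Idm B P) S1 S2 A1 A2
    = idn B H P (etO X S1 S2 A1 A2) \<cdot>\<^bsub>Fib H P\<^esub> inv_arr (Fib H P) (e S1 S2 A1 A2)"
proof -
  have P: "P \<in> Obj B" using T.prd_obj[OF S1 S2] by (simp add: P_def)
  interpret D: category "Fib H P" by (rule T.fib_category[OF P])
  note q = T.prj1_hom[OF S1 S2, folded P_def] T.prj2_hom[OF S1 S2, folded P_def]
  note qA = T.pb_obj[OF q(1) A(1)] T.pb_obj[OF q(2) A(2)]
  note ei = D.inv_arr(2)[OF e_iso[OF S1 S2 A, folded P_def]]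
  show ?thesis
    using T.mon_id[OF P qA] T.idn_square[OF P ei] T.pb_id_arr[OF P homD(1)[OF ei]]
      T.conn_id_left[OF q(1) A(1)] T.conn_id_left[OF q(2) A(2)] homD(2)[OF T.id_hom[OF P]]
    by (simp add: comparison_def Let_def P_def)
qed

text \<open>This is the compatibility of \<open>e\<close> with \<open>m\<close>, solved for the comparison along \<open>f1 \<times> f2\<close>. The identifications
  \<open>swap\<close> in the monoidality isomorphism of \<open>E(\<otimes>)\<close> are \<open>conn\<close> after an inverse of \<open>conn\<close>; the former belongs to the
  comparison, the latter is moved to the other side.\<close>

lemma comparison_etM:
  assumes f1: "f1 \<in> hom B T1 S1" and f2: "f2 \<in> hom B T2 S2"
    and A: "A1 \<in> Obj (Fib H S1)" "A2 \<in> Obj (Fib H S2)"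
  defines "P \<equiv> prd B T1 T2"
  shows "comparison B H T e (cross B f1 f2) S1 S2 A1 A2
    = (etM X f1 f2 A1 A2 \<cdot>\<^bsub>Fib H P\<^esub> inv_arr (Fib H P) (e T1 T2 (pbO H f1 A1) (pbO H f2 A2)))
      \<cdot>\<^bsub>Fib H P\<^esub> itA T P (conn H (prj1 B T1 T2) f1 A1) (conn H (prj2 B T1 T2) f2 A2)"
proof -
  define D where "D = Fib H P"
  define p1 p2 q1 q2 c where "p1 = prj1 B T1 T2" and "p2 = prj2 B T1 T2"
    and "q1 = prj1 B S1 S2" and "q2 = prj2 B S1 S2" and "c = cross B f1 f2"
  note T1 = T.hom_obj(1)[OF f1] and T2 = T.hom_obj(1)[OF f2]
    and S1 = T.hom_obj(2)[OF f1] and S2 = T.hom_obj(2)[OF f2]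
  have P: "P \<in> Obj B" using T.prd_obj[OF T1 T2] by (simp add: P_def)
  interpret D: category D unfolding D_def by (rule T.fib_category[OF P])
  interpret Q: category "Fib H (prd B S1 S2)" by (rule T.fib_category[OF T.prd_obj[OF S1 S2]])
  have p: "p1 \<in> hom B P T1" "p2 \<in> hom B P T2"
    using T.prj1_hom[OF T1 T2] T.prj2_hom[OF T1 T2] by (simp_all add: p1_def p2_def P_def)
  have q: "q1 \<in> hom B (prd B S1 S2) S1" "q2 \<in> hom B (prd B S1 S2) S2"
    using T.prj1_hom[OF S1 S2] T.prj2_hom[OF S1 S2] by (simp_all add: q1_def q2_def)
  have c: "c \<in> hom B P (prd B S1 S2)" "q1 \<cdot>\<^bsub>B\<^esub> c = f1 \<cdot>\<^bsub>B\<^esub> p1" "q2 \<cdot>\<^bsub>B\<^esub> c = f2 \<cdot>\<^bsub>B\<^esub> p2"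
    using T.cross[OF f1 f2] by (simp_all add: p1_def p2_def P_def q1_def q2_def c_def)
  note qA = T.pb_obj[OF q(1) A(1)] T.pb_obj[OF q(2) A(2)]
  note fA = T.pb_obj[OF f1 A(1)] T.pb_obj[OF f2 A(2)]
  note cq = T.conn_iso[OF c(1) q(1) A(1), folded D_def, unfolded c(2)]
    T.conn_iso[OF c(1) q(2) A(2), folded D_def, unfolded c(3)]
  note cp = T.conn_iso[OF p(1) f1 A(1), folded D_def] T.conn_iso[OF p(2) f2 A(2), folded D_def]
  have sw: "swap B H p1 f1 c q1 A1 \<cdot>\<^bsub>D\<^esub> conn H p1 f1 A1 = conn H c q1 A1"
    "swap B H p2 f2 c q2 A2 \<cdot>\<^bsub>D\<^esub> conn H p2 f2 A2 = conn H c q2 A2"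
    using D.inv_arr_cancel(4)[OF cp(1) iso_hom[OF cq(1)]] D.inv_arr_cancel(4)[OF cp(2) iso_hom[OF cq(2)]]
      homD(2)[OF p(1)] homD(2)[OF p(2)] by (simp_all add: swap_def D_def)
  note sh = iso_hom[OF T.swap_iso[OF p(1) f1 c(1) q(1) c(2)[symmetric] A(1)]]
    iso_hom[OF T.swap_iso[OF p(2) f2 c(1) q(2) c(3)[symmetric] A(2)]]
  have sten: "itA T P (swap B H p1 f1 c q1 A1) (swap B H p2 f2 c q2 A2)
      \<cdot>\<^bsub>D\<^esub> itA T P (conn H p1 f1 A1) (conn H p2 f2 A2) = itA T P (conn H c q1 A1) (conn H c q2 A2)"
    using T.ten_comp[OF P iso_hom[OF cp(1), unfolded D_def] sh(1) iso_hom[OF cp(2), unfolded D_def] sh(2)]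
      sw by (simp add: D_def)
  define s where "s = itA T P (swap B H p1 f1 c q1 A1) (swap B H p2 f2 c q2 A2)"
  define k where "k = itA T P (conn H p1 f1 A1) (conn H p2 f2 A2)"
  define m where "m = itM T c (pbO H q1 A1) (pbO H q2 A2)"
  define E where "E = e T1 T2 (pbO H f1 A1) (pbO H f2 A2)"
  define F where "F = e S1 S2 A1 A2"
  have s: "s \<in> hom D (itO T P (pbO H p1 (pbO H f1 A1)) (pbO H p2 (pbO H f2 A2)))
      (itO T P (pbO H c (pbO H q1 A1)) (pbO H c (pbO H q2 A2)))"
    using T.ten_hom[OF P sh] by (simp add: s_def D_def)
  have k: "k \<in> hom D (itO T P (pbO H (f1 \<cdot>\<^bsub>B\<^esub> p1) A1) (pbO H (f2 \<cdot>\<^bsub>B\<^esub> p2) A2))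
      (itO T P (pbO H p1 (pbO H f1 A1)) (pbO H p2 (pbO H f2 A2)))"
    using T.ten_hom[OF P iso_hom[OF cp(1), unfolded D_def] iso_hom[OF cp(2), unfolded D_def]]
    by (simp add: k_def D_def)
  note m = iso_hom[OF T.mon_iso[OF c(1) qA], folded D_def m_def]
  have E: "E \<in> iso D (etO X T1 T2 (pbO H f1 A1) (pbO H f2 A2))
      (itO T P (pbO H p1 (pbO H f1 A1)) (pbO H p2 (pbO H f2 A2)))"
    using e_iso[OF T1 T2 fA] by (simp add: E_def D_def P_def p1_def p2_def)
  have F: "F \<in> iso (Fib H (prd B S1 S2)) (etO X S1 S2 A1 A2)
      (itO T (prd B S1 S2) (pbO H q1 A1) (pbO H q2 A2))"
    using e_iso[OF S1 S2 A] by (simp add: F_def q1_def q2_def)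
  note cF = T.pb_iso(1)[OF c(1) F, folded D_def] and cFi = T.pb_iso(2)[OF c(1) F, folded D_def]
  have M: "etM X f1 f2 A1 A2 \<in> hom D (etO X T1 T2 (pbO H f1 A1) (pbO H f2 A2)) (pbO H c (etO X S1 S2 A1 A2))"
    using iso_hom[OF X.emon_iso[OF f1 f2 A]] by (simp add: D_def P_def c_def)
  have eq: "pbA H c F \<cdot>\<^bsub>D\<^esub> etM X f1 f2 A1 A2 = (m \<cdot>\<^bsub>D\<^esub> s) \<cdot>\<^bsub>D\<^esub> E"
    using e_monoidal[OF f1 f2 A] homD[OF f1] homD[OF f2]
    by (simp add: E_ext_def Let_def D_def P_def F_def m_def s_def E_def c_def p1_def p2_def q1_def q2_def)
  have "etM X f1 f2 A1 A2 \<cdot>\<^bsub>D\<^esub> inv_arr D E = pbA H c (inv_arr (Fib H (prd B S1 S2)) F) \<cdot>\<^bsub>D\<^esub> m \<cdot>\<^bsub>D\<^esub> s"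
    using D.square_inv[OF E cF M D.comp_hom[OF s m] eq[symmetric]] cFi by simp
  then have "(etM X f1 f2 A1 A2 \<cdot>\<^bsub>D\<^esub> inv_arr D E) \<cdot>\<^bsub>D\<^esub> k
      = pbA H c (inv_arr (Fib H (prd B S1 S2)) F) \<cdot>\<^bsub>D\<^esub> m \<cdot>\<^bsub>D\<^esub> s \<cdot>\<^bsub>D\<^esub> k"
    using D.comp_assoc[OF k D.comp_hom[OF s m] D.inv_arr(2)[OF cF]] cFi D.comp_assoc[OF k s m] by simp
  also have "s \<cdot>\<^bsub>D\<^esub> k = itA T P (conn H c q1 A1) (conn H c q2 A2)"
    unfolding s_def k_def by (rule sten)
  finally show ?thesis
    using homD(2)[OF c(1)]
    by (simp add: comparison_def Let_def D_def F_def m_def k_def E_def c_def p1_def p2_def q1_def q2_def)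
qed

context
  fixes S d D
  assumes S: "S \<in> Obj B"
  defines "d \<equiv> diag B S" and "D \<equiv> Fib H S"
begin

text \<open>Each factor of \<open>diag_comparison\<close> contains an identification of \<open>A\<close> with \<open>id\<^sup>*A = (q\<^sub>i \<Delta>)\<^sup>*A\<close>; bifunctoriality
  splits it off.\<close>

lemma diag_comparison_eq:
  assumes A: "A \<in> Obj (Fib H S)" "A' \<in> Obj (Fib H S)"
  shows "diag_comparison B H T e S A A'
    = comparison B H T e d S S A A' \<cdot>\<^bsub>D\<^esub> itA T S (idn B H S A) (idn B H S A')"
proof -
  interpret D: category D unfolding D_def by (rule T.fib_category[OF S])
  note d = T.diag[OF S, folded d_def]
  note q = T.prj1_hom[OF S S] T.prj2_hom[OF S S]
  note i = iso_hom[OF T.idn_iso[OF S A(1)]] iso_hom[OF T.idn_iso[OF S A(2)]]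
  have c: "conn H d (prj1 B S S) A \<in> hom D A (pbO H d (pbO H (prj1 B S S) A))"
    "conn H d (prj2 B S S) A' \<in> hom D A' (pbO H d (pbO H (prj2 B S S) A'))"
    using iso_hom[OF T.conn_iso[OF d(1) q(1) A(1)]] iso_hom[OF T.conn_iso[OF d(1) q(2) A(2)]]
      T.pb_id_obj[OF S A(1)] T.pb_id_obj[OF S A(2)] by (simp_all add: d D_def)
  note p = comparison_parts[OF S S d(1) A, folded D_def, unfolded d T.pb_id_obj[OF S A(1)] T.pb_id_obj[OF S A(2)]]
  note ii = T.ten_hom[OF S i, folded D_def]
  show ?thesis
    unfolding p(1)
    using D.comp_assoc[OF ii D.comp_hom[OF iso_hom[OF p(4)] iso_hom[OF p(3)]] iso_hom[OF p(2)]]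
      D.comp_assoc[OF ii iso_hom[OF p(4)] iso_hom[OF p(3)]]
      T.ten_comp[OF S i(1) c(1)[unfolded D_def] i(2) c(2)[unfolded D_def]]
    by (simp add: diag_comparison_def Let_def D_def d_def)
qed

lemma comparison_diag_iso:
  assumes A: "A \<in> Obj (Fib H S)" "A' \<in> Obj (Fib H S)"
  shows "comparison B H T e d S S A A' \<in> iso D (itO T S A A') (pbO H d (etO X S S A A'))"
  using comparison_iso[OF S S T.diag(1)[OF S] A]
  by (simp add: T.diag[OF S] T.pb_id_obj[OF S A(1)] T.pb_id_obj[OF S A(2)] D_def d_def)

lemma diag_comparison_iso:
  assumes A: "A \<in> Obj (Fib H S)" "A' \<in> Obj (Fib H S)"
  shows "diag_comparison B H T e S A A' \<in> iso D (itO T S A A') (pbO H d (etO X S S A A'))"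
proof -
  interpret D: category D unfolding D_def by (rule T.fib_category[OF S])
  show ?thesis
    unfolding diag_comparison_eq[OF A]
    by (rule D.iso_comp[OF T.ten_iso[OF S T.idn_iso[OF S A(1)] T.idn_iso[OF S A(2)], folded D_def]
          comparison_diag_iso[OF A]])
qed

lemma diag_comparison_square:
  assumes u: "u \<in> hom (Fib H S) A A1" "u' \<in> hom (Fib H S) A' A1'"
  shows "pbA H d (etA X S S u u') \<cdot>\<^bsub>D\<^esub> diag_comparison B H T e S A A'
    = diag_comparison B H T e S A1 A1' \<cdot>\<^bsub>D\<^esub> itA T S u u'"
proof -
  interpret D: category "Fib H S" by (rule T.fib_category[OF S])
  note d = T.diag[OF S, folded d_def]
  note A = D.hom_obj(1)[OF u(1)] D.hom_obj(1)[OF u(2)] and A1 = D.hom_obj(2)[OF u(1)] D.hom_obj(2)[OF u(2)]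
  note i = iso_hom[OF T.idn_iso[OF S A(1)]] iso_hom[OF T.idn_iso[OF S A(2)]]
  note i1 = iso_hom[OF T.idn_iso[OF S A1(1)]] iso_hom[OF T.idn_iso[OF S A1(2)]]
  have sq: "itA T S u u' \<cdot>\<^bsub>Fib H S\<^esub> itA T S (idn B H S A) (idn B H S A')
      = itA T S (idn B H S A1) (idn B H S A1') \<cdot>\<^bsub>Fib H S\<^esub> itA T S u u'"
    using T.ten_comp[OF S i(1) u(1) i(2) u(2)] T.ten_comp[OF S u(1) i1(1) u(2) i1(2)]
      T.idn_square[OF S u(1)] T.idn_square[OF S u(2)] by simp
  have sq2: "pbA H d (etA X S S u u') \<cdot>\<^bsub>Fib H S\<^esub> comparison B H T e d S S A A'
      = comparison B H T e d S S A1 A1' \<cdot>\<^bsub>Fib H S\<^esub> itA T S u u'"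
    using comparison_square[OF S S d(1) u] T.pb_id_arr[OF S homD(1)[OF u(1)]] T.pb_id_arr[OF S homD(1)[OF u(2)]]
    by (simp add: d)
  note uu = T.ten_hom[OF S u]
  show ?thesis
    unfolding diag_comparison_eq[OF A] diag_comparison_eq[OF A1] D_def
    by (rule D.square_paste[OF T.ten_hom[OF S i] T.ten_hom[OF S i1]
          iso_hom[OF comparison_diag_iso[OF A, unfolded D_def]]
          iso_hom[OF comparison_diag_iso[OF A1, unfolded D_def]]
          uu uu T.pb_hom[OF d(1) X.ext_hom[OF S S u]] sq sq2])
qed

text \<open>The arrow \<open>conn f id\<close> that \<open>comparison_pullback\<close> produces in each factor is \<open>f\<^sup>*(idn)\<close> by \<open>conn_id_right\<close>, which
  is exactly the identification contained in the comparison along the diagonal. The identity exhibits the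
  monoidality isomorphism of \<open>\<otimes>\<close> in terms of comparisons.\<close>

lemma diag_comparison_pullback:
  assumes f: "f \<in> hom B U S" and A: "A \<in> Obj (Fib H S)" "A' \<in> Obj (Fib H S)"
  shows "pbA H f (diag_comparison B H T e S A A') \<cdot>\<^bsub>Fib H U\<^esub> itM T f A A'
    = conn H f d (etO X S S A A') \<cdot>\<^bsub>Fib H U\<^esub> comparison B H T e (d \<cdot>\<^bsub>B\<^esub> f) S S A A'"
proof -
  interpret D: category D unfolding D_def by (rule T.fib_category[OF S])
  interpret E: category "Fib H U" by (rule T.fib_category[OF T.hom_obj(1)[OF f]])
  note d = T.diag[OF S, folded d_def]
  note i = iso_hom[OF T.idn_iso[OF S A(1)]] iso_hom[OF T.idn_iso[OF S A(2)]]
  note ii = T.ten_hom[OF S i]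
  note k = iso_hom[OF comparison_diag_iso[OF A, unfolded D_def]]
  note m = iso_hom[OF T.mon_iso[OF f A]]
  note fi = T.pb_hom[OF f i(1)] T.pb_hom[OF f i(2)]
  have "pbA H f (diag_comparison B H T e S A A') \<cdot>\<^bsub>Fib H U\<^esub> itM T f A A'
      = pbA H f (comparison B H T e d S S A A') \<cdot>\<^bsub>Fib H U\<^esub> itM T f A A'
        \<cdot>\<^bsub>Fib H U\<^esub> itA T U (pbA H f (idn B H S A)) (pbA H f (idn B H S A'))"
    unfolding diag_comparison_eq[OF A] D_def
    using T.pb_comp[OF f ii k] E.comp_assoc[OF m T.pb_hom[OF f ii] T.pb_hom[OF f k]]
      T.mon_square[OF f i] by simp
  also have "\<dots> = conn H f d (etO X S S A A') \<cdot>\<^bsub>Fib H U\<^esub> comparison B H T e (d \<cdot>\<^bsub>B\<^esub> f) S S A A'"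
    using comparison_pullback[OF S S d(1) f A] T.conn_id_right[OF f A(1)] T.conn_id_right[OF f A(2)]
      T.pb_id_obj[OF S A(1)] T.pb_id_obj[OF S A(2)]
    by (simp add: d)
  finally show ?thesis .
qed

end

text \<open>The arrow \<open>c \<cdot> d\<close> is the one with components \<open>f1\<close> and \<open>f2\<close>. So all comparisons are determined by the one
  along the diagonal and the monoidality isomorphisms of \<open>\<boxtimes>\<close>. The coherence arrows left over in each factor
  compose to the identity by the cocycle identity of \<open>conn\<close> for \<open>f\<^sub>i pr\<^sub>i \<Delta>\<close>.\<close>

lemma comparison_tuple:
  assumes f1: "f1 \<in> hom B U S1" and f2: "f2 \<in> hom B U S2"
    and A: "A1 \<in> Obj (Fib H S1)" "A2 \<in> Obj (Fib H S2)"
  defines "d \<equiv> diag B U" and "c \<equiv> cross B f1 f2"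
  shows "conn H d c (etO X S1 S2 A1 A2) \<cdot>\<^bsub>Fib H U\<^esub> comparison B H T e (c \<cdot>\<^bsub>B\<^esub> d) S1 S2 A1 A2
    = pbA H d (etM X f1 f2 A1 A2)
      \<cdot>\<^bsub>Fib H U\<^esub> diag_comparison B H T e U (pbO H f1 A1) (pbO H f2 A2)"
proof -
  note U = T.hom_obj(1)[OF f1] and S1 = T.hom_obj(2)[OF f1] and S2 = T.hom_obj(2)[OF f2]
  define D p1 p2 where "D = Fib H U" and "p1 = prj1 B U U" and "p2 = prj2 B U U"
  interpret D: category D unfolding D_def by (rule T.fib_category[OF U])
  interpret P: category "Fib H (prd B U U)" by (rule T.fib_category[OF T.prd_obj[OF U U]])
  note d = T.diag[OF U, folded d_def p1_def p2_def]
  note p = T.prj1_hom[OF U U, folded p1_def] T.prj2_hom[OF U U, folded p2_def]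
  note c = T.cross[OF f1 f2, folded c_def p1_def p2_def]
  define g1 g2 where "g1 = f1 \<cdot>\<^bsub>B\<^esub> p1" and "g2 = f2 \<cdot>\<^bsub>B\<^esub> p2"
  have g: "g1 \<in> hom B (prd B U U) S1" "g2 \<in> hom B (prd B U U) S2"
    using T.comp_hom[OF p(1) f1] T.comp_hom[OF p(2) f2] by (simp_all add: g1_def g2_def)
  have gd: "g1 \<cdot>\<^bsub>B\<^esub> d = f1" "g2 \<cdot>\<^bsub>B\<^esub> d = f2"
    using T.comp_assoc[OF d(1) p(1) f1] T.comp_assoc[OF d(1) p(2) f2] T.id_right[OF f1] T.id_right[OF f2]
    by (simp_all add: g1_def g2_def d)
  note fA = T.pb_obj[OF f1 A(1)] T.pb_obj[OF f2 A(2)]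
  have coc: "pbA H d (conn H p1 f1 A1) \<cdot>\<^bsub>D\<^esub> conn H d g1 A1 = conn H d p1 (pbO H f1 A1) \<cdot>\<^bsub>D\<^esub> idn B H U (pbO H f1 A1)"
    "pbA H d (conn H p2 f2 A2) \<cdot>\<^bsub>D\<^esub> conn H d g2 A2 = conn H d p2 (pbO H f2 A2) \<cdot>\<^bsub>D\<^esub> idn B H U (pbO H f2 A2)"
    using T.conn_cocycle[OF d(1) p(1) f1 A(1)] T.conn_cocycle[OF d(1) p(2) f2 A(2)]
      T.conn_id_left[OF f1 A(1)] T.conn_id_left[OF f2 A(2)] by (simp_all add: d g1_def g2_def D_def)
  define E where "E = inv_arr (Fib H (prd B U U)) (e U U (pbO H f1 A1) (pbO H f2 A2))"
  note E = P.inv_arr(2)[OF e_iso[OF U U fA], folded E_def p1_def p2_def]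
  note M = iso_hom[OF X.emon_iso[OF f1 f2 A], folded c_def]
  note cp = iso_hom[OF T.conn_iso[OF p(1) f1 A(1)], folded g1_def] iso_hom[OF T.conn_iso[OF p(2) f2 A(2)], folded g2_def]
  define k where "k = itA T (prd B U U) (conn H p1 f1 A1) (conn H p2 f2 A2)"
  note k = T.ten_hom[OF T.prd_obj[OF U U] cp, folded k_def]
  note gA = T.pb_obj[OF g(1) A(1)] T.pb_obj[OF g(2) A(2)]
  define m m' where "m = itM T d (pbO H g1 A1) (pbO H g2 A2)"
    and "m' = itM T d (pbO H p1 (pbO H f1 A1)) (pbO H p2 (pbO H f2 A2))"
  note m = iso_hom[OF T.mon_iso[OF d(1) gA], folded m_def D_def]
    and m' = iso_hom[OF T.mon_iso[OF d(1) T.pb_obj[OF p(1) fA(1)] T.pb_obj[OF p(2) fA(2)]], folded m'_def D_def]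
  define n where "n = itA T U (conn H d g1 A1) (conn H d g2 A2)"
  note cg = iso_hom[OF T.conn_iso[OF d(1) g(1) A(1)], unfolded gd] iso_hom[OF T.conn_iso[OF d(1) g(2) A(2)], unfolded gd]
  note n = T.ten_hom[OF U cg, folded n_def D_def]
  define k' where "k' = itA T U (pbA H d (conn H p1 f1 A1)) (pbA H d (conn H p2 f2 A2))"
  note k' = T.ten_hom[OF U T.pb_hom[OF d(1) cp(1)] T.pb_hom[OF d(1) cp(2)], folded k'_def D_def]
  note nat = T.mon_square[OF d(1) cp, folded k_def m_def k'_def m'_def D_def]
  have "pbA H d (etM X f1 f2 A1 A2) \<cdot>\<^bsub>D\<^esub> diag_comparison B H T e U (pbO H f1 A1) (pbO H f2 A2)
      = pbA H d (etM X f1 f2 A1 A2) \<cdot>\<^bsub>D\<^esub> pbA H d E \<cdot>\<^bsub>D\<^esub> m' \<cdot>\<^bsub>D\<^esub> k' \<cdot>\<^bsub>D\<^esub> n"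
    using T.ten_comp[OF U cg(1) T.pb_hom[OF d(1) cp(1)] cg(2) T.pb_hom[OF d(1) cp(2)], folded n_def k'_def]
      coc by (simp add: diag_comparison_def Let_def d_def p1_def p2_def D_def E_def m'_def)
  also have "\<dots> = pbA H d (etM X f1 f2 A1 A2) \<cdot>\<^bsub>D\<^esub> pbA H d E \<cdot>\<^bsub>D\<^esub> pbA H d k \<cdot>\<^bsub>D\<^esub> m \<cdot>\<^bsub>D\<^esub> n"
    using D.comp_assoc[OF n k' m'] D.comp_assoc[OF n m T.pb_hom[OF d(1) k, folded D_def]] nat by simp
  also have "\<dots> = pbA H d ((etM X f1 f2 A1 A2 \<cdot>\<^bsub>Fib H (prd B U U)\<^esub> E) \<cdot>\<^bsub>Fib H (prd B U U)\<^esub> k) \<cdot>\<^bsub>D\<^esub> m \<cdot>\<^bsub>D\<^esub> n"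
    using T.pb_comp[OF d(1) k P.comp_hom[OF E M]] T.pb_comp[OF d(1) E M]
      D.comp_assoc[OF D.comp_hom[OF n m] T.pb_hom[OF d(1) k, folded D_def] T.pb_hom[OF d(1) P.comp_hom[OF E M], folded D_def]]
      D.comp_assoc[OF D.comp_hom[OF D.comp_hom[OF n m] T.pb_hom[OF d(1) k, folded D_def]] T.pb_hom[OF d(1) E, folded D_def] T.pb_hom[OF d(1) M, folded D_def]]
    by (simp add: D_def)
  also have "\<dots> = pbA H d (comparison B H T e c S1 S2 A1 A2) \<cdot>\<^bsub>D\<^esub> m \<cdot>\<^bsub>D\<^esub> n"
    using comparison_etM[OF f1 f2 A] by (simp add: E_def k_def c_def p1_def p2_def)
  also have "\<dots> = conn H d c (etO X S1 S2 A1 A2) \<cdot>\<^bsub>D\<^esub> comparison B H T e (c \<cdot>\<^bsub>B\<^esub> d) S1 S2 A1 A2"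
    using comparison_pullback[OF S1 S2 c(1) d(1) A]
    by (simp add: c(2,3) g1_def[symmetric] g2_def[symmetric] m_def n_def D_def)
  finally show ?thesis by (simp add: D_def)
qed

end


section \<open>Glued objects\<close>

text \<open>An object \<open>X\<close> of a fiber of \<open>H1\<close>, an object \<open>Y\<close> of the fiber of \<open>H2\<close>, and an isomorphism \<open>Y \<rightarrow> R X\<close>.\<close>

datatype ('x, 'y, 'h) glued = Glued (lft: 'x) (rgt: 'y) (cmpr: 'h)

context fibered_morphism
begin

lemma mor_obj: "S \<in> Obj B \<Longrightarrow> A \<in> Obj (Fib H1 S) \<Longrightarrow> morO R S A \<in> Obj (Fib H2 S)"
  and mor_ident: "S \<in> Obj B \<Longrightarrow> A \<in> Obj (Fib H1 S) \<Longrightarrow>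
    morA R S (Idm (Fib H1 S) A) = Idm (Fib H2 S) (morO R S A)"
  and mor_hom: "S \<in> Obj B \<Longrightarrow> u \<in> hom (Fib H1 S) A A' \<Longrightarrow>
    morA R S u \<in> hom (Fib H2 S) (morO R S A) (morO R S A')"
  and mor_comp: "S \<in> Obj B \<Longrightarrow> u \<in> hom (Fib H1 S) A A' \<Longrightarrow> v \<in> hom (Fib H1 S) A' A'' \<Longrightarrow>
    morA R S (v \<cdot>\<^bsub>Fib H1 S\<^esub> u) = morA R S v \<cdot>\<^bsub>Fib H2 S\<^esub> morA R S u"
  by (rule functor_obj[OF mor_functor], assumption+)
    (rule functor_id[OF mor_functor], assumption+,
      rule functor_hom[OF mor_functor], assumption+,
      rule functor_comp[OF mor_functor], assumption+)

lemma mor_iso: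
  assumes "S \<in> Obj B" "u \<in> iso (Fib H1 S) A A'"
  shows "morA R S u \<in> iso (Fib H2 S) (morO R S A) (morO R S A')"
    and "morA R S (inv_arr (Fib H1 S) u) = inv_arr (Fib H2 S) (morA R S u)"
  using functor_iso[OF H1.fib_category[OF assms(1)] H2.fib_category[OF assms(1)] mor_functor[OF assms(1)] assms(2)]
  by auto

lemma theta_iso:
  assumes "f \<in> hom B T S" "A \<in> Obj (Fib H1 S)"
  shows "theta R f A \<in> iso (Fib H2 T) (pbO H2 f (morO R S A)) (morO R T (pbO H1 f A))"
  using natural_iso_iso[OF theta_natural] assms by blast

lemma theta_square:
  assumes "f \<in> hom B T S" "u \<in> hom (Fib H1 S) A A'"
  shows "morA R T (pbA H1 f u) \<cdot>\<^bsub>Fib H2 T\<^esub> theta R f A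
    = theta R f A' \<cdot>\<^bsub>Fib H2 T\<^esub> pbA H2 f (morA R S u)"
  using natural_iso_square[OF theta_natural] assms by blast

definition glued_obj :: "'o \<Rightarrow> ('x1, 'x2, 'h2) glued \<Rightarrow> bool" where
  "glued_obj S P \<longleftrightarrow> S \<in> Obj B \<and> lft P \<in> Obj (Fib H1 S) \<and> rgt P \<in> Obj (Fib H2 S) \<and>
     cmpr P \<in> iso (Fib H2 S) (rgt P) (morO R S (lft P))"

text \<open>The pair \<open>(s, t)\<close> is an arrow of the iso-comma category of \<open>R\<close> over \<open>S\<close>.\<close>

definition lifts :: "'o \<Rightarrow> ('x1, 'x2, 'h2) glued \<Rightarrow> ('x1, 'x2, 'h2) glued \<Rightarrow> 'h1 \<Rightarrow> 'h2 \<Rightarrow> bool" where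
  "lifts S P Q s t \<longleftrightarrow> glued_obj S P \<and> glued_obj S Q \<and>
     s \<in> hom (Fib H1 S) (lft P) (lft Q) \<and> t \<in> hom (Fib H2 S) (rgt P) (rgt Q) \<and>
     cmpr Q \<cdot>\<^bsub>Fib H2 S\<^esub> t = morA R S s \<cdot>\<^bsub>Fib H2 S\<^esub> cmpr P"

text \<open>The glued objects at which the axioms for structures on \<open>R\<close> are stated.\<close>

definition gbase :: "'o \<Rightarrow> 'x1 \<Rightarrow> ('x1, 'x2, 'h2) glued" where
  "gbase S A = Glued A (morO R S A) (Idm (Fib H2 S) (morO R S A))"

definition gpb :: "'m \<Rightarrow> ('x1, 'x2, 'h2) glued \<Rightarrow> ('x1, 'x2, 'h2) glued" where
  "gpb f P = Glued (pbO H1 f (lft P)) (pbO H2 f (rgt P))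
     (theta R f (lft P) \<cdot>\<^bsub>Fib H2 (Dom B f)\<^esub> pbA H2 f (cmpr P))"

lemma gbase_simps [simp]: "lft (gbase S A) = A" "rgt (gbase S A) = morO R S A"
  "cmpr (gbase S A) = Idm (Fib H2 S) (morO R S A)"
  and gpb_simps [simp]: "lft (gpb f P) = pbO H1 f (lft P)" "rgt (gpb f P) = pbO H2 f (rgt P)"
  by (simp_all add: gbase_def gpb_def)

lemma glued_objD:
  assumes "glued_obj S P"
  shows "S \<in> Obj B" "lft P \<in> Obj (Fib H1 S)" "rgt P \<in> Obj (Fib H2 S)"
    "cmpr P \<in> iso (Fib H2 S) (rgt P) (morO R S (lft P))"
  using assms by (auto simp: glued_obj_def)

lemma liftsD:
  assumes "lifts S P Q s t"
  shows "glued_obj S P" "glued_obj S Q"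
    "s \<in> hom (Fib H1 S) (lft P) (lft Q)" "t \<in> hom (Fib H2 S) (rgt P) (rgt Q)"
    "cmpr Q \<cdot>\<^bsub>Fib H2 S\<^esub> t = morA R S s \<cdot>\<^bsub>Fib H2 S\<^esub> cmpr P"
  using assms by (auto simp: lifts_def)

lemma glued_base: "S \<in> Obj B \<Longrightarrow> A \<in> Obj (Fib H1 S) \<Longrightarrow> glued_obj S (gbase S A)"
  using category.id_iso[OF H2.fib_category mor_obj] mor_obj by (simp add: glued_obj_def)

lemma cmpr_gpb: "f \<in> hom B T S \<Longrightarrow>
    cmpr (gpb f P) = theta R f (lft P) \<cdot>\<^bsub>Fib H2 T\<^esub> pbA H2 f (cmpr P)"
  using homD(2) by (force simp: gpb_def)

lemma cmpr_gpb_base: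
  assumes "f \<in> hom B T S" "A \<in> Obj (Fib H1 S)"
  shows "cmpr (gpb f (gbase S A)) = theta R f A"
  using assms H2.pb_ident[OF assms(1) mor_obj[OF H1.hom_obj(2)[OF assms(1)] assms(2)]]
    category.id_right[OF H2.fib_category[OF H1.hom_obj(1)[OF assms(1)]] iso_hom[OF theta_iso[OF assms]]]
  by (simp add: cmpr_gpb)

lemma glued_pb:
  assumes f: "f \<in> hom B T S" and P: "glued_obj S P"
  shows "glued_obj T (gpb f P)"
  unfolding glued_obj_def cmpr_gpb[OF f] gpb_simps
  using H1.hom_obj(1)[OF f] H1.pb_obj[OF f glued_objD(2)[OF P]] H2.pb_obj[OF f glued_objD(3)[OF P]]
    category.iso_comp[OF H2.fib_category[OF H1.hom_obj(1)[OF f]]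
      H2.pb_iso(1)[OF f glued_objD(4)[OF P]] theta_iso[OF f glued_objD(2)[OF P]]]
  by simp

lemma lifts_id:
  assumes P: "glued_obj S P"
  shows "lifts S P P (Idm (Fib H1 S) (lft P)) (Idm (Fib H2 S) (rgt P))"
proof -
  note P' = glued_objD[OF P]
  interpret D1: category "Fib H1 S" by (rule H1.fib_category[OF P'(1)])
  interpret D2: category "Fib H2 S" by (rule H2.fib_category[OF P'(1)])
  show ?thesis
    unfolding lifts_def
    using P D1.id_hom[OF P'(2)] D2.id_hom[OF P'(3)] D2.id_right[OF iso_hom[OF P'(4)]]
      D2.id_left[OF iso_hom[OF P'(4)]] mor_ident[OF P'(1,2)] by simp
qed

lemma lifts_comp:
  assumes s: "lifts S P Q s t" and s': "lifts S Q Q' s' t'"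
  shows "lifts S P Q' (s' \<cdot>\<^bsub>Fib H1 S\<^esub> s) (t' \<cdot>\<^bsub>Fib H2 S\<^esub> t)"
proof -
  note a = liftsD[OF s] and b = liftsD[OF s']
  note S = glued_objD(1)[OF a(1)]
  interpret D1: category "Fib H1 S" by (rule H1.fib_category[OF S])
  interpret D2: category "Fib H2 S" by (rule H2.fib_category[OF S])
  note c = iso_hom[OF glued_objD(4)[OF a(1)]] iso_hom[OF glued_objD(4)[OF a(2)]] iso_hom[OF glued_objD(4)[OF b(2)]]
  have "cmpr Q' \<cdot>\<^bsub>Fib H2 S\<^esub> t' \<cdot>\<^bsub>Fib H2 S\<^esub> t = (morA R S s' \<cdot>\<^bsub>Fib H2 S\<^esub> morA R S s) \<cdot>\<^bsub>Fib H2 S\<^esub> cmpr P"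
    using D2.square_paste[OF a(4) mor_hom[OF S a(3)] b(4) mor_hom[OF S b(3)] c a(5) b(5)] .
  then show ?thesis
    unfolding lifts_def
    using a b D1.comp_hom[OF a(3) b(3)] D2.comp_hom[OF a(4) b(4)] mor_comp[OF S a(3) b(3)] by simp
qed

definition glued_iso :: "'o \<Rightarrow> ('x1, 'x2, 'h2) glued \<Rightarrow> ('x1, 'x2, 'h2) glued \<Rightarrow> 'h1 \<Rightarrow> 'h2 \<Rightarrow> bool" where
  "glued_iso S P Q s t \<longleftrightarrow> lifts S P Q s t \<and> s \<in> iso (Fib H1 S) (lft P) (lft Q) \<and>
     t \<in> iso (Fib H2 S) (rgt P) (rgt Q)"

lemma glued_isoD: "glued_iso S P Q s t \<Longrightarrow> lifts S P Q s t"
    "glued_iso S P Q s t \<Longrightarrow> s \<in> iso (Fib H1 S) (lft P) (lft Q)"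
    "glued_iso S P Q s t \<Longrightarrow> t \<in> iso (Fib H2 S) (rgt P) (rgt Q)"
  by (auto simp: glued_iso_def)

lemma glued_iso_obj:
  assumes "glued_iso S P Q s t"
  shows "S \<in> Obj B" "glued_obj S P" "glued_obj S Q"
  using glued_isoD(1)[OF assms] glued_objD(1)[OF liftsD(1)] liftsD by blast+

lemma glued_iso_id: "glued_obj S P \<Longrightarrow> glued_iso S P P (Idm (Fib H1 S) (lft P)) (Idm (Fib H2 S) (rgt P))"
  using lifts_id category.id_iso[OF H1.fib_category] category.id_iso[OF H2.fib_category]
  by (simp add: glued_iso_def glued_objD)

lemma glued_iso_comp:
  assumes "glued_iso S P Q s t" "glued_iso S Q Q' s' t'"
  shows "glued_iso S P Q' (s' \<cdot>\<^bsub>Fib H1 S\<^esub> s) (t' \<cdot>\<^bsub>Fib H2 S\<^esub> t)"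
  using assms lifts_comp glued_iso_obj(1)[OF assms(1)]
    category.iso_comp[OF H1.fib_category] category.iso_comp[OF H2.fib_category]
  unfolding glued_iso_def by metis

lemma glued_iso_inv:
  assumes l: "glued_iso S P Q s t"
  shows "glued_iso S Q P (inv_arr (Fib H1 S) s) (inv_arr (Fib H2 S) t)"
proof -
  note a = liftsD[OF glued_isoD(1)[OF l]] and s = glued_isoD(2)[OF l] and t = glued_isoD(3)[OF l]
  note S = glued_objD(1)[OF a(1)]
  interpret D1: category "Fib H1 S" by (rule H1.fib_category[OF S])
  interpret D2: category "Fib H2 S" by (rule H2.fib_category[OF S])
  note c = iso_hom[OF glued_objD(4)[OF a(1)]] iso_hom[OF glued_objD(4)[OF a(2)]]
  show ?thesis
    unfolding glued_iso_def lifts_def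
    using a D1.inv_arr(1,2)[OF s] D2.inv_arr(1,2)[OF t] mor_iso[OF S s]
      D2.square_inv[OF t mor_iso(1)[OF S s] c a(5)] by simp
qed

lemma lifts_precomp_iff:
  assumes l: "glued_iso S P P' a b"
    and x: "x \<in> hom (Fib H1 S) (lft P') (lft Q)" and y: "y \<in> hom (Fib H2 S) (rgt P') (rgt Q)"
  shows "lifts S P Q (x \<cdot>\<^bsub>Fib H1 S\<^esub> a) (y \<cdot>\<^bsub>Fib H2 S\<^esub> b) \<longleftrightarrow> lifts S P' Q x y"
  using lifts_comp[OF glued_isoD(1)[OF l], of Q x y] lifts_comp[OF glued_isoD(1)[OF glued_iso_inv[OF l]]]
    category.inv_arr_cancel(3)[OF H1.fib_category[OF glued_iso_obj(1)[OF l]] glued_isoD(2)[OF l] x]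
    category.inv_arr_cancel(3)[OF H2.fib_category[OF glued_iso_obj(1)[OF l]] glued_isoD(3)[OF l] y]
  by metis

lemma lifts_postcomp_iff:
  assumes l: "glued_iso S Q Q' c d"
    and x: "x \<in> hom (Fib H1 S) (lft P) (lft Q)" and y: "y \<in> hom (Fib H2 S) (rgt P) (rgt Q)"
  shows "lifts S P Q' (c \<cdot>\<^bsub>Fib H1 S\<^esub> x) (d \<cdot>\<^bsub>Fib H2 S\<^esub> y) \<longleftrightarrow> lifts S P Q x y"
  using lifts_comp[OF _ glued_isoD(1)[OF l], of P x y] lifts_comp[OF _ glued_isoD(1)[OF glued_iso_inv[OF l]]]
    category.inv_arr_cancel(1)[OF H1.fib_category[OF glued_iso_obj(1)[OF l]] glued_isoD(2)[OF l] x]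
    category.inv_arr_cancel(1)[OF H2.fib_category[OF glued_iso_obj(1)[OF l]] glued_isoD(3)[OF l] y]
  by metis

text \<open>For a natural transformation it does not matter at which of two isomorphic glued objects lifting is tested.\<close>

lemma lifts_square_iff:
  assumes l: "glued_iso S P P' a b" and l': "glued_iso S Q Q' c d"
    and x: "x \<in> hom (Fib H1 S) (lft P) (lft Q)" and y: "y \<in> hom (Fib H2 S) (rgt P) (rgt Q)"
    and x': "x' \<in> hom (Fib H1 S) (lft P') (lft Q')" and y': "y' \<in> hom (Fib H2 S) (rgt P') (rgt Q')"
    and eq: "c \<cdot>\<^bsub>Fib H1 S\<^esub> x = x' \<cdot>\<^bsub>Fib H1 S\<^esub> a" "d \<cdot>\<^bsub>Fib H2 S\<^esub> y = y' \<cdot>\<^bsub>Fib H2 S\<^esub> b"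
  shows "lifts S P Q x y \<longleftrightarrow> lifts S P' Q' x' y'"
  using lifts_postcomp_iff[OF l' x y] lifts_precomp_iff[OF l x' y'] eq by simp

text \<open>One direction of \<open>lifts_square_iff\<close>, for an arrow that need not be invertible on the source side. It is used
  while only some of the constructions on glued objects are known to be functorial.\<close>

lemma lifts_transport:
  assumes "lifts S P' Q' x' y'" and "lifts S P P' a b" and l: "glued_iso S Q Q' c d"
    and x: "x \<in> hom (Fib H1 S) (lft P) (lft Q)" and y: "y \<in> hom (Fib H2 S) (rgt P) (rgt Q)"
    and eq: "c \<cdot>\<^bsub>Fib H1 S\<^esub> x = x' \<cdot>\<^bsub>Fib H1 S\<^esub> a" "d \<cdot>\<^bsub>Fib H2 S\<^esub> y = y' \<cdot>\<^bsub>Fib H2 S\<^esub> b"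
  shows "lifts S P Q x y"
  using lifts_postcomp_iff[OF l x y] lifts_comp[OF assms(2,1)] eq by simp

lemma lifts_iff:
  assumes "glued_obj S P" "glued_obj S Q"
    "x \<in> hom (Fib H1 S) (lft P) (lft Q)" "y \<in> hom (Fib H2 S) (rgt P) (rgt Q)"
  shows "lifts S P Q x y \<longleftrightarrow> cmpr Q \<cdot>\<^bsub>Fib H2 S\<^esub> y = morA R S x \<cdot>\<^bsub>Fib H2 S\<^esub> cmpr P"
  using assms by (simp add: lifts_def)

text \<open>A third component can be transported along a pair of isomorphisms in exactly one way. The formulas for
  \<open>to_external\<close> and \<open>to_internal\<close> are instances of the one that appears here and in \<open>glued_iso_cmpr\<close>.\<close>

lemma glued_iso_along:
  assumes Q: "glued_obj S Q" and s: "s \<in> iso (Fib H1 S) X (lft Q)" and t: "t \<in> iso (Fib H2 S) Y (rgt Q)"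
  shows "glued_iso S (Glued X Y (morA R S (inv_arr (Fib H1 S) s) \<cdot>\<^bsub>Fib H2 S\<^esub> cmpr Q \<cdot>\<^bsub>Fib H2 S\<^esub> t)) Q s t"
proof -
  note q = glued_objD[OF Q]
  interpret D1: category "Fib H1 S" by (rule H1.fib_category[OF q(1)])
  interpret D2: category "Fib H2 S" by (rule H2.fib_category[OF q(1)])
  note Rs = mor_iso[OF q(1) s] and ct = D2.iso_comp[OF t q(4)]
  show ?thesis
    unfolding glued_iso_def lifts_def glued_obj_def[of S "Glued _ _ _"]
    using Q q s t iso_hom[OF s] iso_hom[OF t] D1.hom_obj(1)[OF iso_hom[OF s]] D2.hom_obj(1)[OF iso_hom[OF t]]
      D2.inv_arr_cancel(2)[OF Rs(1) iso_hom[OF ct]] D2.iso_comp[OF ct D2.inv_arr(1)[OF Rs(1)]]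
    by (simp add: Rs(2))
qed

lemma glued_iso_cmpr:
  assumes l: "glued_iso S P Q s t"
  shows "cmpr P = morA R S (inv_arr (Fib H1 S) s) \<cdot>\<^bsub>Fib H2 S\<^esub> cmpr Q \<cdot>\<^bsub>Fib H2 S\<^esub> t"
proof -
  note a = liftsD[OF glued_isoD(1)[OF l]]
  note S = glued_iso_obj(1)[OF l] and c = iso_hom[OF glued_objD(4)[OF a(1)]]
  show ?thesis
    using category.inv_arr_cancel(1)[OF H2.fib_category[OF S] mor_iso(1)[OF S glued_isoD(2)[OF l]] c]
      mor_iso(2)[OF S glued_isoD(2)[OF l]] a(5) by simp
qed

lemma lifts_base:
  assumes S: "S \<in> Obj B" and u: "u \<in> hom (Fib H1 S) A A'"
  shows "lifts S (gbase S A) (gbase S A') u (morA R S u)"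
proof -
  interpret D1: category "Fib H1 S" by (rule H1.fib_category[OF S])
  interpret D2: category "Fib H2 S" by (rule H2.fib_category[OF S])
  show ?thesis
    unfolding lifts_def
    using glued_base[OF S D1.hom_obj(1)[OF u]] glued_base[OF S D1.hom_obj(2)[OF u]] u mor_hom[OF S u]
      D2.id_left[OF mor_hom[OF S u]] D2.id_right[OF mor_hom[OF S u]] by simp
qed

text \<open>Since every glued object is isomorphic to some \<open>gbase\<close>, properties of natural arrows need to be checked only there.\<close>

lemma glued_iso_base:
  assumes P: "glued_obj S P"
  shows "glued_iso S P (gbase S (lft P)) (Idm (Fib H1 S) (lft P)) (cmpr P)"
proof -
  note p = glued_objD[OF P]
  interpret D1: category "Fib H1 S" by (rule H1.fib_category[OF p(1)])
  interpret D2: category "Fib H2 S" by (rule H2.fib_category[OF p(1)])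
  show ?thesis
    unfolding glued_iso_def lifts_def
    using P glued_base[OF p(1,2)] D1.id_iso[OF p(2)] D1.id_hom[OF p(2)] iso_hom[OF p(4)] p(4)
      mor_ident[OF p(1,2)] D2.id_left[OF iso_hom[OF p(4)]] by simp
qed

lemma lifts_pb:
  assumes f: "f \<in> hom B T S" and l: "lifts S P Q s t"
  shows "lifts T (gpb f P) (gpb f Q) (pbA H1 f s) (pbA H2 f t)"
proof -
  note a = liftsD[OF l]
  note S = glued_objD(1)[OF a(1)] and T = H1.hom_obj(1)[OF f]
  interpret D2: category "Fib H2 S" by (rule H2.fib_category[OF S])
  interpret E2: category "Fib H2 T" by (rule H2.fib_category[OF T])
  note p = glued_objD[OF a(1)] and q = glued_objD[OF a(2)]
  note cp = iso_hom[OF p(4)] and cq = iso_hom[OF q(4)]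
  note tp = iso_hom[OF theta_iso[OF f p(2)]] and tq = iso_hom[OF theta_iso[OF f q(2)]]
  note R = mor_hom[OF S a(3)]
  note ft = H2.pb_hom[OF f a(4)]
  have "pbA H2 f (cmpr Q) \<cdot>\<^bsub>Fib H2 T\<^esub> pbA H2 f t = pbA H2 f (morA R S s) \<cdot>\<^bsub>Fib H2 T\<^esub> pbA H2 f (cmpr P)"
    using H2.pb_comp[OF f a(4) cq] H2.pb_comp[OF f cp R] a(5) by simp
  then have "cmpr (gpb f Q) \<cdot>\<^bsub>Fib H2 T\<^esub> pbA H2 f t = morA R T (pbA H1 f s) \<cdot>\<^bsub>Fib H2 T\<^esub> cmpr (gpb f P)"
    unfolding cmpr_gpb[OF f]
    using E2.square_paste[OF H2.pb_hom[OF f cp] H2.pb_hom[OF f cq] tp tq ft H2.pb_hom[OF f R]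
        mor_hom[OF T H1.pb_hom[OF f a(3)]] _ theta_square[OF f a(3)]] by simp
  then show ?thesis
    unfolding lifts_def
    using glued_pb[OF f a(1)] glued_pb[OF f a(2)] H1.pb_hom[OF f a(3)] ft by simp
qed

lemma glued_iso_pb:
  assumes f: "f \<in> hom B T S" and l: "glued_iso S P Q s t"
  shows "glued_iso T (gpb f P) (gpb f Q) (pbA H1 f s) (pbA H2 f t)"
  using lifts_pb[OF f glued_isoD(1)[OF l]] H1.pb_iso(1)[OF f glued_isoD(2)[OF l]]
    H2.pb_iso(1)[OF f glued_isoD(3)[OF l]] by (simp add: glued_iso_def)

lemma glued_iso_conn:
  assumes f: "f \<in> hom B T S" and g: "g \<in> hom B S V" and P: "glued_obj V P"
  shows "glued_iso T (gpb (g \<cdot>\<^bsub>B\<^esub> f) P) (gpb f (gpb g P)) (conn H1 f g (lft P)) (conn H2 f g (rgt P))"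
proof -
  note p = glued_objD[OF P] and gf = H1.comp_hom[OF f g]
  note T = H1.hom_obj(1)[OF f] and S = H1.hom_obj(2)[OF f]
  interpret D2: category "Fib H2 S" by (rule H2.fib_category[OF S])
  interpret E2: category "Fib H2 T" by (rule H2.fib_category[OF T])
  note c = iso_hom[OF p(4)]
  note c1 = iso_hom[OF H1.conn_iso[OF f g p(2)]]
  note c2 = iso_hom[OF H2.conn_iso[OF f g p(3)]]
    and c2' = iso_hom[OF H2.conn_iso[OF f g mor_obj[OF p(1,2)]]]
  note tg = iso_hom[OF theta_iso[OF g p(2)]] and tgf = iso_hom[OF theta_iso[OF gf p(2)]]
    and tf = iso_hom[OF theta_iso[OF f H1.pb_obj[OF g p(2)]]]
  note gc = H2.pb_hom[OF g c] and gfc = H2.pb_hom[OF gf c]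
  have "cmpr (gpb f (gpb g P)) \<cdot>\<^bsub>Fib H2 T\<^esub> conn H2 f g (rgt P)
      = theta R f (pbO H1 g (lft P)) \<cdot>\<^bsub>Fib H2 T\<^esub> pbA H2 f (theta R g (lft P))
        \<cdot>\<^bsub>Fib H2 T\<^esub> pbA H2 f (pbA H2 g (cmpr P)) \<cdot>\<^bsub>Fib H2 T\<^esub> conn H2 f g (rgt P)"
    unfolding cmpr_gpb[OF f] cmpr_gpb[OF g] gpb_simps
    using H2.pb_comp[OF f gc tg] E2.comp_assoc[OF c2 H2.pb_hom[OF f D2.comp_hom[OF gc tg]] tf]
      E2.comp_assoc[OF c2 H2.pb_hom[OF f gc] H2.pb_hom[OF f tg]] by simp
  also have "\<dots> = theta R f (pbO H1 g (lft P)) \<cdot>\<^bsub>Fib H2 T\<^esub> pbA H2 f (theta R g (lft P))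
        \<cdot>\<^bsub>Fib H2 T\<^esub> conn H2 f g (morO R V (lft P)) \<cdot>\<^bsub>Fib H2 T\<^esub> pbA H2 (g \<cdot>\<^bsub>B\<^esub> f) (cmpr P)"
    using H2.conn_square[OF f g c] by simp
  also have "\<dots> = (theta R f (pbO H1 g (lft P)) \<cdot>\<^bsub>Fib H2 T\<^esub> pbA H2 f (theta R g (lft P))
        \<cdot>\<^bsub>Fib H2 T\<^esub> conn H2 f g (morO R V (lft P))) \<cdot>\<^bsub>Fib H2 T\<^esub> pbA H2 (g \<cdot>\<^bsub>B\<^esub> f) (cmpr P)"
    using E2.comp_assoc[OF gfc E2.comp_hom[OF c2' H2.pb_hom[OF f tg]] tf]
      E2.comp_assoc[OF gfc c2' H2.pb_hom[OF f tg]] by simp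
  also have "\<dots> = morA R T (conn H1 f g (lft P)) \<cdot>\<^bsub>Fib H2 T\<^esub> cmpr (gpb (g \<cdot>\<^bsub>B\<^esub> f) P)"
    unfolding cmpr_gpb[OF gf]
    using theta_comp[OF f g p(2)] E2.comp_assoc[OF gfc tgf mor_hom[OF T c1]] by simp
  finally show ?thesis
    unfolding glued_iso_def lifts_def
    using glued_pb[OF gf P] glued_pb[OF f glued_pb[OF g P]] c1 c2 H1.conn_iso[OF f g p(2)] H2.conn_iso[OF f g p(3)]
    by simp
qed

text \<open>The cocycle identity of \<open>\<theta>\<close> at \<open>(id, id)\<close> contains \<open>\<theta>\<^sub>i\<^sub>d\<close> twice on one side and once on the other. To cancel it, it
  has to be moved past \<open>R(idn)\<close>, by naturality at \<open>idn\<close>.\<close>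

lemma theta_idn:
  assumes S: "S \<in> Obj B" and A: "A \<in> Obj (Fib H1 S)"
  shows "theta R (Idm B S) A \<cdot>\<^bsub>Fib H2 S\<^esub> idn B H2 S (morO R S A) = morA R S (idn B H1 S A)"
proof -
  interpret D: category "Fib H2 S" by (rule H2.fib_category[OF S])
  note id = H1.id_hom[OF S]
  note RA = mor_obj[OF S A]
  have t: "theta R (Idm B S) A \<in> iso (Fib H2 S) (morO R S A) (morO R S A)"
    using theta_iso[OF id A] H1.pb_id_obj[OF S A] H2.pb_id_obj[OF S RA] by simp
  note i = iso_hom[OF H1.idn_iso[OF S A]]
  note i2 = iso_hom[OF H2.idn_iso[OF S RA]]
  note Ri = mor_hom[OF S i]
  have "theta R (Idm B S) A \<cdot>\<^bsub>Fib H2 S\<^esub> theta R (Idm B S) A \<cdot>\<^bsub>Fib H2 S\<^esub> idn B H2 S (morO R S A)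
      = morA R S (idn B H1 S A) \<cdot>\<^bsub>Fib H2 S\<^esub> theta R (Idm B S) A"
    using theta_comp[OF id id A] H1.pb_id_obj[OF S A] H2.pb_id_arr[OF S homD(1)[OF iso_hom[OF t]]]
      H1.id_left[OF id] by (simp add: idn_def)
  also have "\<dots> = theta R (Idm B S) A \<cdot>\<^bsub>Fib H2 S\<^esub> morA R S (idn B H1 S A)"
    using theta_square[OF id i] H1.pb_id_arr[OF S homD(1)[OF i]] H2.pb_id_arr[OF S homD(1)[OF Ri]] by simp
  finally show ?thesis by (rule D.iso_cancel_left[OF t D.comp_hom[OF i2 iso_hom[OF t]] Ri])
qed

lemma glued_iso_idn:
  assumes P: "glued_obj S P"
  shows "glued_iso S P (gpb (Idm B S) P) (idn B H1 S (lft P)) (idn B H2 S (rgt P))"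
proof -
  note p = glued_objD[OF P]
  interpret D: category "Fib H2 S" by (rule H2.fib_category[OF p(1)])
  note id = H1.id_hom[OF p(1)] and c = iso_hom[OF p(4)]
  note i1 = iso_hom[OF H1.idn_iso[OF p(1,2)]] and i2 = iso_hom[OF H2.idn_iso[OF p(1,3)]]
    and i2' = iso_hom[OF H2.idn_iso[OF p(1) mor_obj[OF p(1,2)]]]
  have t: "theta R (Idm B S) (lft P) \<in> hom (Fib H2 S) (morO R S (lft P)) (morO R S (lft P))"
    using iso_hom[OF theta_iso[OF id p(2)]] H1.pb_id_obj[OF p(1,2)] H2.pb_id_obj[OF p(1) mor_obj[OF p(1,2)]]
    by simp
  have "cmpr (gpb (Idm B S) P) \<cdot>\<^bsub>Fib H2 S\<^esub> idn B H2 S (rgt P)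
      = morA R S (idn B H1 S (lft P)) \<cdot>\<^bsub>Fib H2 S\<^esub> cmpr P"
    unfolding cmpr_gpb[OF id]
    using H2.pb_id_arr[OF p(1) homD(1)[OF c]] D.comp_assoc[OF i2 c t] H2.idn_square[OF p(1) c]
      D.comp_assoc[OF c i2' t] theta_idn[OF p(1,2)] by simp
  then show ?thesis
    unfolding glued_iso_def lifts_def
    using P glued_pb[OF id P] i1 i2 H1.idn_iso[OF p(1,2)] H2.idn_iso[OF p(1,3)] H1.pb_id_obj[OF p(1,2)] H2.pb_id_obj[OF p(1,3)] by simp
qed

text \<open>Applied to a diagonal and the projections that it splits.\<close>

lemma glued_iso_retract:
  assumes f: "f \<in> hom B T S" and g: "g \<in> hom B S T" and eq: "g \<cdot>\<^bsub>B\<^esub> f = Idm B T" and P: "glued_obj T P"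
  shows "glued_iso T P (gpb f (gpb g P))
    (conn H1 f g (lft P) \<cdot>\<^bsub>Fib H1 T\<^esub> idn B H1 T (lft P)) (conn H2 f g (rgt P) \<cdot>\<^bsub>Fib H2 T\<^esub> idn B H2 T (rgt P))"
  by (rule glued_iso_comp[OF glued_iso_idn[OF P] glued_iso_conn[OF f g P, unfolded eq]])

text \<open>A transformation \<open>\<eta> : O2(R -, R -) \<rightarrow> R O1(-, -)\<close> makes the pair of bifunctors \<open>O1\<close>, \<open>O2\<close> act on glued objects.
  The two instances are \<open>\<otimes>\<close> with \<open>\<rho>\<close>, over one base object, and \<open>\<boxtimes>\<close> with \<open>\<sigma>\<close>, from the fibers over \<open>S1\<close> and \<open>S2\<close> to
  the one over the product.\<close>

definition gprod where
  "gprod S O1 O2 F2 \<eta> P Q = Glued (O1 (lft P) (lft Q)) (O2 (rgt P) (rgt Q))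
     (\<eta> (lft P) (lft Q) \<cdot>\<^bsub>Fib H2 S\<^esub> F2 (cmpr P) (cmpr Q))"

lemma gprod_simps [simp]: "lft (gprod S O1 O2 F2 \<eta> P Q) = O1 (lft P) (lft Q)"
    "rgt (gprod S O1 O2 F2 \<eta> P Q) = O2 (rgt P) (rgt Q)"
  and cmpr_gprod: "cmpr (gprod S O1 O2 F2 \<eta> P Q) = \<eta> (lft P) (lft Q) \<cdot>\<^bsub>Fib H2 S\<^esub> F2 (cmpr P) (cmpr Q)"
  by (simp_all add: gprod_def)

end

locale glued_bifunctor = fibered_morphism B H1 H2 R +
  F1: bifunctor "Fib H1 S1" "Fib H1 S2" "Fib H1 S" O1 F1 +
  F2: bifunctor "Fib H2 S1" "Fib H2 S2" "Fib H2 S" O2 F2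
  for B :: "('o, 'm) pcat" and H1 :: "('o, 'm, 'x1, 'h1) fibcat" and H2 :: "('o, 'm, 'x2, 'h2) fibcat"
    and R :: "('o, 'm, 'x1, 'h1, 'x2, 'h2) fibmor" and S1 S2 S O1 F1 O2 F2 +
  fixes \<eta> :: "'x1 \<Rightarrow> 'x1 \<Rightarrow> 'h2"
  assumes base: "S1 \<in> Obj B" "S2 \<in> Obj B" "S \<in> Obj B"
    and \<eta>_natural: "is_natural_iso (prod_cat (Fib H1 S1) (Fib H1 S2)) (Fib H2 S)
      (\<lambda>(A, A'). O2 (morO R S1 A) (morO R S2 A')) (\<lambda>(g, h). F2 (morA R S1 g) (morA R S2 h))
      (\<lambda>(A, A'). morO R S (O1 A A')) (\<lambda>(g, h). morA R S (F1 g h)) (\<lambda>(A, A'). \<eta> A A')"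
begin

lemma \<eta>_iso: "A \<in> Obj (Fib H1 S1) \<Longrightarrow> A' \<in> Obj (Fib H1 S2) \<Longrightarrow>
    \<eta> A A' \<in> iso (Fib H2 S) (O2 (morO R S1 A) (morO R S2 A')) (morO R S (O1 A A'))"
  and \<eta>_square: "g \<in> hom (Fib H1 S1) X Y \<Longrightarrow> h \<in> hom (Fib H1 S2) X' Y' \<Longrightarrow>
    morA R S (F1 g h) \<cdot>\<^bsub>Fib H2 S\<^esub> \<eta> X X' = \<eta> Y Y' \<cdot>\<^bsub>Fib H2 S\<^esub> F2 (morA R S1 g) (morA R S2 h)"
  using \<eta>_natural[unfolded bifunctor_natural_iso_iff] by blast+

lemma glued:
  assumes P: "glued_obj S1 P" and Q: "glued_obj S2 Q"
  shows "glued_obj S (gprod S O1 O2 F2 \<eta> P Q)"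
proof -
  note p = glued_objD[OF P] and q = glued_objD[OF Q]
  show ?thesis
    unfolding glued_obj_def gprod_simps
    using base F1.obj[OF p(2) q(2)] F2.obj[OF p(3) q(3)]
      F2.D.iso_comp[OF F2.map_iso(1)[OF p(4) q(4)] \<eta>_iso[OF p(2) q(2)]]
    by (simp add: gprod_def)
qed

lemma lifts:
  assumes l: "lifts S1 P P' s t" and l': "lifts S2 Q Q' s' t'"
  shows "lifts S (gprod S O1 O2 F2 \<eta> P Q) (gprod S O1 O2 F2 \<eta> P' Q') (F1 s s') (F2 t t')"
proof -
  note a = liftsD[OF l] and b = liftsD[OF l']
  note p = glued_objD[OF a(1)] and q = glued_objD[OF b(1)] and p' = glued_objD[OF a(2)] and q' = glued_objD[OF b(2)]
  note cp = iso_hom[OF p(4)] and cq = iso_hom[OF q(4)] and cp' = iso_hom[OF p'(4)] and cq' = iso_hom[OF q'(4)]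
  note e = iso_hom[OF \<eta>_iso[OF p(2) q(2)]] and e' = iso_hom[OF \<eta>_iso[OF p'(2) q'(2)]]
  note R = mor_hom[OF base(1) a(3)] mor_hom[OF base(2) b(3)]
  have "F2 (cmpr P') (cmpr Q') \<cdot>\<^bsub>Fib H2 S\<^esub> F2 t t'
      = F2 (morA R S1 s) (morA R S2 s') \<cdot>\<^bsub>Fib H2 S\<^esub> F2 (cmpr P) (cmpr Q)"
    using F2.map_comp[OF a(4) cp' b(4) cq'] F2.map_comp[OF cp R(1) cq R(2)] a(5) b(5) by simp
  note sq = F2.D.square_paste[OF F2.map_hom[OF cp cq] F2.map_hom[OF cp' cq'] e e' F2.map_hom[OF a(4) b(4)]
      F2.map_hom[OF R] mor_hom[OF base(3) F1.map_hom[OF a(3) b(3)]] this[symmetric] \<eta>_square[OF a(3) b(3)]]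
  show ?thesis
    unfolding lifts_def gprod_simps
    using glued[OF a(1) b(1)] glued[OF a(2) b(2)] F1.map_hom[OF a(3) b(3)] F2.map_hom[OF a(4) b(4)] sq
    by (simp add: gprod_def)
qed

lemma glued_iso:
  assumes "glued_iso S1 P P' s t" "glued_iso S2 Q Q' s' t'"
  shows "glued_iso S (gprod S O1 O2 F2 \<eta> P Q) (gprod S O1 O2 F2 \<eta> P' Q') (F1 s s') (F2 t t')"
  using assms lifts F1.map_iso(1) F2.map_iso(1) by (simp add: glued_iso_def)

lemma cmpr_base:
  assumes "A \<in> Obj (Fib H1 S1)" "A' \<in> Obj (Fib H1 S2)"
  shows "cmpr (gprod S O1 O2 F2 \<eta> (gbase S1 A) (gbase S2 A')) = \<eta> A A'"
  using F2.D.id_right[OF iso_hom[OF \<eta>_iso[OF assms]]] F2.ident[OF mor_obj[OF base(1) assms(1)] mor_obj[OF base(2) assms(2)]]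
  by (simp add: gprod_def)

end


section \<open>Corresponding structures on a morphism\<close>

locale equivalent_tensors = fibered_morphism B H1 H2 R +
  E1: tensor_equivalence B H1 T1 X1 e1 + E2: tensor_equivalence B H2 T2 X2 e2
  for B :: "('o, 'm) pcat" and H1 :: "('o, 'm, 'x1, 'h1) fibcat" and H2 :: "('o, 'm, 'x2, 'h2) fibcat"
    and R :: "('o, 'm, 'x1, 'h1, 'x2, 'h2) fibmor" and T1 X1 e1 T2 X2 e2
begin

abbreviation "gten \<rho> S \<equiv> gprod S (itO T1 S) (itO T2 S) (itA T2 S) (\<rho> S)"

abbreviation "gext \<sigma> S1 S2 \<equiv>
  gprod (prd B S1 S2) (etO X1 S1 S2) (etO X2 S1 S2) (etA X2 S1 S2) (\<sigma> S1 S2)"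

definition int_natural :: "('o \<Rightarrow> 'x1 \<Rightarrow> 'x1 \<Rightarrow> 'h2) \<Rightarrow> bool" where
  "int_natural \<rho> \<longleftrightarrow> (\<forall>S \<in> Obj B.
     is_natural_iso (prod_cat (Fib H1 S) (Fib H1 S)) (Fib H2 S)
       (\<lambda>(A, A'). itO T2 S (morO R S A) (morO R S A')) (\<lambda>(g, h). itA T2 S (morA R S g) (morA R S h))
       (\<lambda>(A, A'). morO R S (itO T1 S A A')) (\<lambda>(g, h). morA R S (itA T1 S g h))
       (\<lambda>(A, A'). \<rho> S A A'))"

definition ext_natural :: "('o \<Rightarrow> 'o \<Rightarrow> 'x1 \<Rightarrow> 'x1 \<Rightarrow> 'h2) \<Rightarrow> bool" where
  "ext_natural \<sigma> \<longleftrightarrow> (\<forall>S1 \<in> Obj B. \<forall>S2 \<in> Obj B.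
     is_natural_iso (prod_cat (Fib H1 S1) (Fib H1 S2)) (Fib H2 (prd B S1 S2))
       (\<lambda>(A1, A2). etO X2 S1 S2 (morO R S1 A1) (morO R S2 A2))
       (\<lambda>(h1, h2). etA X2 S1 S2 (morA R S1 h1) (morA R S2 h2))
       (\<lambda>(A1, A2). morO R (prd B S1 S2) (etO X1 S1 S2 A1 A2))
       (\<lambda>(h1, h2). morA R (prd B S1 S2) (etA X1 S1 S2 h1 h2))
       (\<lambda>(A1, A2). \<sigma> S1 S2 A1 A2))"

lemma int_bifunctor:
  assumes "int_natural \<rho>" "S \<in> Obj B"
  shows "glued_bifunctor B H1 H2 R S S S (itO T1 S) (itA T1 S) (itO T2 S) (itA T2 S) (\<rho> S)"
  using assms E1.T.ten_bifunctor E2.T.ten_bifunctor fibered_morphism_axioms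
  by (simp add: glued_bifunctor_def glued_bifunctor_axioms_def int_natural_def)

lemma ext_bifunctor:
  assumes "ext_natural \<sigma>" "S1 \<in> Obj B" "S2 \<in> Obj B"
  shows "glued_bifunctor B H1 H2 R S1 S2 (prd B S1 S2) (etO X1 S1 S2) (etA X1 S1 S2)
    (etO X2 S1 S2) (etA X2 S1 S2) (\<sigma> S1 S2)"
  using assms E1.X.ext_bifunctor E2.X.ext_bifunctor fibered_morphism_axioms H1.prd_obj
  by (simp add: glued_bifunctor_def glued_bifunctor_axioms_def ext_natural_def)

end

text \<open>The two conditions at the end say that \<open>\<rho>\<close> is compatible with the monoidality isomorphisms, and that \<open>\<rho>\<close> and \<open>\<sigma>\<close>
  correspond to each other. They are required at \<open>gbase\<close> objects; \<open>iso_mon\<close> and \<open>iso_e\<close> extend them to all glued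
  objects.\<close>

locale corresponding_structures = equivalent_tensors B H1 H2 R T1 X1 e1 T2 X2 e2
  for B :: "('o, 'm) pcat" and H1 :: "('o, 'm, 'x1, 'h1) fibcat" and H2 :: "('o, 'm, 'x2, 'h2) fibcat"
    and R :: "('o, 'm, 'x1, 'h1, 'x2, 'h2) fibmor" and T1 X1 e1 T2 X2 e2 +
  fixes \<rho> :: "'o \<Rightarrow> 'x1 \<Rightarrow> 'x1 \<Rightarrow> 'h2" and \<sigma> :: "'o \<Rightarrow> 'o \<Rightarrow> 'x1 \<Rightarrow> 'x1 \<Rightarrow> 'h2"
  assumes \<rho>_natural: "int_natural \<rho>" and \<sigma>_natural: "ext_natural \<sigma>"
    and mon_base: "\<lbrakk>f \<in> hom B T S; A \<in> Obj (Fib H1 S); A' \<in> Obj (Fib H1 S)\<rbrakk> \<Longrightarrow>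
      lifts T (gten \<rho> T (gpb f (gbase S A)) (gpb f (gbase S A'))) (gpb f (gten \<rho> S (gbase S A) (gbase S A')))
        (itM T1 f A A') (itM T2 f (morO R S A) (morO R S A'))"
    and e_base: "\<lbrakk>S1 \<in> Obj B; S2 \<in> Obj B; A1 \<in> Obj (Fib H1 S1); A2 \<in> Obj (Fib H1 S2)\<rbrakk> \<Longrightarrow>
      lifts (prd B S1 S2) (gext \<sigma> S1 S2 (gbase S1 A1) (gbase S2 A2))
        (gten \<rho> (prd B S1 S2) (gpb (prj1 B S1 S2) (gbase S1 A1)) (gpb (prj2 B S1 S2) (gbase S2 A2)))
        (e1 S1 S2 A1 A2) (e2 S1 S2 (morO R S1 A1) (morO R S2 A2))"
begin

abbreviation "ten \<equiv> gten \<rho>"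

abbreviation "ext \<equiv> gext \<sigma>"

lemmas glued_ten = glued_bifunctor.glued[OF int_bifunctor[OF \<rho>_natural]]
  and iso_ten = glued_bifunctor.glued_iso[OF int_bifunctor[OF \<rho>_natural]]
  and cmpr_ten_base = glued_bifunctor.cmpr_base[OF int_bifunctor[OF \<rho>_natural]]
  and \<rho>_iso = glued_bifunctor.\<eta>_iso[OF int_bifunctor[OF \<rho>_natural]]
  and glued_ext = glued_bifunctor.glued[OF ext_bifunctor[OF \<sigma>_natural]]
  and iso_ext = glued_bifunctor.glued_iso[OF ext_bifunctor[OF \<sigma>_natural]]
  and cmpr_ext_base = glued_bifunctor.cmpr_base[OF ext_bifunctor[OF \<sigma>_natural]]
  and \<sigma>_iso = glued_bifunctor.\<eta>_iso[OF ext_bifunctor[OF \<sigma>_natural]]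

lemma iso_mon:
  assumes f: "f \<in> hom B T S" and P: "glued_obj S P" and Q: "glued_obj S Q"
  shows "glued_iso T (ten T (gpb f P) (gpb f Q)) (gpb f (ten S P Q))
    (itM T1 f (lft P) (lft Q)) (itM T2 f (rgt P) (rgt Q))"
proof -
  note T = H1.hom_obj(1)[OF f] and S = H1.hom_obj(2)[OF f]
  note p = glued_objD[OF P] and q = glued_objD[OF Q]
  note m1 = E1.T.mon_iso[OF f p(2) q(2)] and m2 = E2.T.mon_iso[OF f p(3) q(3)]
  note lp = glued_iso_base[OF P] and lq = glued_iso_base[OF Q]
  have "lifts T (ten T (gpb f P) (gpb f Q)) (gpb f (ten S P Q))
      (itM T1 f (lft P) (lft Q)) (itM T2 f (rgt P) (rgt Q))"
    using iso_hom[OF m1] iso_hom[OF m2]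
      E1.T.mon_square[OF f iso_hom[OF glued_isoD(2)[OF lp]] iso_hom[OF glued_isoD(2)[OF lq]]]
      E2.T.mon_square[OF f iso_hom[OF glued_isoD(3)[OF lp]] iso_hom[OF glued_isoD(3)[OF lq]]]
    by (intro lifts_transport[OF mon_base[OF f p(2) q(2)]
          glued_isoD(1)[OF iso_ten[OF T glued_iso_pb[OF f lp] glued_iso_pb[OF f lq]]]
          glued_iso_pb[OF f iso_ten[OF S lp lq]]]) simp_all
  then show ?thesis using m1 m2 by (simp add: glued_iso_def)
qed

lemma iso_e:
  assumes S: "S1 \<in> Obj B" "S2 \<in> Obj B" and P: "glued_obj S1 P" and Q: "glued_obj S2 Q"
  shows "glued_iso (prd B S1 S2) (ext S1 S2 P Q) (ten (prd B S1 S2) (gpb (prj1 B S1 S2) P) (gpb (prj2 B S1 S2) Q))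
    (e1 S1 S2 (lft P) (lft Q)) (e2 S1 S2 (rgt P) (rgt Q))"
proof -
  note p = glued_objD[OF P] and q = glued_objD[OF Q]
  note m1 = E1.e_iso[OF S p(2) q(2)] and m2 = E2.e_iso[OF S p(3) q(3)]
  note lp = glued_iso_base[OF P] and lq = glued_iso_base[OF Q]
  have "lifts (prd B S1 S2) (ext S1 S2 P Q) (ten (prd B S1 S2) (gpb (prj1 B S1 S2) P) (gpb (prj2 B S1 S2) Q))
      (e1 S1 S2 (lft P) (lft Q)) (e2 S1 S2 (rgt P) (rgt Q))"
    using iso_hom[OF m1] iso_hom[OF m2]
      E1.e_square[OF S iso_hom[OF glued_isoD(2)[OF lp]] iso_hom[OF glued_isoD(2)[OF lq]]]
      E2.e_square[OF S iso_hom[OF glued_isoD(3)[OF lp]] iso_hom[OF glued_isoD(3)[OF lq]]]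
    by (intro lifts_transport[OF e_base[OF S p(2) q(2)] glued_isoD(1)[OF iso_ext[OF S lp lq]]
          iso_ten[OF H1.prd_obj[OF S] glued_iso_pb[OF H1.prj1_hom[OF S] lp] glued_iso_pb[OF H1.prj2_hom[OF S] lq]]])
      simp_all
  then show ?thesis using m1 m2 by (simp add: glued_iso_def)
qed

text \<open>The comparison is composed of \<open>conn\<close>, \<open>m\<close> and the inverse of \<open>e\<close>, and all of these lift.\<close>

lemma iso_comparison:
  assumes S: "S1 \<in> Obj B" "S2 \<in> Obj B" and P: "glued_obj S1 P" and Q: "glued_obj S2 Q"
    and h: "h \<in> hom B U (prd B S1 S2)"
  shows "glued_iso U (ten U (gpb (prj1 B S1 S2 \<cdot>\<^bsub>B\<^esub> h) P) (gpb (prj2 B S1 S2 \<cdot>\<^bsub>B\<^esub> h) Q)) (gpb h (ext S1 S2 P Q))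
    (comparison B H1 T1 e1 h S1 S2 (lft P) (lft Q)) (comparison B H2 T2 e2 h S1 S2 (rgt P) (rgt Q))"
proof -
  note q1 = H1.prj1_hom[OF S] and q2 = H1.prj2_hom[OF S]
  show ?thesis
    using glued_iso_comp[OF glued_iso_comp[OF
          iso_ten[OF H1.hom_obj(1)[OF h] glued_iso_conn[OF h q1 P] glued_iso_conn[OF h q2 Q]]
          iso_mon[OF h glued_pb[OF q1 P] glued_pb[OF q2 Q]]] glued_iso_pb[OF h glued_iso_inv[OF iso_e[OF S P Q]]]]
    by (simp add: comparison_def Let_def homD(2)[OF h])
qed

text \<open>By \<open>comparison_etM\<close> the external monoidality isomorphism is a factor of a comparison, and the other factors are
  isomorphisms that lift.\<close>

lemma lifts_etM:
  assumes f1: "f1 \<in> hom B T1' S1" and f2: "f2 \<in> hom B T2' S2" and P: "glued_obj S1 P" and Q: "glued_obj S2 Q"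
  shows "lifts (prd B T1' T2') (ext T1' T2' (gpb f1 P) (gpb f2 Q)) (gpb (cross B f1 f2) (ext S1 S2 P Q))
    (etM X1 f1 f2 (lft P) (lft Q)) (etM X2 f1 f2 (rgt P) (rgt Q))"
proof -
  note p = glued_objD[OF P] and q = glued_objD[OF Q]
  note T = H1.hom_obj(1)[OF f1] H1.hom_obj(1)[OF f2] and S = H1.hom_obj(2)[OF f1] H1.hom_obj(2)[OF f2]
  define PO where "PO = prd B T1' T2'"
  note PO = H1.prd_obj[OF T, folded PO_def]
  note p1 = H1.prj1_hom[OF T, folded PO_def] and p2 = H1.prj2_hom[OF T, folded PO_def]
  note c = H1.cross[OF f1 f2, folded PO_def]
  interpret D1: category "Fib H1 PO" by (rule H1.fib_category[OF PO])
  interpret D2: category "Fib H2 PO" by (rule H2.fib_category[OF PO])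
  note k = iso_ten[OF PO glued_iso_conn[OF p1 f1 P] glued_iso_conn[OF p2 f2 Q]]
    and ei = glued_iso_inv[OF iso_e[OF T glued_pb[OF f1 P] glued_pb[OF f2 Q], folded PO_def]]
  have m: "etM X1 f1 f2 (lft P) (lft Q) \<in> hom (Fib H1 PO)
        (lft (gprod PO (etO X1 T1' T2') (etO X2 T1' T2') (etA X2 T1' T2') (\<sigma> T1' T2') (gpb f1 P) (gpb f2 Q)))
        (lft (gpb (cross B f1 f2) (ext S1 S2 P Q)))"
    "etM X2 f1 f2 (rgt P) (rgt Q) \<in> hom (Fib H2 PO)
        (rgt (gprod PO (etO X1 T1' T2') (etO X2 T1' T2') (etA X2 T1' T2') (\<sigma> T1' T2') (gpb f1 P) (gpb f2 Q)))
        (rgt (gpb (cross B f1 f2) (ext S1 S2 P Q)))"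
    using iso_hom[OF E1.X.emon_iso[OF f1 f2 p(2) q(2)]] iso_hom[OF E2.X.emon_iso[OF f1 f2 p(3) q(3)]]
    by (simp_all add: PO_def)
  note mei = D1.comp_hom[OF iso_hom[OF glued_isoD(2)[OF ei]] m(1)] D2.comp_hom[OF iso_hom[OF glued_isoD(3)[OF ei]] m(2)]
  show ?thesis
    using glued_isoD(1)[OF iso_comparison[OF S P Q c(1), unfolded c(2,3)]]
      E1.comparison_etM[OF f1 f2 p(2) q(2)] E2.comparison_etM[OF f1 f2 p(3) q(3)]
      lifts_precomp_iff[OF k mei] lifts_precomp_iff[OF ei m] by (simp add: PO_def)
qed

end


section \<open>Commutativity\<close>

context internal_tensor
begin

lemma symmetricD:
  assumes c: "itensor_symmetric B H T"
  shows "\<lbrakk>S \<in> Obj B; A \<in> Obj (Fib H S); A' \<in> Obj (Fib H S)\<rbrakk> \<Longrightarrow>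
      itCom T S A A' \<in> iso (Fib H S) (itO T S A A') (itO T S A' A)"
    and "\<lbrakk>S \<in> Obj B; h \<in> hom (Fib H S) X Y; h' \<in> hom (Fib H S) X' Y'\<rbrakk> \<Longrightarrow>
      itA T S h' h \<cdot>\<^bsub>Fib H S\<^esub> itCom T S X X' = itCom T S Y Y' \<cdot>\<^bsub>Fib H S\<^esub> itA T S h h'"
    and "\<lbrakk>f \<in> hom B S' S; A \<in> Obj (Fib H S); A' \<in> Obj (Fib H S)\<rbrakk> \<Longrightarrow>
      pbA H f (itCom T S A A') \<cdot>\<^bsub>Fib H S'\<^esub> itM T f A A'
        = itM T f A' A \<cdot>\<^bsub>Fib H S'\<^esub> itCom T S' (pbO H f A) (pbO H f A')"
  using c unfolding itensor_symmetric_def bifunctor_natural_iso_iff by blast+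

end

locale corresponding_symmetric = corresponding_structures +
  fixes ass uni v1 v2
  assumes T1: "internal_structure ass True uni B H1 T1" and T2: "internal_structure ass True uni B H2 T2"
    and X1: "external_structure ass True uni B H1 X1" and X2: "external_structure ass True uni B H2 X2"
    and e1: "external_equivalence ass True uni B H1 X1 (E_ext B H1 T1) e1 v1"
    and e2: "external_equivalence ass True uni B H2 X2 (E_ext B H2 T2) e2 v2"
begin

definition "lifts_com S P Q \<longleftrightarrow> lifts S (ten S P Q) (ten S Q P)
  (itCom T1 S (lft P) (lft Q)) (itCom T2 S (rgt P) (rgt Q))"

definition "lifts_ecom S1 S2 P Q \<longleftrightarrow>
  lifts (prd B S1 S2) (ext S1 S2 P Q) (gpb (perm B S1 S2) (ext S2 S1 Q P))
    (etCom X1 S1 S2 (lft P) (lft Q)) (etCom X2 S1 S2 (rgt P) (rgt Q))"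

lemma symmetric: "itensor_symmetric B H1 T1" "itensor_symmetric B H2 T2"
  "etensor_symmetric B H1 X1" "etensor_symmetric B H2 X2"
  using T1 T2 X1 X2 by (simp_all add: internal_structure_def external_structure_def)

lemmas com1 = E1.T.symmetricD[OF symmetric(1)] and com2 = E2.T.symmetricD[OF symmetric(2)]
  and e1_com = e1[unfolded external_equivalence_def Let_def, THEN conjunct2, THEN conjunct2, THEN conjunct2,
      THEN conjunct1, THEN mp, OF TrueI, rule_format]
  and e2_com = e2[unfolded external_equivalence_def Let_def, THEN conjunct2, THEN conjunct2, THEN conjunct2,
      THEN conjunct1, THEN mp, OF TrueI, rule_format]

lemma com_hom:
  assumes "glued_obj S P" "glued_obj S Q"
  shows "itCom T1 S (lft P) (lft Q) \<in> hom (Fib H1 S) (lft (ten S P Q)) (lft (ten S Q P))"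
    "itCom T2 S (rgt P) (rgt Q) \<in> hom (Fib H2 S) (rgt (ten S P Q)) (rgt (ten S Q P))"
  using iso_hom[OF com1(1)] iso_hom[OF com2(1)] glued_objD[OF assms(1)] glued_objD[OF assms(2)] by auto

lemma com_transport:
  assumes l: "glued_iso S P P' a b" and l': "glued_iso S Q Q' c d"
  shows "lifts_com S P Q \<longleftrightarrow> lifts_com S P' Q'"
  unfolding lifts_com_def
proof (rule lifts_square_iff)
  note S = glued_iso_obj(1)[OF l]
  show "glued_iso S (ten S P Q) (ten S P' Q') (itA T1 S a c) (itA T2 S b d)"
    by (rule iso_ten[OF S l l'])
  show "glued_iso S (ten S Q P) (ten S Q' P') (itA T1 S c a) (itA T2 S d b)"
    by (rule iso_ten[OF S l' l])
  show "itA T1 S c a \<cdot>\<^bsub>Fib H1 S\<^esub> itCom T1 S (lft P) (lft Q)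
      = itCom T1 S (lft P') (lft Q') \<cdot>\<^bsub>Fib H1 S\<^esub> itA T1 S a c"
    by (rule com1(2)[OF S iso_hom[OF glued_isoD(2)[OF l]] iso_hom[OF glued_isoD(2)[OF l']]])
  show "itA T2 S d b \<cdot>\<^bsub>Fib H2 S\<^esub> itCom T2 S (rgt P) (rgt Q)
      = itCom T2 S (rgt P') (rgt Q') \<cdot>\<^bsub>Fib H2 S\<^esub> itA T2 S b d"
    by (rule com2(2)[OF S iso_hom[OF glued_isoD(3)[OF l]] iso_hom[OF glued_isoD(3)[OF l']]])
qed (use glued_iso_obj[OF l] glued_iso_obj[OF l'] com_hom in simp_all)

text \<open>The constraint over \<open>T\<close> is conjugate to the pullback of the one over \<open>S\<close>, by monoidality isomorphisms.\<close>

lemma com_pullback: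
  assumes f: "f \<in> hom B T S" and P: "glued_obj S P" and Q: "glued_obj S Q" and l: "lifts_com S P Q"
  shows "lifts_com T (gpb f P) (gpb f Q)"
proof -
  note p = glued_objD[OF P] and q = glued_objD[OF Q]
  note c = com_hom[OF glued_pb[OF f P] glued_pb[OF f Q]]
  show ?thesis
    unfolding lifts_com_def
    using lifts_postcomp_iff[OF iso_mon[OF f Q P] c]
      lifts_comp[OF glued_isoD(1)[OF iso_mon[OF f P Q]] lifts_pb[OF f l[unfolded lifts_com_def]]]
      com1(3)[OF f p(2) q(2)] com2(3)[OF f p(3) q(3)] by simp
qed

text \<open>Under \<open>e\<close> the external constraint becomes that of \<open>E(\<otimes>)\<close>, which is the internal constraint for \<open>t\<^sup>*q\<^sub>2\<^sup>*P\<close> and \<open>t\<^sup>*q\<^sub>1\<^sup>*Q\<close>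
  between isomorphisms that lift. Here \<open>t\<close> exchanges the factors, so these are the pullbacks along the
  projections of \<open>S1 \<times> S2\<close>, up to \<open>conn\<close>.\<close>

lemma ecom_iff:
  assumes S1: "S1 \<in> Obj B" and S2: "S2 \<in> Obj B" and P: "glued_obj S1 P" and Q: "glued_obj S2 Q"
  shows "lifts_ecom S1 S2 P Q \<longleftrightarrow> lifts_com (prd B S1 S2) (gpb (prj1 B S1 S2) P) (gpb (prj2 B S1 S2) Q)"
proof -
  define PO t q1 q2 where "PO = prd B S1 S2" and "t = perm B S1 S2"
    and "q1 = prj1 B S2 S1" and "q2 = prj2 B S2 S1"
  note p = glued_objD[OF P] and q = glued_objD[OF Q]
  note PO = H1.prd_obj[OF S1 S2, folded PO_def]
  note t = H1.perm[OF S1 S2, folded PO_def t_def q1_def q2_def]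
  note q1 = H1.prj1_hom[OF S2 S1, folded q1_def] and q2 = H1.prj2_hom[OF S2 S1, folded q2_def]
  note cQ = glued_iso_conn[OF t(1) q1 Q, unfolded t(2)] and cP = glued_iso_conn[OF t(1) q2 P, unfolded t(3)]
  note gP = glued_pb[OF t(1) glued_pb[OF q2 P]] and gQ = glued_pb[OF t(1) glued_pb[OF q1 Q]]
  define x1 where "x1 = itM T1 t (pbO H1 q1 (lft Q)) (pbO H1 q2 (lft P)) \<cdot>\<^bsub>Fib H1 PO\<^esub>
      itCom T1 PO (pbO H1 t (pbO H1 q2 (lft P))) (pbO H1 t (pbO H1 q1 (lft Q))) \<cdot>\<^bsub>Fib H1 PO\<^esub>
      itA T1 PO (conn H1 t q2 (lft P)) (conn H1 t q1 (lft Q))"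
  define x2 where "x2 = itM T2 t (pbO H2 q1 (rgt Q)) (pbO H2 q2 (rgt P)) \<cdot>\<^bsub>Fib H2 PO\<^esub>
      itCom T2 PO (pbO H2 t (pbO H2 q2 (rgt P))) (pbO H2 t (pbO H2 q1 (rgt Q))) \<cdot>\<^bsub>Fib H2 PO\<^esub>
      itA T2 PO (conn H2 t q2 (rgt P)) (conn H2 t q1 (rgt Q))"
  have x: "x1 = etCom (E_ext B H1 T1) S1 S2 (lft P) (lft Q)" "x2 = etCom (E_ext B H2 T2) S1 S2 (rgt P) (rgt Q)"
    by (simp_all add: E_ext_def Let_def x1_def x2_def PO_def t_def q1_def q2_def)
  note cc = iso_ten[OF PO cP cQ]
  note mm = iso_mon[OF t(1) glued_pb[OF q1 Q] glued_pb[OF q2 P]]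
  note h = com_hom[OF gP gQ]
  interpret D1: category "Fib H1 PO" by (rule H1.fib_category[OF PO])
  interpret D2: category "Fib H2 PO" by (rule H2.fib_category[OF PO])
  note hc = D1.comp_hom[OF iso_hom[OF glued_isoD(2)[OF cc]] h(1)] D2.comp_hom[OF iso_hom[OF glued_isoD(3)[OF cc]] h(2)]
  have 1: "lifts PO (ten PO (gpb (prj1 B S1 S2) P) (gpb (prj2 B S1 S2) Q))
      (gpb t (ten (prd B S2 S1) (gpb q1 Q) (gpb q2 P))) x1 x2
    \<longleftrightarrow> lifts_com PO (gpb t (gpb q2 P)) (gpb t (gpb q1 Q))"
    unfolding lifts_com_def
    using lifts_postcomp_iff[OF mm hc] lifts_precomp_iff[OF cc h] by (simp add: x1_def x2_def)
  have xh: "x1 \<in> hom (Fib H1 PO) (lft (ten PO (gpb (prj1 B S1 S2) P) (gpb (prj2 B S1 S2) Q)))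
      (lft (gpb t (ten (prd B S2 S1) (gpb q1 Q) (gpb q2 P))))"
    "x2 \<in> hom (Fib H2 PO) (rgt (ten PO (gpb (prj1 B S1 S2) P) (gpb (prj2 B S1 S2) Q)))
      (rgt (gpb t (ten (prd B S2 S1) (gpb q1 Q) (gpb q2 P))))"
    using D1.comp_hom[OF hc(1) iso_hom[OF glued_isoD(2)[OF mm]]] D2.comp_hom[OF hc(2) iso_hom[OF glued_isoD(3)[OF mm]]]
    by (simp_all add: x1_def x2_def)
  have yh: "etCom X1 S1 S2 (lft P) (lft Q) \<in> hom (Fib H1 PO) (lft (ext S1 S2 P Q)) (lft (gpb t (ext S2 S1 Q P)))"
    "etCom X2 S1 S2 (rgt P) (rgt Q) \<in> hom (Fib H2 PO) (rgt (ext S1 S2 P Q)) (rgt (gpb t (ext S2 S1 Q P)))"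
    using symmetric(3,4) S1 S2 p q
    unfolding etensor_symmetric_def bifunctor_natural_iso_iff
    by (auto simp: PO_def t_def intro: iso_hom)
  have 2: "lifts_ecom S1 S2 P Q \<longleftrightarrow> lifts PO (ten PO (gpb (prj1 B S1 S2) P) (gpb (prj2 B S1 S2) Q))
      (gpb t (ten (prd B S2 S1) (gpb q1 Q) (gpb q2 P))) x1 x2"
    unfolding lifts_ecom_def PO_def[symmetric] t_def[symmetric]
    using lifts_square_iff[OF iso_e[OF S1 S2 P Q, folded PO_def]
        glued_iso_pb[OF t(1) iso_e[OF S2 S1 Q P, folded q1_def q2_def]] yh[folded PO_def] xh]
      e1_com[OF S1 S2 p(2) q(2)] e2_com[OF S1 S2 p(3) q(3)] x
    by (simp add: PO_def t_def)
  show ?thesis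
    using 1 2 com_transport[OF cP cQ] by (simp add: PO_def)
qed

lemma com_base_iff:
  assumes S: "S \<in> Obj B" and A: "A1 \<in> Obj (Fib H1 S)" "A2 \<in> Obj (Fib H1 S)"
  shows "lifts_com S (gbase S A1) (gbase S A2) \<longleftrightarrow>
    morA R S (itCom T1 S A1 A2) \<cdot>\<^bsub>Fib H2 S\<^esub> \<rho> S A1 A2
      = \<rho> S A2 A1 \<cdot>\<^bsub>Fib H2 S\<^esub> itCom T2 S (morO R S A1) (morO R S A2)"
proof -
  note g = glued_base[OF S A(1)] glued_base[OF S A(2)]
  show ?thesis
    unfolding lifts_com_def lifts_iff[OF glued_ten[OF S g] glued_ten[OF S g(2,1)] com_hom[OF g]]
      cmpr_ten_base[OF S A] cmpr_ten_base[OF S A(2,1)]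
    by (auto simp: eq_commute)
qed

lemma ecom_base_iff:
  assumes S: "S1 \<in> Obj B" "S2 \<in> Obj B" and A: "A1 \<in> Obj (Fib H1 S1)" "A2 \<in> Obj (Fib H1 S2)"
  defines "D \<equiv> Fib H2 (prd B S1 S2)" and "t \<equiv> perm B S1 S2"
  shows "lifts_ecom S1 S2 (gbase S1 A1) (gbase S2 A2) \<longleftrightarrow>
    morA R (prd B S1 S2) (etCom X1 S1 S2 A1 A2) \<cdot>\<^bsub>D\<^esub> \<sigma> S1 S2 A1 A2
      = theta R t (etO X1 S2 S1 A2 A1) \<cdot>\<^bsub>D\<^esub> pbA H2 t (\<sigma> S2 S1 A2 A1)
          \<cdot>\<^bsub>D\<^esub> etCom X2 S1 S2 (morO R S1 A1) (morO R S2 A2)"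
proof -
  note g1 = glued_base[OF S(1) A(1)] and g2 = glued_base[OF S(2) A(2)]
  note t = H1.perm(1)[OF S, folded t_def]
  interpret D: category D unfolding D_def by (rule H2.fib_category[OF H1.prd_obj[OF S]])
  have h: "etCom X1 S1 S2 A1 A2 \<in> hom (Fib H1 (prd B S1 S2)) (etO X1 S1 S2 A1 A2) (pbO H1 t (etO X1 S2 S1 A2 A1))"
    "etCom X2 S1 S2 (morO R S1 A1) (morO R S2 A2) \<in> hom D (etO X2 S1 S2 (morO R S1 A1) (morO R S2 A2))
      (pbO H2 t (etO X2 S2 S1 (morO R S2 A2) (morO R S1 A1)))"
    using symmetric(3,4) S A mor_obj[OF S(1) A(1)] mor_obj[OF S(2) A(2)]
    unfolding etensor_symmetric_def bifunctor_natural_iso_iff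
    by (auto simp: D_def t_def intro: iso_hom)
  note s = iso_hom[OF glued_objD(4)[OF glued_ext[OF S(2,1) g2 g1]], unfolded cmpr_ext_base[OF S(2,1) A(2,1)]]
  note th = iso_hom[OF theta_iso[OF t glued_objD(2)[OF glued_ext[OF S(2,1) g2 g1]]]]
  show ?thesis
    unfolding lifts_ecom_def t_def[symmetric]
    using lifts_iff[OF glued_ext[OF S g1 g2] glued_pb[OF t glued_ext[OF S(2,1) g2 g1]]] h
      D.comp_assoc[OF h(2) H2.pb_hom[OF t s, folded D_def, unfolded gprod_simps gbase_simps]
        th[folded D_def, unfolded gprod_simps gbase_simps]]
    by (auto simp: cmpr_gpb[OF t] cmpr_ext_base[OF S A] cmpr_ext_base[OF S(2,1) A(2,1)] D_def)
qed

text \<open>From left to right, \<open>ecom_iff\<close> reduces the external constraint to the internal one at pulled back glued objects,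
  which are isomorphic to \<open>gbase\<close> objects. From right to left, it yields the internal constraint for the pullbacks
  of \<open>A1\<close> and \<open>A2\<close> to \<open>S \<times> S\<close>, which is then pulled back along the diagonal.\<close>

lemma symmetric_iff:
  "(\<forall>S \<in> Obj B. \<forall>A1 \<in> Obj (Fib H1 S). \<forall>A2 \<in> Obj (Fib H1 S). lifts_com S (gbase S A1) (gbase S A2))
    \<longleftrightarrow> (\<forall>S1 \<in> Obj B. \<forall>S2 \<in> Obj B. \<forall>A1 \<in> Obj (Fib H1 S1). \<forall>A2 \<in> Obj (Fib H1 S2).
      lifts_ecom S1 S2 (gbase S1 A1) (gbase S2 A2))" (is "?I \<longleftrightarrow> ?E")
proof
  assume I: ?I
  show ?E
  proof (intro ballI)
    fix S1 S2 A1 A2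
    assume S: "S1 \<in> Obj B" "S2 \<in> Obj B" and A: "A1 \<in> Obj (Fib H1 S1)" "A2 \<in> Obj (Fib H1 S2)"
    note g1 = glued_base[OF S(1) A(1)] and g2 = glued_base[OF S(2) A(2)]
    note p1 = glued_pb[OF H1.prj1_hom[OF S] g1] and p2 = glued_pb[OF H1.prj2_hom[OF S] g2]
    show "lifts_ecom S1 S2 (gbase S1 A1) (gbase S2 A2)"
      using ecom_iff[OF S g1 g2] com_transport[OF glued_iso_base[OF p1] glued_iso_base[OF p2]]
        I glued_objD[OF p1] glued_objD[OF p2] by simp
  qed
next
  assume E: ?E
  show ?I
  proof (intro ballI)
    fix S A1 A2
    assume S: "S \<in> Obj B" and A: "A1 \<in> Obj (Fib H1 S)" "A2 \<in> Obj (Fib H1 S)"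
    note g1 = glued_base[OF S A(1)] and g2 = glued_base[OF S A(2)]
    note q1 = H1.prj1_hom[OF S S] and q2 = H1.prj2_hom[OF S S] and d = H1.diag[OF S]
    have "lifts_com S (gpb (diag B S) (gpb (prj1 B S S) (gbase S A1))) (gpb (diag B S) (gpb (prj2 B S S) (gbase S A2)))"
      using com_pullback[OF d(1) glued_pb[OF q1 g1] glued_pb[OF q2 g2]] ecom_iff[OF S S g1 g2] E S A by simp
    then show "lifts_com S (gbase S A1) (gbase S A2)"
      using com_transport[OF glued_iso_retract[OF d(1) q1 d(2) g1] glued_iso_retract[OF d(1) q2 d(3) g2]]
      by simp
  qed
qed

end


section \<open>Units\<close>

text \<open>Left and right unit constraints are treated together. The flag \<open>l\<close> says that the unit is the left argument.
  The base of the unit is called \<open>S'\<close>, that of the other argument \<open>S\<close>.\<close>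

definition sided :: "bool \<Rightarrow> ('a \<Rightarrow> 'a \<Rightarrow> 'b) \<Rightarrow> 'a \<Rightarrow> 'a \<Rightarrow> 'b" where
  "sided l f x u = (if l then f u x else f x u)"

definition sided2 :: "bool \<Rightarrow> ('o \<Rightarrow> 'o \<Rightarrow> 'a \<Rightarrow> 'a \<Rightarrow> 'b) \<Rightarrow> 'o \<Rightarrow> 'o \<Rightarrow> 'a \<Rightarrow> 'a \<Rightarrow> 'b" where
  "sided2 l f S S' x u = (if l then f S' S u x else f S S' x u)"

definition own :: "('o, 'm) pcat \<Rightarrow> bool \<Rightarrow> 'o \<Rightarrow> 'o \<Rightarrow> 'm" where
  "own B l S S' = (if l then prj2 B S' S else prj1 B S S')"

definition other :: "('o, 'm) pcat \<Rightarrow> bool \<Rightarrow> 'o \<Rightarrow> 'o \<Rightarrow> 'm" where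
  "other B l S S' = (if l then prj1 B S' S else prj2 B S S')"

definition unitor :: "('o, 'm, 'x, 'h) itensor \<Rightarrow> bool \<Rightarrow> 'o \<Rightarrow> 'x \<Rightarrow> 'h" where
  "unitor T l S A = (if l then itUl T S A else itUr T S A)"

definition eunitor :: "('o, 'm, 'x, 'h) etensor \<Rightarrow> bool \<Rightarrow> 'o \<Rightarrow> 'o \<Rightarrow> 'x \<Rightarrow> 'h" where
  "eunitor X l S S' A = (if l then etUl X S' S A else etUr X S S' A)"

lemmas sided_defs = sided_def sided2_def own_def other_def unitor_def eunitor_def

context internal_tensor
begin

lemma unitary_section: "itensor_unitary B H T \<Longrightarrow> fib_section B H (itUnit T)"
  by (simp add: itensor_unitary_def)

lemma unitorD:
  assumes u: "itensor_unitary B H T"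
  shows "\<lbrakk>S \<in> Obj B; A \<in> Obj (Fib H S)\<rbrakk> \<Longrightarrow>
      unitor T l S A \<in> iso (Fib H S) (sided l (itO T S) A (secO (itUnit T) S)) A"
    and "\<lbrakk>S \<in> Obj B; h \<in> hom (Fib H S) X Y\<rbrakk> \<Longrightarrow> h \<cdot>\<^bsub>Fib H S\<^esub> unitor T l S X
      = unitor T l S Y \<cdot>\<^bsub>Fib H S\<^esub> sided l (itA T S) h (Idm (Fib H S) (secO (itUnit T) S))"
    and "\<lbrakk>f \<in> hom B S' S; A \<in> Obj (Fib H S)\<rbrakk> \<Longrightarrow>
      pbA H f (unitor T l S A) \<cdot>\<^bsub>Fib H S'\<^esub> sided l (itM T f) A (secO (itUnit T) S)
        = unitor T l S' (pbO H f A) \<cdot>\<^bsub>Fib H S'\<^esub> sided l (itA T S') (Idm (Fib H S') (pbO H f A)) (secA (itUnit T) f)"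
  using u unfolding itensor_unitary_def is_natural_iso_def sided_defs by (cases l; simp; blast)+

end

lemma (in external_tensor) eunitor_hom:
  assumes "etensor_unitary B H X" "S \<in> Obj B" "S' \<in> Obj B" "A \<in> Obj (Fib H S)"
  shows "eunitor X l S S' A \<in> hom (Fib H (sided l (prd B) S S'))
    (sided2 l (etO X) S S' A (secO (etUnit X) S')) (pbO H (own B l S S') A)"
  using assms unfolding etensor_unitary_def is_natural_iso_def sided_defs
  by (cases l) (auto intro: iso_hom)

locale corresponding_unitary = corresponding_structures B H1 H2 R T1 X1 e1 T2 X2 e2 \<rho> \<sigma>
  for B :: "('o, 'm) pcat" and H1 :: "('o, 'm, 'x1, 'h1) fibcat" and H2 :: "('o, 'm, 'x2, 'h2) fibcat"
    and R :: "('o, 'm, 'x1, 'h1, 'x2, 'h2) fibmor" and T1 X1 e1 T2 X2 e2 \<rho> \<sigma> +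
  fixes ass com v1 v2 and w :: "'o \<Rightarrow> 'h2"
  assumes T1: "internal_structure ass com True B H1 T1" and T2: "internal_structure ass com True B H2 T2"
    and X1: "external_structure ass com True B H1 X1" and X2: "external_structure ass com True B H2 X2"
    and e1: "external_equivalence ass com True B H1 X1 (E_ext B H1 T1) e1 v1"
    and e2: "external_equivalence ass com True B H2 X2 (E_ext B H2 T2) e2 v2"
    and w_section: "section_iso B H2 (image_section B H2 R (itUnit T1)) (itUnit T2) w"
begin

lemma unitary: "itensor_unitary B H1 T1" "itensor_unitary B H2 T2"
  "etensor_unitary B H1 X1" "etensor_unitary B H2 X2"
  using T1 T2 X1 X2 by (simp_all add: internal_structure_def external_structure_def)

lemma v1_section: "section_iso B H1 (etUnit X1) (itUnit T1) v1"
  and v2_section: "section_iso B H2 (etUnit X2) (itUnit T2) v2"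
  using e1 e2 by (simp_all add: external_equivalence_def E_ext_def)

lemmas u1 = E1.T.unitorD[OF unitary(1)] and u2 = E2.T.unitorD[OF unitary(2)]

abbreviation "w' \<equiv> transport_unit_iso H2 R v1 v2 w"

abbreviation "U1 \<equiv> secO (itUnit T1)"

abbreviation "U2 \<equiv> secO (itUnit T2)"

lemma w_iso: "S \<in> Obj B \<Longrightarrow> w S \<in> iso (Fib H2 S) (morO R S (U1 S)) (U2 S)"
  using w_section by (simp add: section_iso_def image_section_def)

lemma v_iso: "S \<in> Obj B \<Longrightarrow> v1 S \<in> iso (Fib H1 S) (secO (etUnit X1) S) (U1 S)"
  "S \<in> Obj B \<Longrightarrow> v2 S \<in> iso (Fib H2 S) (secO (etUnit X2) S) (U2 S)"
  using v1_section v2_section by (simp_all add: section_iso_def)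

lemma w'_iso:
  assumes S: "S \<in> Obj B"
  shows "w' S \<in> iso (Fib H2 S) (morO R S (secO (etUnit X1) S)) (secO (etUnit X2) S)"
    "v2 S \<cdot>\<^bsub>Fib H2 S\<^esub> w' S = w S \<cdot>\<^bsub>Fib H2 S\<^esub> morA R S (v1 S)"
proof -
  interpret D: category "Fib H2 S" by (rule H2.fib_category[OF S])
  note wv = D.iso_comp[OF mor_iso(1)[OF S v_iso(1)[OF S]] w_iso[OF S]]
  show "w' S \<in> iso (Fib H2 S) (morO R S (secO (etUnit X1) S)) (secO (etUnit X2) S)"
    unfolding transport_unit_iso_def by (rule D.iso_comp[OF wv D.inv_arr(1)[OF v_iso(2)[OF S]]])
  show "v2 S \<cdot>\<^bsub>Fib H2 S\<^esub> w' S = w S \<cdot>\<^bsub>Fib H2 S\<^esub> morA R S (v1 S)"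
    unfolding transport_unit_iso_def by (rule D.inv_arr_cancel(2)[OF v_iso(2)[OF S] iso_hom[OF wv]])
qed

text \<open>The isomorphism \<open>w : R(\<one>) \<rightarrow> \<one>\<close> of unit sections turns the two units into a glued object. Its arrows
  \<open>f\<^sup>*\<one> \<rightarrow> \<one>\<close> lift because \<open>w\<close> respects sections (\<open>iso_unit_section\<close>). The transported isomorphism \<open>w'\<close> does the same
  for the unit sections of \<open>\<boxtimes>\<close>, and is the one for which \<open>(v1, v2)\<close> lifts (\<open>iso_v\<close>).\<close>

definition "gunit S = Glued (U1 S) (U2 S) (inv_arr (Fib H2 S) (w S))"

definition "geunit S = Glued (secO (etUnit X1) S) (secO (etUnit X2) S) (inv_arr (Fib H2 S) (w' S))"

lemma gunit_simps [simp]: "lft (gunit S) = U1 S" "rgt (gunit S) = U2 S" "cmpr (gunit S) = inv_arr (Fib H2 S) (w S)"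
  "lft (geunit S) = secO (etUnit X1) S" "rgt (geunit S) = secO (etUnit X2) S"
  "cmpr (geunit S) = inv_arr (Fib H2 S) (w' S)"
  by (simp_all add: gunit_def geunit_def)

lemma glued_unit:
  assumes S: "S \<in> Obj B"
  shows "glued_obj S (gunit S)" "glued_obj S (geunit S)"
proof -
  interpret D1: category "Fib H1 S" by (rule H1.fib_category[OF S])
  interpret D2: category "Fib H2 S" by (rule H2.fib_category[OF S])
  show "glued_obj S (gunit S)" "glued_obj S (geunit S)"
    using S D2.inv_arr(1)[OF w_iso[OF S]] D2.inv_arr(1)[OF w'_iso(1)[OF S]]
      D1.hom_obj[OF iso_hom[OF v_iso(1)[OF S]]] D2.hom_obj[OF iso_hom[OF v_iso(2)[OF S]]]
    by (simp_all add: glued_obj_def)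
qed

lemma iso_v:
  assumes S: "S \<in> Obj B"
  shows "glued_iso S (geunit S) (gunit S) (v1 S) (v2 S)"
proof -
  interpret D: category "Fib H2 S" by (rule H2.fib_category[OF S])
  note v = v_iso[OF S]
  have "morA R S (v1 S) \<cdot>\<^bsub>Fib H2 S\<^esub> inv_arr (Fib H2 S) (w' S)
      = inv_arr (Fib H2 S) (w S) \<cdot>\<^bsub>Fib H2 S\<^esub> v2 S"
    by (rule D.square_inv[OF w'_iso(1)[OF S] w_iso[OF S] iso_hom[OF mor_iso(1)[OF S v(1)]]
          iso_hom[OF v(2)] w'_iso(2)[OF S]])
  then show ?thesis
    using glued_unit[OF S] v iso_hom[OF v(1)] iso_hom[OF v(2)] by (simp add: glued_iso_def lifts_def)
qed

lemma iso_unit_section: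
  assumes f: "f \<in> hom B T S"
  shows "glued_iso T (gpb f (gunit S)) (gunit T) (secA (itUnit T1) f) (secA (itUnit T2) f)"
proof -
  note T = H1.hom_obj(1)[OF f] and S = H1.hom_obj(2)[OF f]
  interpret D: category "Fib H2 T" by (rule H2.fib_category[OF T])
  note s1 = fib_section.sec_iso[OF E1.T.unitary_section[OF unitary(1)] f]
    and s2 = fib_section.sec_iso[OF E2.T.unitary_section[OF unitary(2)] f]
  note k = H2.pb_iso[OF f w_iso[OF S]]
  note gS = glued_unit(1)[OF S] and gT = glued_unit(1)[OF T]
  note th = iso_hom[OF theta_iso[OF f glued_objD(2)[OF gS]], unfolded gunit_simps]
  note R = mor_hom[OF T iso_hom[OF s1]]
  note iw = D.inv_arr(2)[OF w_iso[OF T]]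
  have "secA (itUnit T2) f \<cdot>\<^bsub>Fib H2 T\<^esub> pbA H2 f (w S)
      = w T \<cdot>\<^bsub>Fib H2 T\<^esub> morA R T (secA (itUnit T1) f) \<cdot>\<^bsub>Fib H2 T\<^esub> theta R f (U1 S)"
    using w_section f homD[OF f] by (simp add: section_iso_def image_section_def)
  then have "(inv_arr (Fib H2 T) (w T) \<cdot>\<^bsub>Fib H2 T\<^esub> secA (itUnit T2) f) \<cdot>\<^bsub>Fib H2 T\<^esub> pbA H2 f (w S)
      = morA R T (secA (itUnit T1) f) \<cdot>\<^bsub>Fib H2 T\<^esub> theta R f (U1 S)"
    using D.comp_assoc[OF iso_hom[OF k(1)] iso_hom[OF s2] iw]
      D.inv_arr_cancel(1)[OF w_iso[OF T] D.comp_hom[OF th R]] by simp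
  then show ?thesis
    using glued_pb[OF f gS] gT s1 s2 iso_hom[OF s1] iso_hom[OF s2] k(2)
      D.move_iso[OF k(1) D.comp_hom[OF iso_hom[OF s2] iw] th R]
    by (simp add: glued_iso_def lifts_def cmpr_gpb[OF f])
qed

definition "uten l S = sided l (ten S)"

definition "uext l S S' = sided2 l ext S S'"

lemma uten_simps [simp]: "lft (uten l S P Q) = sided l (itO T1 S) (lft P) (lft Q)"
  "rgt (uten l S P Q) = sided l (itO T2 S) (rgt P) (rgt Q)"
  "lft (uext l S S' P Q) = sided2 l (etO X1) S S' (lft P) (lft Q)"
  "rgt (uext l S S' P Q) = sided2 l (etO X2) S S' (rgt P) (rgt Q)"
  by (simp_all add: uten_def uext_def sided_defs)

lemma sided_prd:
  assumes "S \<in> Obj B" "S' \<in> Obj B"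
  shows "sided l (prd B) S S' \<in> Obj B" "own B l S S' \<in> hom B (sided l (prd B) S S') S"
    "other B l S S' \<in> hom B (sided l (prd B) S S') S'"
  using assms H1.prd_obj H1.prj1_hom H1.prj2_hom by (simp_all add: sided_defs)

lemma iso_uten: "\<lbrakk>S \<in> Obj B; glued_iso S P P' a b; glued_iso S Q Q' c d\<rbrakk> \<Longrightarrow>
    glued_iso S (uten l S P Q) (uten l S P' Q') (sided l (itA T1 S) a c) (sided l (itA T2 S) b d)"
  and iso_uext: "\<lbrakk>S \<in> Obj B; S' \<in> Obj B; glued_iso S P P' a b; glued_iso S' U U' c d\<rbrakk> \<Longrightarrow>
    glued_iso (sided l (prd B) S S') (uext l S S' P U) (uext l S S' P' U')
      (sided2 l (etA X1) S S' a c) (sided2 l (etA X2) S S' b d)"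
  and iso_umon: "\<lbrakk>f \<in> hom B T S; glued_obj S P; glued_obj S Q\<rbrakk> \<Longrightarrow>
    glued_iso T (uten l T (gpb f P) (gpb f Q)) (gpb f (uten l S P Q))
      (sided l (itM T1 f) (lft P) (lft Q)) (sided l (itM T2 f) (rgt P) (rgt Q))"
  and iso_ue: "\<lbrakk>S \<in> Obj B; S' \<in> Obj B; glued_obj S P; glued_obj S' U\<rbrakk> \<Longrightarrow>
    glued_iso (sided l (prd B) S S') (uext l S S' P U)
      (uten l (sided l (prd B) S S') (gpb (own B l S S') P) (gpb (other B l S S') U))
      (sided2 l e1 S S' (lft P) (lft U)) (sided2 l e2 S S' (rgt P) (rgt U))"
  using iso_ten iso_ext iso_mon iso_e by (simp_all add: uten_def uext_def sided_defs)

definition "lifts_unitor l S P \<longleftrightarrow>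
  lifts S (uten l S P (gunit S)) P (unitor T1 l S (lft P)) (unitor T2 l S (rgt P))"

definition "lifts_eunitor l S S' P \<longleftrightarrow>
  lifts (sided l (prd B) S S') (uext l S S' P (geunit S')) (gpb (own B l S S') P)
    (eunitor X1 l S S' (lft P)) (eunitor X2 l S S' (rgt P))"

lemma unitor_hom:
  assumes "glued_obj S P"
  shows "unitor T1 l S (lft P) \<in> hom (Fib H1 S) (lft (uten l S P (gunit S))) (lft P)"
    "unitor T2 l S (rgt P) \<in> hom (Fib H2 S) (rgt (uten l S P (gunit S))) (rgt P)"
  using iso_hom[OF u1(1)] iso_hom[OF u2(1)] glued_objD[OF assms] by simp_all

lemma unitor_transport:
  assumes l: "glued_iso S P P' a b"
  shows "lifts_unitor k S P \<longleftrightarrow> lifts_unitor k S P'"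
  unfolding lifts_unitor_def
proof (rule lifts_square_iff)
  note S = glued_iso_obj(1)[OF l]
  show "glued_iso S (uten k S P (gunit S)) (uten k S P' (gunit S))
      (sided k (itA T1 S) a (Idm (Fib H1 S) (lft (gunit S)))) (sided k (itA T2 S) b (Idm (Fib H2 S) (rgt (gunit S))))"
    by (rule iso_uten[OF S l glued_iso_id[OF glued_unit(1)[OF S]]])
  show "glued_iso S P P' a b" by (rule l)
  show "a \<cdot>\<^bsub>Fib H1 S\<^esub> unitor T1 k S (lft P)
      = unitor T1 k S (lft P') \<cdot>\<^bsub>Fib H1 S\<^esub> sided k (itA T1 S) a (Idm (Fib H1 S) (lft (gunit S)))"
    "b \<cdot>\<^bsub>Fib H2 S\<^esub> unitor T2 k S (rgt P)
      = unitor T2 k S (rgt P') \<cdot>\<^bsub>Fib H2 S\<^esub> sided k (itA T2 S) b (Idm (Fib H2 S) (rgt (gunit S)))"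
    using u1(2)[OF S iso_hom[OF glued_isoD(2)[OF l]]] u2(2)[OF S iso_hom[OF glued_isoD(3)[OF l]]] by simp_all
qed (rule unitor_hom[OF glued_iso_obj(2)[OF l]] unitor_hom[OF glued_iso_obj(3)[OF l]])+

text \<open>The compatibility of the unit constraint with pullbacks involves \<open>f\<^sup>*\<one> \<rightarrow> \<one>\<close>, which lifts.\<close>

lemma unitor_pullback:
  assumes f: "f \<in> hom B T S" and P: "glued_obj S P" and l: "lifts_unitor k S P"
  shows "lifts_unitor k T (gpb f P)"
proof -
  note p = glued_objD[OF P]
  note T = H1.hom_obj(1)[OF f] and S = H1.hom_obj(2)[OF f]
  note fP = glued_pb[OF f P]
  show ?thesis
    unfolding lifts_unitor_def
    using lifts_comp[OF glued_isoD(1)[OF iso_umon[OF f P glued_unit(1)[OF S]]] lifts_pb[OF f l[unfolded lifts_unitor_def]]]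
      lifts_precomp_iff[OF iso_uten[OF T glued_iso_id[OF fP] iso_unit_section[OF f]] unitor_hom[OF fP]]
      u1(3)[OF f p(2)] u2(3)[OF f p(3)]
    by simp
qed

text \<open>The external constraint is the composite of the equivalence \<open>v\<close> of units, of \<open>e\<close>, of \<open>pr\<^sup>*\<one> \<rightarrow> \<one>\<close> and of the internal
  constraint; all but the last are isomorphisms that lift.\<close>

lemma eunitor_iff:
  assumes S: "S \<in> Obj B" "S' \<in> Obj B" and P: "glued_obj S P"
  shows "lifts_eunitor l S S' P \<longleftrightarrow> lifts_unitor l (sided l (prd B) S S') (gpb (own B l S S') P)"
proof -
  define PO where "PO = sided l (prd B) S S'"
  note p = glued_objD[OF P]
  note PO = sided_prd[OF S, of l, folded PO_def]
  interpret D1: category "Fib H1 PO" by (rule H1.fib_category[OF PO(1)])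
  interpret D2: category "Fib H2 PO" by (rule H2.fib_category[OF PO(1)])
  note qP = glued_pb[OF PO(2) P]
  note ve = glued_iso_comp[OF iso_uext[OF S glued_iso_id[OF P] iso_v[OF S(2)]]
      iso_ue[OF S P glued_unit(1)[OF S(2)]], of l, folded PO_def]
    and s = iso_uten[OF PO(1) glued_iso_id[OF qP] iso_unit_section[OF PO(3)], of l]
  note h1 = iso_hom[OF glued_isoD(2)[OF s]] iso_hom[OF glued_isoD(2)[OF ve]]
    and h2 = iso_hom[OF glued_isoD(3)[OF s]] iso_hom[OF glued_isoD(3)[OF ve]]
  note y = unitor_hom[OF qP, of l]
  have x: "eunitor X1 l S S' (lft P) = (unitor T1 l PO (lft (gpb (own B l S S') P))
      \<cdot>\<^bsub>Fib H1 PO\<^esub> sided l (itA T1 PO) (Idm (Fib H1 PO) (lft (gpb (own B l S S') P))) (secA (itUnit T1) (other B l S S')))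
      \<cdot>\<^bsub>Fib H1 PO\<^esub> sided2 l e1 S S' (lft P) (lft (gunit S'))
      \<cdot>\<^bsub>Fib H1 PO\<^esub> sided2 l (etA X1) S S' (Idm (Fib H1 S) (lft P)) (v1 S')"
    "eunitor X2 l S S' (rgt P) = (unitor T2 l PO (rgt (gpb (own B l S S') P))
      \<cdot>\<^bsub>Fib H2 PO\<^esub> sided l (itA T2 PO) (Idm (Fib H2 PO) (rgt (gpb (own B l S S') P))) (secA (itUnit T2) (other B l S S')))
      \<cdot>\<^bsub>Fib H2 PO\<^esub> sided2 l e2 S S' (rgt P) (rgt (gunit S'))
      \<cdot>\<^bsub>Fib H2 PO\<^esub> sided2 l (etA X2) S S' (Idm (Fib H2 S) (rgt P)) (v2 S')"
    using e1 e2 S p unfolding external_equivalence_def Let_def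
    by (simp_all add: E_ext_def Let_def PO_def sided_defs)
  show ?thesis
    unfolding lifts_unitor_def lifts_eunitor_def PO_def[symmetric] x
    using lifts_precomp_iff[OF glued_iso_comp[OF ve s] y] D1.comp_assoc[OF h1(2,1) y(1)] D2.comp_assoc[OF h2(2,1) y(2)]
    by simp
qed

text \<open>The glued unit carries the inverse of \<open>w\<close>, while the axiom contains \<open>w\<close>; \<open>move_iso\<close> exchanges the two forms.\<close>

lemma unitor_base_iff:
  assumes S: "S \<in> Obj B" and A: "A \<in> Obj (Fib H1 S)"
  shows "lifts_unitor l S (gbase S A) \<longleftrightarrow>
    unitor T2 l S (morO R S A) \<cdot>\<^bsub>Fib H2 S\<^esub> sided l (itA T2 S) (Idm (Fib H2 S) (morO R S A)) (w S)
      = morA R S (unitor T1 l S A) \<cdot>\<^bsub>Fib H2 S\<^esub> sided l (\<rho> S) A (U1 S)"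
proof -
  interpret D: category "Fib H2 S" by (rule H2.fib_category[OF S])
  note g = glued_base[OF S A] and gU = glued_unit(1)[OF S] and RA = mor_obj[OF S A]
  note u = unitor_hom[OF g, of l]
  note U = glued_objD(2)[OF gU, unfolded gunit_simps]
  have k: "sided l (itA T2 S) (Idm (Fib H2 S) (morO R S A)) (w S)
      \<in> iso (Fib H2 S) (sided l (itO T2 S) (morO R S A) (morO R S (U1 S))) (sided l (itO T2 S) (morO R S A) (U2 S))"
    "sided l (itA T2 S) (Idm (Fib H2 S) (morO R S A)) (inv_arr (Fib H2 S) (w S))
      = inv_arr (Fib H2 S) (sided l (itA T2 S) (Idm (Fib H2 S) (morO R S A)) (w S))"
    using E2.T.ten_iso[OF S] E2.T.ten_inv[OF S] D.id_iso[OF RA] w_iso[OF S] D.inv_arr_id[OF RA]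
    by (simp_all add: sided_def) (metis (no_types))+
  have r: "sided l (\<rho> S) A (U1 S) \<in> hom (Fib H2 S)
      (sided l (itO T2 S) (morO R S A) (morO R S (U1 S))) (morO R S (sided l (itO T1 S) A (U1 S)))"
    using iso_hom[OF \<rho>_iso[OF S A U]] iso_hom[OF \<rho>_iso[OF S U A]] by (simp add: sided_def)
  have c: "cmpr (uten l S (gbase S A) (gunit S)) = sided l (\<rho> S) A (U1 S)
      \<cdot>\<^bsub>Fib H2 S\<^esub> sided l (itA T2 S) (Idm (Fib H2 S) (morO R S A)) (inv_arr (Fib H2 S) (w S))"
    by (simp add: uten_def sided_def cmpr_gprod)
  have o: "glued_obj S (uten l S (gbase S A) (gunit S))"
    using glued_ten[OF S g gU] glued_ten[OF S gU g] by (simp add: uten_def sided_def)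
  show ?thesis
    unfolding lifts_unitor_def
    using lifts_iff[OF o g u] D.id_left[OF u(2)] c k(2)
      D.move_iso[OF k(1) u(2)[unfolded uten_simps gbase_simps gunit_simps] r mor_hom[OF S u(1)[unfolded uten_simps gbase_simps gunit_simps]]]
    by simp
qed

lemma eunitor_base_iff:
  fixes l
  assumes S: "S \<in> Obj B" "S' \<in> Obj B" and A: "A \<in> Obj (Fib H1 S)"
  defines "D \<equiv> Fib H2 (sided l (prd B) S S')"
  shows "lifts_eunitor l S S' (gbase S A) \<longleftrightarrow>
    theta R (own B l S S') A \<cdot>\<^bsub>D\<^esub> eunitor X2 l S S' (morO R S A)
        \<cdot>\<^bsub>D\<^esub> sided2 l (etA X2) S S' (Idm (Fib H2 S) (morO R S A)) (w' S')
      = morA R (sided l (prd B) S S') (eunitor X1 l S S' A) \<cdot>\<^bsub>D\<^esub> sided2 l \<sigma> S S' A (secO (etUnit X1) S')"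
proof -
  note PO = sided_prd[OF S, of l]
  interpret D: category D unfolding D_def by (rule H2.fib_category[OF PO(1)])
  interpret F: category "Fib H2 S" by (rule H2.fib_category[OF S(1)])
  note g = glued_base[OF S(1) A] and gU = glued_unit(2)[OF S(2)] and RA = mor_obj[OF S(1) A]
  note U = glued_objD(2)[OF gU, unfolded gunit_simps]
  note u1 = E1.X.eunitor_hom[OF unitary(3) S A, of l]
    and u2 = E2.X.eunitor_hom[OF unitary(4) S RA, of l, folded D_def]
  have k: "sided2 l (etA X2) S S' (Idm (Fib H2 S) (morO R S A)) (w' S')
      \<in> iso D (sided2 l (etO X2) S S' (morO R S A) (morO R S' (secO (etUnit X1) S')))
        (sided2 l (etO X2) S S' (morO R S A) (secO (etUnit X2) S'))"
    "sided2 l (etA X2) S S' (Idm (Fib H2 S) (morO R S A)) (inv_arr (Fib H2 S') (w' S'))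
      = inv_arr D (sided2 l (etA X2) S S' (Idm (Fib H2 S) (morO R S A)) (w' S'))"
    using E2.X.ext_iso[OF S F.id_iso[OF RA] w'_iso(1)[OF S(2)]] E2.X.ext_iso[OF S(2,1) w'_iso(1)[OF S(2)] F.id_iso[OF RA]]
      E2.X.ext_inv[OF S F.id_iso[OF RA] w'_iso(1)[OF S(2)]] E2.X.ext_inv[OF S(2,1) w'_iso(1)[OF S(2)] F.id_iso[OF RA]]
      F.inv_arr_id[OF RA]
    by (simp_all add: sided_defs D_def)
  have r: "sided2 l \<sigma> S S' A (secO (etUnit X1) S') \<in> hom D
      (sided2 l (etO X2) S S' (morO R S A) (morO R S' (secO (etUnit X1) S')))
      (morO R (sided l (prd B) S S') (sided2 l (etO X1) S S' A (secO (etUnit X1) S')))"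
    using iso_hom[OF \<sigma>_iso[OF S A U]] iso_hom[OF \<sigma>_iso[OF S(2,1) U A]] by (simp add: sided_defs D_def)
  note th = iso_hom[OF theta_iso[OF PO(2) A], folded D_def]
  have c: "cmpr (uext l S S' (gbase S A) (geunit S')) = sided2 l \<sigma> S S' A (secO (etUnit X1) S')
      \<cdot>\<^bsub>D\<^esub> sided2 l (etA X2) S S' (Idm (Fib H2 S) (morO R S A)) (inv_arr (Fib H2 S') (w' S'))"
    by (simp add: uext_def sided_defs cmpr_gprod D_def)
  have o: "glued_obj (sided l (prd B) S S') (uext l S S' (gbase S A) (geunit S'))"
    using glued_ext[OF S g gU] glued_ext[OF S(2,1) gU g] by (simp add: uext_def sided_defs)
  show ?thesis
    unfolding lifts_eunitor_def
    using lifts_iff[OF o glued_pb[OF PO(2) g]] u1 u2 c k(2) cmpr_gpb_base[OF PO(2) A] D.comp_assoc[OF iso_hom[OF k(1)] u2 th]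
      D.move_iso[OF k(1) D.comp_hom[OF u2 th] r mor_hom[OF PO(1) u1, folded D_def]]
    by (simp add: D_def)
qed

text \<open>The argument is that of \<open>symmetric_iff\<close>.\<close>

lemma one_sided_unitary_iff:
  "(\<forall>S \<in> Obj B. \<forall>A \<in> Obj (Fib H1 S). lifts_unitor l S (gbase S A)) \<longleftrightarrow>
    (\<forall>S \<in> Obj B. \<forall>S' \<in> Obj B. \<forall>A \<in> Obj (Fib H1 S). lifts_eunitor l S S' (gbase S A))" (is "?I \<longleftrightarrow> ?E")
proof
  assume I: ?I
  show ?E
  proof (intro ballI)
    fix S S' A
    assume S: "S \<in> Obj B" "S' \<in> Obj B" and A: "A \<in> Obj (Fib H1 S)"
    note g = glued_base[OF S(1) A]
    note p = glued_pb[OF sided_prd(2)[OF S] g]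
    show "lifts_eunitor l S S' (gbase S A)"
      using eunitor_iff[OF S g] unitor_transport[OF glued_iso_base[OF p]] I glued_objD[OF p] by simp
  qed
next
  assume E: ?E
  show ?I
  proof (intro ballI)
    fix S A
    assume S: "S \<in> Obj B" and A: "A \<in> Obj (Fib H1 S)"
    note g = glued_base[OF S A] and q = sided_prd(2)[OF S S, of l]
    have d: "diag B S \<in> hom B S (sided l (prd B) S S)" "own B l S S \<cdot>\<^bsub>B\<^esub> diag B S = Idm B S"
      using H1.diag[OF S] by (simp_all add: sided_defs)
    have "lifts_unitor l S (gpb (diag B S) (gpb (own B l S S) (gbase S A)))"
      using unitor_pullback[OF d(1) glued_pb[OF q g], of l] eunitor_iff[OF S S g, of l] E S A by simp
    then show "lifts_unitor l S (gbase S A)"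
      using unitor_transport[OF glued_iso_retract[OF d(1) q d(2) g]] by simp
  qed
qed

lemma unitary_iff:
  "(\<forall>S \<in> Obj B. \<forall>A \<in> Obj (Fib H1 S). lifts_unitor False S (gbase S A) \<and> lifts_unitor True S (gbase S A))
    \<longleftrightarrow> (\<forall>S1 \<in> Obj B. \<forall>S2 \<in> Obj B. (\<forall>A1 \<in> Obj (Fib H1 S1). lifts_eunitor False S1 S2 (gbase S1 A1)) \<and>
      (\<forall>A2 \<in> Obj (Fib H1 S2). lifts_eunitor True S2 S1 (gbase S2 A2)))"
  using one_sided_unitary_iff[of False] one_sided_unitary_iff[of True] by blast

lemmas unitor_base_iffs =
    unitor_base_iff[of _ _ False, unfolded sided_defs if_False] unitor_base_iff[of _ _ True, unfolded sided_defs if_True]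
  and eunitor_base_iffs = eunitor_base_iff[of _ _ _ False, unfolded sided_defs if_False]
    eunitor_base_iff[of _ _ _ True, unfolded sided_defs if_True]

end


section \<open>Associativity\<close>

context internal_tensor
begin

lemma associativeD:
  assumes a: "itensor_associative B H T"
  shows "\<lbrakk>S \<in> Obj B; A1 \<in> Obj (Fib H S); A2 \<in> Obj (Fib H S); A3 \<in> Obj (Fib H S)\<rbrakk> \<Longrightarrow>
      itAss T S A1 A2 A3 \<in> iso (Fib H S) (itO T S (itO T S A1 A2) A3) (itO T S A1 (itO T S A2 A3))"
    and "\<lbrakk>S \<in> Obj B; h1 \<in> hom (Fib H S) A1 A1'; h2 \<in> hom (Fib H S) A2 A2'; h3 \<in> hom (Fib H S) A3 A3'\<rbrakk> \<Longrightarrow>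
      itA T S h1 (itA T S h2 h3) \<cdot>\<^bsub>Fib H S\<^esub> itAss T S A1 A2 A3
        = itAss T S A1' A2' A3' \<cdot>\<^bsub>Fib H S\<^esub> itA T S (itA T S h1 h2) h3"
    and "\<lbrakk>f \<in> hom B S' S; A1 \<in> Obj (Fib H S); A2 \<in> Obj (Fib H S); A3 \<in> Obj (Fib H S)\<rbrakk> \<Longrightarrow>
      pbA H f (itAss T S A1 A2 A3) \<cdot>\<^bsub>Fib H S'\<^esub> itM T f (itO T S A1 A2) A3
          \<cdot>\<^bsub>Fib H S'\<^esub> itA T S' (itM T f A1 A2) (Idm (Fib H S') (pbO H f A3))
        = itM T f A1 (itO T S A2 A3)
          \<cdot>\<^bsub>Fib H S'\<^esub> itA T S' (Idm (Fib H S') (pbO H f A1)) (itM T f A2 A3)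
          \<cdot>\<^bsub>Fib H S'\<^esub> itAss T S' (pbO H f A1) (pbO H f A2) (pbO H f A3)"
proof -
  note a' = a[unfolded itensor_associative_def]
  show "\<lbrakk>S \<in> Obj B; A1 \<in> Obj (Fib H S); A2 \<in> Obj (Fib H S); A3 \<in> Obj (Fib H S)\<rbrakk> \<Longrightarrow>
      itAss T S A1 A2 A3 \<in> iso (Fib H S) (itO T S (itO T S A1 A2) A3) (itO T S A1 (itO T S A2 A3))"
    by (rule trifunctor_natural_isoD(1)[OF a'[THEN conjunct1, THEN bspec]])
qed (rule trifunctor_natural_isoD(2)[OF a[unfolded itensor_associative_def, THEN conjunct1, THEN bspec]]
    a[unfolded itensor_associative_def, THEN conjunct2, THEN conjunct2, rule_format]; assumption)+

end

lemma (in external_tensor) associative_iso: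
  assumes "etensor_associative B H X" "S1 \<in> Obj B" "S2 \<in> Obj B" "S3 \<in> Obj B"
    and "A1 \<in> Obj (Fib H S1)" "A2 \<in> Obj (Fib H S2)" "A3 \<in> Obj (Fib H S3)"
  shows "etAss X S1 S2 S3 A1 A2 A3 \<in> iso (Fib H (prd B (prd B S1 S2) S3))
      (etO X (prd B S1 S2) S3 (etO X S1 S2 A1 A2) A3)
      (pbO H (reassoc B S1 S2 S3) (etO X S1 (prd B S2 S3) A1 (etO X S2 S3 A2 A3)))"
  by (rule trifunctor_natural_isoD(1)[OF assms(1)[unfolded etensor_associative_def, THEN conjunct1,
          THEN bspec, THEN bspec, THEN bspec, OF assms(2-4)] assms(5-7)])

locale corresponding_associative = corresponding_structures +
  fixes com uni v1 v2
  assumes T1: "internal_structure True com uni B H1 T1" and T2: "internal_structure True com uni B H2 T2"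
    and X1: "external_structure True com uni B H1 X1" and X2: "external_structure True com uni B H2 X2"
    and e1: "external_equivalence True com uni B H1 X1 (E_ext B H1 T1) e1 v1"
    and e2: "external_equivalence True com uni B H2 X2 (E_ext B H2 T2) e2 v2"
begin

lemma associative: "itensor_associative B H1 T1" "itensor_associative B H2 T2"
  "etensor_associative B H1 X1" "etensor_associative B H2 X2"
  using T1 T2 X1 X2 by (simp_all add: internal_structure_def external_structure_def)

lemmas ass1 = E1.T.associativeD[OF associative(1)] and ass2 = E2.T.associativeD[OF associative(2)]
  and e1_ass = e1[unfolded external_equivalence_def Let_def, THEN conjunct2, THEN conjunct2,
      THEN conjunct1, THEN mp, OF TrueI, rule_format]
  and e2_ass = e2[unfolded external_equivalence_def Let_def, THEN conjunct2, THEN conjunct2,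
      THEN conjunct1, THEN mp, OF TrueI, rule_format]

definition "lifts_ass S P1 P2 P3 \<longleftrightarrow> lifts S (ten S (ten S P1 P2) P3) (ten S P1 (ten S P2 P3))
  (itAss T1 S (lft P1) (lft P2) (lft P3)) (itAss T2 S (rgt P1) (rgt P2) (rgt P3))"

definition "lifts_eass S1 S2 S3 P1 P2 P3 \<longleftrightarrow>
  lifts (prd B (prd B S1 S2) S3) (ext (prd B S1 S2) S3 (ext S1 S2 P1 P2) P3)
    (gpb (reassoc B S1 S2 S3) (ext S1 (prd B S2 S3) P1 (ext S2 S3 P2 P3)))
    (etAss X1 S1 S2 S3 (lft P1) (lft P2) (lft P3)) (etAss X2 S1 S2 S3 (rgt P1) (rgt P2) (rgt P3))"

lemma ass_hom:
  assumes "glued_obj S P1" "glued_obj S P2" "glued_obj S P3"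
  shows "itAss T1 S (lft P1) (lft P2) (lft P3)
      \<in> hom (Fib H1 S) (lft (ten S (ten S P1 P2) P3)) (lft (ten S P1 (ten S P2 P3)))"
    "itAss T2 S (rgt P1) (rgt P2) (rgt P3)
      \<in> hom (Fib H2 S) (rgt (ten S (ten S P1 P2) P3)) (rgt (ten S P1 (ten S P2 P3)))"
  using iso_hom[OF ass1(1)] iso_hom[OF ass2(1)]
    glued_objD[OF assms(1)] glued_objD[OF assms(2)] glued_objD[OF assms(3)] by auto

lemma ass_transport:
  assumes l1: "glued_iso S P1 Q1 a1 b1" and l2: "glued_iso S P2 Q2 a2 b2" and l3: "glued_iso S P3 Q3 a3 b3"
  shows "lifts_ass S P1 P2 P3 \<longleftrightarrow> lifts_ass S Q1 Q2 Q3"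
  unfolding lifts_ass_def
proof (rule lifts_square_iff)
  note S = glued_iso_obj(1)[OF l1]
  show "glued_iso S (ten S (ten S P1 P2) P3) (ten S (ten S Q1 Q2) Q3)
      (itA T1 S (itA T1 S a1 a2) a3) (itA T2 S (itA T2 S b1 b2) b3)"
    by (rule iso_ten[OF S iso_ten[OF S l1 l2] l3])
  show "glued_iso S (ten S P1 (ten S P2 P3)) (ten S Q1 (ten S Q2 Q3))
      (itA T1 S a1 (itA T1 S a2 a3)) (itA T2 S b1 (itA T2 S b2 b3))"
    by (rule iso_ten[OF S l1 iso_ten[OF S l2 l3]])
  show "itA T1 S a1 (itA T1 S a2 a3) \<cdot>\<^bsub>Fib H1 S\<^esub> itAss T1 S (lft P1) (lft P2) (lft P3)
      = itAss T1 S (lft Q1) (lft Q2) (lft Q3) \<cdot>\<^bsub>Fib H1 S\<^esub> itA T1 S (itA T1 S a1 a2) a3"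
    by (rule ass1(2)[OF S iso_hom[OF glued_isoD(2)[OF l1]] iso_hom[OF glued_isoD(2)[OF l2]]
          iso_hom[OF glued_isoD(2)[OF l3]]])
  show "itA T2 S b1 (itA T2 S b2 b3) \<cdot>\<^bsub>Fib H2 S\<^esub> itAss T2 S (rgt P1) (rgt P2) (rgt P3)
      = itAss T2 S (rgt Q1) (rgt Q2) (rgt Q3) \<cdot>\<^bsub>Fib H2 S\<^esub> itA T2 S (itA T2 S b1 b2) b3"
    by (rule ass2(2)[OF S iso_hom[OF glued_isoD(3)[OF l1]] iso_hom[OF glued_isoD(3)[OF l2]]
          iso_hom[OF glued_isoD(3)[OF l3]]])
qed (rule ass_hom[OF glued_iso_obj(2)[OF l1] glued_iso_obj(2)[OF l2] glued_iso_obj(2)[OF l3]]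
  ass_hom[OF glued_iso_obj(3)[OF l1] glued_iso_obj(3)[OF l2] glued_iso_obj(3)[OF l3]])+

text \<open>The constraint over \<open>T\<close> is conjugate to the pullback of the one over \<open>S\<close>, by composites of two monoidality
  isomorphisms on either side.\<close>

lemma ass_pullback:
  assumes f: "f \<in> hom B T S" and P: "glued_obj S P1" "glued_obj S P2" "glued_obj S P3"
    and l: "lifts_ass S P1 P2 P3"
  shows "lifts_ass T (gpb f P1) (gpb f P2) (gpb f P3)"
proof -
  note T = H1.hom_obj(1)[OF f] and S = H1.hom_obj(2)[OF f]
  note p1 = glued_objD[OF P(1)] and p2 = glued_objD[OF P(2)] and p3 = glued_objD[OF P(3)]
  note fP = glued_pb[OF f P(1)] glued_pb[OF f P(2)] glued_pb[OF f P(3)]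
  note h = ass_hom[OF fP]
  note i12 = iso_ten[OF T iso_mon[OF f P(1,2)] glued_iso_id[OF fP(3)]]
    and i23 = iso_ten[OF T glued_iso_id[OF fP(1)] iso_mon[OF f P(2,3)]]
  note m12 = iso_mon[OF f glued_ten[OF S P(1,2)] P(3)] and m23 = iso_mon[OF f P(1) glued_ten[OF S P(2,3)]]
  interpret D1: category "Fib H1 T" by (rule H1.fib_category[OF T])
  interpret D2: category "Fib H2 T" by (rule H2.fib_category[OF T])
  note c = lifts_comp[OF glued_isoD(1)[OF glued_iso_comp[OF i12 m12]]
      lifts_pb[OF f l[unfolded lifts_ass_def]]]
  note h' = D1.comp_hom[OF h(1) iso_hom[OF glued_isoD(2)[OF i23]]] D2.comp_hom[OF h(2) iso_hom[OF glued_isoD(3)[OF i23]]]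
  show ?thesis
    unfolding lifts_ass_def
    using c lifts_postcomp_iff[OF m23 h'] lifts_postcomp_iff[OF i23 h]
      ass1(3)[OF f p1(2) p2(2) p3(2)] ass2(3)[OF f p1(3) p2(3) p3(3)]
    by simp
qed

text \<open>Under \<open>e\<close> the external constraint becomes that of \<open>E(\<otimes>)\<close>. By definition this is the internal constraint for the
  pullbacks to \<open>(S1 \<times> S2) \<times> S3\<close>, preceded by the inverse of an isomorphism \<open>\<mu>\<close> (facts \<open>mu\<close>) and followed by \<open>\<nu>\<close> (\<open>nu\<close>)
  and by \<open>\<alpha>\<close> (\<open>al\<close>), which accounts for \<open>reassoc\<close>. All three are composed of \<open>m\<close> and \<open>conn\<close>.\<close>

lemma eass_iff:
  assumes S: "S1 \<in> Obj B" "S2 \<in> Obj B" "S3 \<in> Obj B"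
    and P: "glued_obj S1 P1" "glued_obj S2 P2" "glued_obj S3 P3"
  defines "p12 \<equiv> prj1 B (prd B S1 S2) S3" and "p3 \<equiv> prj2 B (prd B S1 S2) S3"
  shows "lifts_eass S1 S2 S3 P1 P2 P3 \<longleftrightarrow> lifts_ass (prd B (prd B S1 S2) S3)
    (gpb (prj1 B S1 S2 \<cdot>\<^bsub>B\<^esub> p12) P1) (gpb (prj2 B S1 S2 \<cdot>\<^bsub>B\<^esub> p12) P2) (gpb p3 P3)"
proof -
  define S12 S23 PO where "S12 = prd B S1 S2" and "S23 = prd B S2 S3" and "PO = prd B (prd B S1 S2) S3"
  define q1 q2 s1 s2 t2 t3 r where "q1 = prj1 B S1 S2" and "q2 = prj2 B S1 S2" and "s1 = prj1 B S1 (prd B S2 S3)"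
    and "s2 = prj2 B S1 (prd B S2 S3)" and "t2 = prj1 B S2 S3" and "t3 = prj2 B S2 S3" and "r = reassoc B S1 S2 S3"
  define p23 where "p23 = s2 \<cdot>\<^bsub>B\<^esub> r"
  note a = glued_objD[OF P(1)] and b = glued_objD[OF P(2)] and c = glued_objD[OF P(3)]
  note O12 = H1.prd_obj[OF S(1,2), folded S12_def] and O23 = H1.prd_obj[OF S(2,3), folded S23_def]
  note PO = H1.prd_obj[OF H1.prd_obj[OF S(1,2)] S(3), folded PO_def]
  note q = H1.prj1_hom[OF S(1,2), folded q1_def S12_def] H1.prj2_hom[OF S(1,2), folded q2_def S12_def]
  note t = H1.prj1_hom[OF S(2,3), folded t2_def S23_def] H1.prj2_hom[OF S(2,3), folded t3_def S23_def]
  have s: "s1 \<in> hom B (prd B S1 S23) S1" "s2 \<in> hom B (prd B S1 S23) S23"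
    using H1.prj1_hom[OF S(1) O23] H1.prj2_hom[OF S(1) O23] by (simp_all add: s1_def s2_def S23_def)
  have p: "p12 \<in> hom B PO S12" "p3 \<in> hom B PO S3"
    using H1.prj1_hom[OF O12 S(3)] H1.prj2_hom[OF O12 S(3)] by (simp_all add: p12_def p3_def S12_def PO_def)
  have r: "r \<in> hom B PO (prd B S1 S23)" "s1 \<cdot>\<^bsub>B\<^esub> r = q1 \<cdot>\<^bsub>B\<^esub> p12" "t2 \<cdot>\<^bsub>B\<^esub> p23 = q2 \<cdot>\<^bsub>B\<^esub> p12" "t3 \<cdot>\<^bsub>B\<^esub> p23 = p3"
    using H1.reassoc[OF S]
    by (simp_all add: r_def PO_def S23_def s1_def s2_def q1_def q2_def p12_def p3_def t2_def t3_def p23_def)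
  note p23 = H1.comp_hom[OF r(1) s(2), folded p23_def]
  define Q1 Q2 Q3 where "Q1 = gpb (q1 \<cdot>\<^bsub>B\<^esub> p12) P1" and "Q2 = gpb (q2 \<cdot>\<^bsub>B\<^esub> p12) P2" and "Q3 = gpb p3 P3"
  note Q = glued_pb[OF H1.comp_hom[OF p(1) q(1)] P(1), folded Q1_def]
    glued_pb[OF H1.comp_hom[OF p(1) q(2)] P(2), folded Q2_def] glued_pb[OF p(2) P(3), folded Q3_def]
  note g1 = glued_pb[OF q(1) P(1)] and g2 = glued_pb[OF q(2) P(2)]
    and k2 = glued_pb[OF t(1) P(2)] and k3 = glued_pb[OF t(2) P(3)]
  define A12 A23 where "A12 = ten S12 (gpb q1 P1) (gpb q2 P2)" and "A23 = ten S23 (gpb t2 P2) (gpb t3 P3)"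
  note A12 = glued_ten[OF O12 g1 g2, folded A12_def] and A23 = glued_ten[OF O23 k2 k3, folded A23_def]
  note mu = glued_iso_comp[OF
      iso_ten[OF PO iso_ten[OF PO glued_iso_conn[OF p(1) q(1) P(1), folded Q1_def] glued_iso_conn[OF p(1) q(2) P(2), folded Q2_def]]
        glued_iso_id[OF Q(3)]]
      iso_ten[OF PO iso_mon[OF p(1) g1 g2, folded A12_def] glued_iso_id[OF Q(3)]]]
  note nu = glued_iso_comp[OF
      iso_ten[OF PO glued_iso_id[OF Q(1)]
        iso_ten[OF PO glued_iso_conn[OF p23 t(1) P(2), unfolded r, folded Q2_def]
          glued_iso_conn[OF p23 t(2) P(3), unfolded r, folded Q3_def]]]
      iso_ten[OF PO glued_iso_id[OF Q(1)] iso_mon[OF p23 k2 k3, folded A23_def]]]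
  note al = glued_iso_comp[OF
      iso_ten[OF PO glued_iso_conn[OF r(1) s(1) P(1), unfolded r, folded Q1_def]
        glued_iso_conn[OF r(1) s(2) A23, folded p23_def]]
      iso_mon[OF r(1) glued_pb[OF s(1) P(1)] glued_pb[OF s(2) A23]]]
  interpret D1: category "Fib H1 PO" by (rule H1.fib_category[OF PO])
  interpret D2: category "Fib H2 PO" by (rule H2.fib_category[OF PO])
  note h = ass_hom[OF Q]
  note mui = glued_iso_inv[OF mu]
  note h1 = D1.comp_hom[OF iso_hom[OF glued_isoD(2)[OF mui]] h(1)] D2.comp_hom[OF iso_hom[OF glued_isoD(3)[OF mui]] h(2)]
  note h2 = D1.comp_hom[OF h1(1) iso_hom[OF glued_isoD(2)[OF nu]]] D2.comp_hom[OF h1(2) iso_hom[OF glued_isoD(3)[OF nu]]]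
  note h3 = D1.comp_hom[OF h2(1) iso_hom[OF glued_isoD(2)[OF al]]] D2.comp_hom[OF h2(2) iso_hom[OF glued_isoD(3)[OF al]]]
  note iff1 = lifts_postcomp_iff[OF al h2] and iff2 = lifts_postcomp_iff[OF nu h1] and iff3 = lifts_precomp_iff[OF mui h]
  note defs = S12_def S23_def PO_def q1_def q2_def s1_def s2_def t2_def t3_def r_def p23_def p12_def p3_def
    Q1_def Q2_def Q3_def A12_def A23_def
  have x: "etAss (E_ext B H1 T1) S1 S2 S3 (lft P1) (lft P2) (lft P3) \<in> hom (Fib H1 PO)
      (lft (ten PO (gpb p12 A12) Q3)) (lft (gpb r (ten (prd B S1 S23) (gpb s1 P1) (gpb s2 A23))))"
    "etAss (E_ext B H2 T2) S1 S2 S3 (rgt P1) (rgt P2) (rgt P3) \<in> hom (Fib H2 PO)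
      (rgt (ten PO (gpb p12 A12) Q3)) (rgt (gpb r (ten (prd B S1 S23) (gpb s1 P1) (gpb s2 A23))))"
    using h3 by (simp_all add: E_ext_def E_ass_def Let_def defs)
  have I: "lifts PO (ten PO (gpb p12 A12) Q3) (gpb r (ten (prd B S1 S23) (gpb s1 P1) (gpb s2 A23)))
      (etAss (E_ext B H1 T1) S1 S2 S3 (lft P1) (lft P2) (lft P3))
      (etAss (E_ext B H2 T2) S1 S2 S3 (rgt P1) (rgt P2) (rgt P3)) \<longleftrightarrow> lifts_ass PO Q1 Q2 Q3"
    unfolding lifts_ass_def
    using iff1 iff2 iff3 by (simp add: E_ext_def E_ass_def Let_def defs)
  note el = glued_iso_comp[OF iso_ext[OF O12 S(3) iso_e[OF S(1,2) P(1,2), folded S12_def q1_def q2_def, folded A12_def] glued_iso_id[OF P(3)]]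
      iso_e[OF O12 S(3) A12 P(3)]]
  note er1 = glued_iso_pb[OF r(1) iso_ext[OF S(1) O23 glued_iso_id[OF P(1)] iso_e[OF S(2,3) P(2,3), folded S23_def t2_def t3_def, folded A23_def]]]
    and er2 = glued_iso_pb[OF r(1) iso_e[OF S(1) O23 P(1) A23]]
  have y: "etAss X1 S1 S2 S3 (lft P1) (lft P2) (lft P3) \<in> hom (Fib H1 PO)
      (lft (ext S12 S3 (ext S1 S2 P1 P2) P3)) (lft (gpb r (ext S1 S23 P1 (ext S2 S3 P2 P3))))"
    "etAss X2 S1 S2 S3 (rgt P1) (rgt P2) (rgt P3) \<in> hom (Fib H2 PO)
      (rgt (ext S12 S3 (ext S1 S2 P1 P2) P3)) (rgt (gpb r (ext S1 S23 P1 (ext S2 S3 P2 P3))))"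
    using iso_hom[OF E1.X.associative_iso[OF associative(3) S a(2) b(2) c(2)]]
      iso_hom[OF E2.X.associative_iso[OF associative(4) S a(3) b(3) c(3)]] by (simp_all add: defs)
  note ass = D1.comp_assoc[OF y(1)] D2.comp_assoc[OF y(2)]
  have rh: "pbA H1 r (etA X1 S1 S23 (Idm (Fib H1 S1) (lft P1)) (e1 S2 S3 (lft P2) (lft P3))) \<in> hom (Fib H1 PO)
      (lft (gpb r (ext S1 S23 P1 (ext S2 S3 P2 P3)))) (lft (gpb r (ext S1 S23 P1 A23)))"
    "pbA H2 r (etA X2 S1 S23 (Idm (Fib H2 S1) (rgt P1)) (e2 S2 S3 (rgt P2) (rgt P3))) \<in> hom (Fib H2 PO)
      (rgt (gpb r (ext S1 S23 P1 (ext S2 S3 P2 P3)))) (rgt (gpb r (ext S1 S23 P1 A23)))"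
    "pbA H1 r (e1 S1 S23 (lft P1) (lft A23)) \<in> hom (Fib H1 PO)
      (lft (gpb r (ext S1 S23 P1 A23))) (lft (gpb r (ten (prd B S1 S23) (gpb (prj1 B S1 S23) P1) (gpb (prj2 B S1 S23) A23))))"
    "pbA H2 r (e2 S1 S23 (rgt P1) (rgt A23)) \<in> hom (Fib H2 PO)
      (rgt (gpb r (ext S1 S23 P1 A23))) (rgt (gpb r (ten (prd B S1 S23) (gpb (prj1 B S1 S23) P1) (gpb (prj2 B S1 S23) A23))))"
    using iso_hom[OF glued_isoD(2)[OF er1]] iso_hom[OF glued_isoD(3)[OF er1]]
      iso_hom[OF glued_isoD(2)[OF er2]] iso_hom[OF glued_isoD(3)[OF er2]]
    by simp_all
  have E: "lifts PO (gprod PO (etO X1 S12 S3) (etO X2 S12 S3) (etA X2 S12 S3) (\<sigma> S12 S3)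
          (gprod S12 (etO X1 S1 S2) (etO X2 S1 S2) (etA X2 S1 S2) (\<sigma> S1 S2) P1 P2) P3)
        (gpb r (ext S1 S23 P1 (gprod S23 (etO X1 S2 S3) (etO X2 S2 S3) (etA X2 S2 S3) (\<sigma> S2 S3) P2 P3)))
        (etAss X1 S1 S2 S3 (lft P1) (lft P2) (lft P3)) (etAss X2 S1 S2 S3 (rgt P1) (rgt P2) (rgt P3))
      \<longleftrightarrow> lifts PO (ten PO (gpb p12 A12) Q3) (gpb r (ten (prd B S1 S23) (gpb s1 P1) (gpb s2 A23)))
        (etAss (E_ext B H1 T1) S1 S2 S3 (lft P1) (lft P2) (lft P3))
        (etAss (E_ext B H2 T2) S1 S2 S3 (rgt P1) (rgt P2) (rgt P3))"
  proof (rule lifts_square_iff)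
    show "glued_iso PO (gprod PO (etO X1 S12 S3) (etO X2 S12 S3) (etA X2 S12 S3) (\<sigma> S12 S3)
          (gprod S12 (etO X1 S1 S2) (etO X2 S1 S2) (etA X2 S1 S2) (\<sigma> S1 S2) P1 P2) P3)
        (ten PO (gpb p12 A12) Q3)
        (e1 S12 S3 (lft A12) (lft P3) \<cdot>\<^bsub>Fib H1 PO\<^esub> etA X1 S12 S3 (e1 S1 S2 (lft P1) (lft P2)) (Idm (Fib H1 S3) (lft P3)))
        (e2 S12 S3 (rgt A12) (rgt P3) \<cdot>\<^bsub>Fib H2 PO\<^esub> etA X2 S12 S3 (e2 S1 S2 (rgt P1) (rgt P2)) (Idm (Fib H2 S3) (rgt P3)))"
      using el by (simp add: defs)
    show "glued_iso PO (gpb r (ext S1 S23 P1 (gprod S23 (etO X1 S2 S3) (etO X2 S2 S3) (etA X2 S2 S3) (\<sigma> S2 S3) P2 P3)))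
        (gpb r (ten (prd B S1 S23) (gpb s1 P1) (gpb s2 A23)))
        (pbA H1 r (e1 S1 S23 (lft P1) (lft A23)) \<cdot>\<^bsub>Fib H1 PO\<^esub>
          pbA H1 r (etA X1 S1 S23 (Idm (Fib H1 S1) (lft P1)) (e1 S2 S3 (lft P2) (lft P3))))
        (pbA H2 r (e2 S1 S23 (rgt P1) (rgt A23)) \<cdot>\<^bsub>Fib H2 PO\<^esub>
          pbA H2 r (etA X2 S1 S23 (Idm (Fib H2 S1) (rgt P1)) (e2 S2 S3 (rgt P2) (rgt P3))))"
      using glued_iso_comp[OF er1 er2] by (simp add: defs)
  qed (use x y e1_ass[OF S a(2) b(2) c(2)] e2_ass[OF S a(3) b(3) c(3)]
      ass(1)[OF rh(1,3)] ass(2)[OF rh(2,4)] in \<open>simp_all add: E_ext_def defs\<close>)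
  show ?thesis using I E by (simp add: lifts_eass_def defs)
qed

lemma ass_base_iff:
  assumes S: "S \<in> Obj B" and A: "A1 \<in> Obj (Fib H1 S)" "A2 \<in> Obj (Fib H1 S)" "A3 \<in> Obj (Fib H1 S)"
  shows "lifts_ass S (gbase S A1) (gbase S A2) (gbase S A3) \<longleftrightarrow>
    morA R S (itAss T1 S A1 A2 A3) \<cdot>\<^bsub>Fib H2 S\<^esub> \<rho> S (itO T1 S A1 A2) A3
        \<cdot>\<^bsub>Fib H2 S\<^esub> itA T2 S (\<rho> S A1 A2) (Idm (Fib H2 S) (morO R S A3))
      = \<rho> S A1 (itO T1 S A2 A3) \<cdot>\<^bsub>Fib H2 S\<^esub> itA T2 S (Idm (Fib H2 S) (morO R S A1)) (\<rho> S A2 A3)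
        \<cdot>\<^bsub>Fib H2 S\<^esub> itAss T2 S (morO R S A1) (morO R S A2) (morO R S A3)"
proof -
  interpret D: category "Fib H2 S" by (rule H2.fib_category[OF S])
  note g = glued_base[OF S A(1)] glued_base[OF S A(2)] glued_base[OF S A(3)]
  note h = ass_hom[OF g]
  note RA = mor_obj[OF S A(1)] mor_obj[OF S A(2)] mor_obj[OF S A(3)]
  note \<rho>h = iso_hom[OF \<rho>_iso[OF S]]
  note r = \<rho>h[OF A(1) glued_objD(2)[OF glued_ten[OF S g(2,3)]]]
  note t = E2.T.ten_hom[OF S D.id_hom[OF RA(1)] \<rho>h[OF A(2,3)]]
  have cl: "cmpr (ten S (ten S (gbase S A1) (gbase S A2)) (gbase S A3))
      = \<rho> S (itO T1 S A1 A2) A3 \<cdot>\<^bsub>Fib H2 S\<^esub> itA T2 S (\<rho> S A1 A2) (Idm (Fib H2 S) (morO R S A3))"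
    using cmpr_ten_base[OF S A(1,2)]
    by (simp add: cmpr_gprod[of S _ _ _ _ "ten S (gbase S A1) (gbase S A2)"])
  have cr: "cmpr (ten S (gbase S A1) (ten S (gbase S A2) (gbase S A3)))
      = \<rho> S A1 (itO T1 S A2 A3) \<cdot>\<^bsub>Fib H2 S\<^esub> itA T2 S (Idm (Fib H2 S) (morO R S A1)) (\<rho> S A2 A3)"
    using cmpr_ten_base[OF S A(2,3)]
    by (simp add: cmpr_gprod[of S _ _ _ _ _ "ten S (gbase S A2) (gbase S A3)"])
  show ?thesis
    unfolding lifts_ass_def
    using lifts_iff[OF glued_ten[OF S glued_ten[OF S g(1,2)] g(3)] glued_ten[OF S g(1) glued_ten[OF S g(2,3)]] h] cl cr
      D.comp_assoc[OF h(2)[unfolded gprod_simps gbase_simps] t r[unfolded gprod_simps gbase_simps]]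
    by auto
qed

lemma eass_base_iff:
  assumes S: "S1 \<in> Obj B" "S2 \<in> Obj B" "S3 \<in> Obj B"
    and A: "A1 \<in> Obj (Fib H1 S1)" "A2 \<in> Obj (Fib H1 S2)" "A3 \<in> Obj (Fib H1 S3)"
  defines "P \<equiv> prd B (prd B S1 S2) S3" and "D \<equiv> Fib H2 (prd B (prd B S1 S2) S3)" and "r \<equiv> reassoc B S1 S2 S3"
  shows "lifts_eass S1 S2 S3 (gbase S1 A1) (gbase S2 A2) (gbase S3 A3) \<longleftrightarrow>
    morA R P (etAss X1 S1 S2 S3 A1 A2 A3) \<cdot>\<^bsub>D\<^esub> \<sigma> (prd B S1 S2) S3 (etO X1 S1 S2 A1 A2) A3
        \<cdot>\<^bsub>D\<^esub> etA X2 (prd B S1 S2) S3 (\<sigma> S1 S2 A1 A2) (Idm (Fib H2 S3) (morO R S3 A3))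
      = theta R r (etO X1 S1 (prd B S2 S3) A1 (etO X1 S2 S3 A2 A3))
        \<cdot>\<^bsub>D\<^esub> pbA H2 r (\<sigma> S1 (prd B S2 S3) A1 (etO X1 S2 S3 A2 A3))
        \<cdot>\<^bsub>D\<^esub> pbA H2 r (etA X2 S1 (prd B S2 S3) (Idm (Fib H2 S1) (morO R S1 A1)) (\<sigma> S2 S3 A2 A3))
        \<cdot>\<^bsub>D\<^esub> etAss X2 S1 S2 S3 (morO R S1 A1) (morO R S2 A2) (morO R S3 A3)"
proof -
  note r = H1.reassoc(1)[OF S, folded r_def P_def]
  note O12 = H1.prd_obj[OF S(1,2)] and O23 = H1.prd_obj[OF S(2,3)]
  note PO = H1.hom_obj(1)[OF r]
  interpret D: category D unfolding D_def by (rule H2.fib_category[OF PO[unfolded P_def]])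
  interpret F: category "Fib H2 S1" by (rule H2.fib_category[OF S(1)])
  interpret G: category "Fib H2 (prd B S1 (prd B S2 S3))" by (rule H2.fib_category[OF H1.hom_obj(2)[OF r]])
  note g = glued_base[OF S(1) A(1)] glued_base[OF S(2) A(2)] glued_base[OF S(3) A(3)]
  note RA = mor_obj[OF S(1) A(1)] mor_obj[OF S(2) A(2)] mor_obj[OF S(3) A(3)]
  note g23 = glued_ext[OF S(2,3) g(2,3)]
  note A23 = glued_objD(2)[OF g23, unfolded gprod_simps gbase_simps]
  note s1 = iso_hom[OF \<sigma>_iso[OF S(1) O23 A(1) A23]]
  note s2 = iso_hom[OF \<sigma>_iso[OF S(2,3) A(2,3)]]
  note t = E2.X.ext_hom[OF S(1) O23 F.id_hom[OF RA(1)] s2]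
  note gl = glued_ext[OF O12 S(3) glued_ext[OF S(1,2) g(1,2)] g(3)] and gr = glued_ext[OF S(1) O23 g(1) g23]
  note th = iso_hom[OF theta_iso[OF r glued_objD(2)[OF gr]], unfolded gprod_simps gbase_simps]
  note y1 = iso_hom[OF E1.X.associative_iso[OF associative(3) S A]]
    and y2 = iso_hom[OF E2.X.associative_iso[OF associative(4) S RA]]
  note f1 = H2.pb_hom[OF r s1] and f2 = H2.pb_hom[OF r t]
  have P: "P = prd B (prd B S1 S2) S3" "Fib H2 P = D" by (simp_all add: P_def D_def)
  have cl: "cmpr (ext (prd B S1 S2) S3 (ext S1 S2 (gbase S1 A1) (gbase S2 A2)) (gbase S3 A3))
      = \<sigma> (prd B S1 S2) S3 (etO X1 S1 S2 A1 A2) A3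
        \<cdot>\<^bsub>D\<^esub> etA X2 (prd B S1 S2) S3 (\<sigma> S1 S2 A1 A2) (Idm (Fib H2 S3) (morO R S3 A3))"
    unfolding cmpr_gprod[of "prd B (prd B S1 S2) S3"] cmpr_ext_base[OF S(1,2) A(1,2)] by (simp add: D_def)
  have cr: "cmpr (ext S1 (prd B S2 S3) (gbase S1 A1) (ext S2 S3 (gbase S2 A2) (gbase S3 A3)))
      = \<sigma> S1 (prd B S2 S3) A1 (etO X1 S2 S3 A2 A3)
        \<cdot>\<^bsub>Fib H2 (prd B S1 (prd B S2 S3))\<^esub> etA X2 S1 (prd B S2 S3) (Idm (Fib H2 S1) (morO R S1 A1)) (\<sigma> S2 S3 A2 A3)"
    unfolding cmpr_gprod[of "prd B S1 (prd B S2 S3)"] cmpr_ext_base[OF S(2,3) A(2,3)] by simp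
  have "lifts_eass S1 S2 S3 (gbase S1 A1) (gbase S2 A2) (gbase S3 A3) \<longleftrightarrow>
      (theta R r (etO X1 S1 (prd B S2 S3) A1 (etO X1 S2 S3 A2 A3))
        \<cdot>\<^bsub>D\<^esub> pbA H2 r (\<sigma> S1 (prd B S2 S3) A1 (etO X1 S2 S3 A2 A3))
        \<cdot>\<^bsub>D\<^esub> pbA H2 r (etA X2 S1 (prd B S2 S3) (Idm (Fib H2 S1) (morO R S1 A1)) (\<sigma> S2 S3 A2 A3)))
        \<cdot>\<^bsub>D\<^esub> etAss X2 S1 S2 S3 (morO R S1 A1) (morO R S2 A2) (morO R S3 A3)
      = morA R P (etAss X1 S1 S2 S3 A1 A2 A3) \<cdot>\<^bsub>D\<^esub> \<sigma> (prd B S1 S2) S3 (etO X1 S1 S2 A1 A2) A3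
        \<cdot>\<^bsub>D\<^esub> etA X2 (prd B S1 S2) S3 (\<sigma> S1 S2 A1 A2) (Idm (Fib H2 S3) (morO R S3 A3))"
    unfolding lifts_eass_def
    using lifts_iff[OF gl glued_pb[OF r[unfolded P(1)] gr]] y1 y2 H2.pb_comp[OF r t s1] cl cr
    by (simp add: P r_def cmpr_gpb[OF r[unfolded P(1)], unfolded r_def] D_def[symmetric])
  then show ?thesis
    using D.comp_assoc[OF y2[folded D_def r_def] D.comp_hom[OF f2[unfolded P(2)] f1[unfolded P(2)]] th[unfolded P(2)]]
      D.comp_assoc[OF y2[folded D_def r_def] f2[unfolded P(2)] f1[unfolded P(2)]]
    by (auto simp: r_def)
qed

text \<open>The argument is that of \<open>symmetric_iff\<close>, with the threefold diagonal \<open>S \<rightarrow> (S \<times> S) \<times> S\<close>.\<close>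

lemma associative_iff:
  "(\<forall>S \<in> Obj B. \<forall>A1 \<in> Obj (Fib H1 S). \<forall>A2 \<in> Obj (Fib H1 S). \<forall>A3 \<in> Obj (Fib H1 S).
      lifts_ass S (gbase S A1) (gbase S A2) (gbase S A3))
    \<longleftrightarrow> (\<forall>S1 \<in> Obj B. \<forall>S2 \<in> Obj B. \<forall>S3 \<in> Obj B.
      \<forall>A1 \<in> Obj (Fib H1 S1). \<forall>A2 \<in> Obj (Fib H1 S2). \<forall>A3 \<in> Obj (Fib H1 S3).
      lifts_eass S1 S2 S3 (gbase S1 A1) (gbase S2 A2) (gbase S3 A3))" (is "?I \<longleftrightarrow> ?E")
proof
  assume I: ?I
  show ?E
  proof (intro ballI)
    fix S1 S2 S3 A1 A2 A3
    assume S: "S1 \<in> Obj B" "S2 \<in> Obj B" "S3 \<in> Obj B"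
      and A: "A1 \<in> Obj (Fib H1 S1)" "A2 \<in> Obj (Fib H1 S2)" "A3 \<in> Obj (Fib H1 S3)"
    note g = glued_base[OF S(1) A(1)] glued_base[OF S(2) A(2)] glued_base[OF S(3) A(3)]
    note O12 = H1.prd_obj[OF S(1,2)]
    note p12 = H1.prj1_hom[OF O12 S(3)]
    note p = glued_pb[OF H1.comp_hom[OF p12 H1.prj1_hom[OF S(1,2)]] g(1)]
      glued_pb[OF H1.comp_hom[OF p12 H1.prj2_hom[OF S(1,2)]] g(2)] glued_pb[OF H1.prj2_hom[OF O12 S(3)] g(3)]
    show "lifts_eass S1 S2 S3 (gbase S1 A1) (gbase S2 A2) (gbase S3 A3)"
      using eass_iff[OF S g] ass_transport[OF glued_iso_base[OF p(1)] glued_iso_base[OF p(2)] glued_iso_base[OF p(3)]]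
        I glued_objD[OF p(1)] glued_objD[OF p(2)] glued_objD[OF p(3)] by simp
  qed
next
  assume E: ?E
  show ?I
  proof (intro ballI)
    fix S A1 A2 A3
    assume S: "S \<in> Obj B"
      and A: "A1 \<in> Obj (Fib H1 S)" "A2 \<in> Obj (Fib H1 S)" "A3 \<in> Obj (Fib H1 S)"
    note g = glued_base[OF S A(1)] glued_base[OF S A(2)] glued_base[OF S A(3)]
    note SS = H1.prd_obj[OF S S] and d = H1.diag[OF S]
    \<comment> \<open>the threefold diagonal\<close>
    define d3 where "d3 = tuple B (diag B S) (Idm B S)"
    note d3 = H1.tuple[OF d(1) H1.id_hom[OF S], folded d3_def]
    note p12 = H1.prj1_hom[OF SS S]
    note q1 = H1.prj1_hom[OF S S] and q2 = H1.prj2_hom[OF S S]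
    note p1 = H1.comp_hom[OF p12 q1] and p2 = H1.comp_hom[OF p12 q2] and p3 = H1.prj2_hom[OF SS S]
    have e: "(prj1 B S S \<cdot>\<^bsub>B\<^esub> prj1 B (prd B S S) S) \<cdot>\<^bsub>B\<^esub> d3 = Idm B S"
      "(prj2 B S S \<cdot>\<^bsub>B\<^esub> prj1 B (prd B S S) S) \<cdot>\<^bsub>B\<^esub> d3 = Idm B S"
      using H1.comp_assoc[OF d3(1) p12 q1] H1.comp_assoc[OF d3(1) p12 q2] d d3 by simp_all
    note r = glued_iso_retract[OF d3(1) p1 e(1) g(1)]
      glued_iso_retract[OF d3(1) p2 e(2) g(2)] glued_iso_retract[OF d3(1) p3 d3(3) g(3)]
    show "lifts_ass S (gbase S A1) (gbase S A2) (gbase S A3)"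
      using ass_pullback[OF d3(1) glued_pb[OF p1 g(1)] glued_pb[OF p2 g(2)] glued_pb[OF p3 g(3)]]
        eass_iff[OF S S S g] E S A ass_transport[OF r] by simp
  qed
qed

end


section \<open>The two constructions are mutually inverse\<close>

context equivalent_tensors
begin

definition int_monoidal :: "('o \<Rightarrow> 'x1 \<Rightarrow> 'x1 \<Rightarrow> 'h2) \<Rightarrow> bool" where
  "int_monoidal \<rho> \<longleftrightarrow> (\<forall>T S. \<forall>f \<in> hom B T S. \<forall>A \<in> Obj (Fib H1 S). \<forall>A' \<in> Obj (Fib H1 S).
        theta R f (itO T1 S A A')
            \<cdot>\<^bsub>Fib H2 T\<^esub> pbA H2 f (\<rho> S A A')
            \<cdot>\<^bsub>Fib H2 T\<^esub> itM T2 f (morO R S A) (morO R S A')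
          = morA R T (itM T1 f A A')
              \<cdot>\<^bsub>Fib H2 T\<^esub> \<rho> T (pbO H1 f A) (pbO H1 f A')
              \<cdot>\<^bsub>Fib H2 T\<^esub> itA T2 T (theta R f A) (theta R f A'))"

definition ext_monoidal :: "('o \<Rightarrow> 'o \<Rightarrow> 'x1 \<Rightarrow> 'x1 \<Rightarrow> 'h2) \<Rightarrow> bool" where
  "ext_monoidal \<sigma> \<longleftrightarrow> (\<forall>U1 S1 U2 S2. \<forall>f1 \<in> hom B U1 S1. \<forall>f2 \<in> hom B U2 S2.
      \<forall>A1 \<in> Obj (Fib H1 S1). \<forall>A2 \<in> Obj (Fib H1 S2).
        theta R (cross B f1 f2) (etO X1 S1 S2 A1 A2)
             \<cdot>\<^bsub>Fib H2 (prd B U1 U2)\<^esub> pbA H2 (cross B f1 f2) (\<sigma> S1 S2 A1 A2)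
             \<cdot>\<^bsub>Fib H2 (prd B U1 U2)\<^esub> etM X2 f1 f2 (morO R S1 A1) (morO R S2 A2)
           = morA R (prd B U1 U2) (etM X1 f1 f2 A1 A2)
             \<cdot>\<^bsub>Fib H2 (prd B U1 U2)\<^esub> \<sigma> U1 U2 (pbO H1 f1 A1) (pbO H1 f2 A2)
             \<cdot>\<^bsub>Fib H2 (prd B U1 U2)\<^esub> etA X2 U1 U2 (theta R f1 A1) (theta R f2 A2))"

lemma lifts_itM_iff:
  assumes n: "int_natural \<rho>" and f: "f \<in> hom B T S" and A: "A \<in> Obj (Fib H1 S)" "A' \<in> Obj (Fib H1 S)"
  shows "lifts T (gten \<rho> T (gpb f (gbase S A)) (gpb f (gbase S A'))) (gpb f (gten \<rho> S (gbase S A) (gbase S A')))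
       (itM T1 f A A') (itM T2 f (morO R S A) (morO R S A'))
    \<longleftrightarrow> theta R f (itO T1 S A A')
            \<cdot>\<^bsub>Fib H2 T\<^esub> pbA H2 f (\<rho> S A A')
            \<cdot>\<^bsub>Fib H2 T\<^esub> itM T2 f (morO R S A) (morO R S A')
          = morA R T (itM T1 f A A')
              \<cdot>\<^bsub>Fib H2 T\<^esub> \<rho> T (pbO H1 f A) (pbO H1 f A')
              \<cdot>\<^bsub>Fib H2 T\<^esub> itA T2 T (theta R f A) (theta R f A')"
proof -
  note T = H1.hom_obj(1)[OF f] and S = H1.hom_obj(2)[OF f]
  interpret D: category "Fib H2 T" by (rule H2.fib_category[OF T])
  interpret G: glued_bifunctor B H1 H2 R S S S "itO T1 S" "itA T1 S" "itO T2 S" "itA T2 S" "\<rho> S"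
    by (rule int_bifunctor[OF n S])
  interpret G': glued_bifunctor B H1 H2 R T T T "itO T1 T" "itA T1 T" "itO T2 T" "itA T2 T" "\<rho> T"
    by (rule int_bifunctor[OF n T])
  note g = glued_base[OF S A(1)] glued_base[OF S A(2)] and RA = mor_obj[OF S A(1)] mor_obj[OF S A(2)]
  note m1 = iso_hom[OF E1.T.mon_iso[OF f A]] and m2 = iso_hom[OF E2.T.mon_iso[OF f RA]]
  note r = H2.pb_hom[OF f iso_hom[OF G.\<eta>_iso[OF A]]] and t = iso_hom[OF theta_iso[OF f G.F1.obj[OF A]]]
  show ?thesis
    using lifts_iff[OF G'.glued[OF glued_pb[OF f g(1)] glued_pb[OF f g(2)]] glued_pb[OF f G.glued[OF g]]] m1 m2
      D.comp_assoc[OF m2 r t] G.cmpr_base[OF A]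
    by (simp add: cmpr_gpb[OF f, of "gprod _ _ _ _ _ _ _"] cmpr_gpb_base[OF f]
        cmpr_gprod[of T _ _ _ _ "gpb f (gbase S A)"] A)
qed

lemma lifts_etM_iff:
  assumes n: "ext_natural \<sigma>" and f: "f1 \<in> hom B U1 S1" "f2 \<in> hom B U2 S2"
    and A: "A1 \<in> Obj (Fib H1 S1)" "A2 \<in> Obj (Fib H1 S2)"
  shows "lifts (prd B U1 U2) (gext \<sigma> U1 U2 (gpb f1 (gbase S1 A1)) (gpb f2 (gbase S2 A2)))
         (gpb (cross B f1 f2) (gext \<sigma> S1 S2 (gbase S1 A1) (gbase S2 A2)))
         (etM X1 f1 f2 A1 A2) (etM X2 f1 f2 (morO R S1 A1) (morO R S2 A2))
      \<longleftrightarrow> theta R (cross B f1 f2) (etO X1 S1 S2 A1 A2)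
             \<cdot>\<^bsub>Fib H2 (prd B U1 U2)\<^esub> pbA H2 (cross B f1 f2) (\<sigma> S1 S2 A1 A2)
             \<cdot>\<^bsub>Fib H2 (prd B U1 U2)\<^esub> etM X2 f1 f2 (morO R S1 A1) (morO R S2 A2)
           = morA R (prd B U1 U2) (etM X1 f1 f2 A1 A2)
             \<cdot>\<^bsub>Fib H2 (prd B U1 U2)\<^esub> \<sigma> U1 U2 (pbO H1 f1 A1) (pbO H1 f2 A2)
             \<cdot>\<^bsub>Fib H2 (prd B U1 U2)\<^esub> etA X2 U1 U2 (theta R f1 A1) (theta R f2 A2)"
proof -
  note U = H1.hom_obj(1)[OF f(1)] H1.hom_obj(1)[OF f(2)] and S = H1.hom_obj(2)[OF f(1)] H1.hom_obj(2)[OF f(2)]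
  note c = H1.cross(1)[OF f]
  interpret D: category "Fib H2 (prd B U1 U2)" by (rule H2.fib_category[OF H1.prd_obj[OF U]])
  interpret G: glued_bifunctor B H1 H2 R S1 S2 "prd B S1 S2" "etO X1 S1 S2" "etA X1 S1 S2" "etO X2 S1 S2"
    "etA X2 S1 S2" "\<sigma> S1 S2"
    by (rule ext_bifunctor[OF n S])
  interpret G': glued_bifunctor B H1 H2 R U1 U2 "prd B U1 U2" "etO X1 U1 U2" "etA X1 U1 U2" "etO X2 U1 U2"
    "etA X2 U1 U2" "\<sigma> U1 U2"
    by (rule ext_bifunctor[OF n U])
  note g = glued_base[OF S(1) A(1)] glued_base[OF S(2) A(2)] and RA = mor_obj[OF S(1) A(1)] mor_obj[OF S(2) A(2)]
  note m1 = iso_hom[OF E1.X.emon_iso[OF f A]] and m2 = iso_hom[OF E2.X.emon_iso[OF f RA]]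
  note r = H2.pb_hom[OF c iso_hom[OF G.\<eta>_iso[OF A]]] and t = iso_hom[OF theta_iso[OF c G.F1.obj[OF A]]]
  show ?thesis
    using lifts_iff[OF G'.glued[OF glued_pb[OF f(1) g(1)] glued_pb[OF f(2) g(2)]] glued_pb[OF c G.glued[OF g]]] m1 m2
      D.comp_assoc[OF m2 r t] G.cmpr_base[OF A]
    by (simp add: cmpr_gpb[OF c] cmpr_gpb_base[OF f(1)] cmpr_gpb_base[OF f(2)]
        cmpr_gprod[of _ _ _ _ _ "gpb f1 (gbase S1 A1)"] A)
qed

context
  fixes \<rho> \<sigma>
  assumes n: "int_natural \<rho>"
  defines "\<sigma> \<equiv> to_external B H1 H2 R T2 e1 e2 \<rho>"
begin

text \<open>The first glued object is \<open>A1 \<boxtimes> A2\<close> with third component \<open>\<sigma>\<close>. It is written out because \<open>\<sigma>\<close> is not yet known to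
  be natural, so that \<open>gext\<close> cannot be used.\<close>

lemma to_external_iso:
  assumes S: "S1 \<in> Obj B" "S2 \<in> Obj B" and A: "A1 \<in> Obj (Fib H1 S1)" "A2 \<in> Obj (Fib H1 S2)"
  shows "glued_iso (prd B S1 S2) (Glued (etO X1 S1 S2 A1 A2) (etO X2 S1 S2 (morO R S1 A1) (morO R S2 A2)) (\<sigma> S1 S2 A1 A2))
    (gten \<rho> (prd B S1 S2) (gpb (prj1 B S1 S2) (gbase S1 A1)) (gpb (prj2 B S1 S2) (gbase S2 A2)))
    (e1 S1 S2 A1 A2) (e2 S1 S2 (morO R S1 A1) (morO R S2 A2))"
proof -
  define P q1 q2 where "P = prd B S1 S2" and "q1 = prj1 B S1 S2" and "q2 = prj2 B S1 S2"
  note P = H1.prd_obj[OF S, folded P_def] and q1 = H1.prj1_hom[OF S, folded P_def q1_def]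
    and q2 = H1.prj2_hom[OF S, folded P_def q2_def]
  note RA = mor_obj[OF S(1) A(1)] mor_obj[OF S(2) A(2)]
  interpret D: category "Fib H2 P" by (rule H2.fib_category[OF P])
  interpret G: glued_bifunctor B H1 H2 R P P P "itO T1 P" "itA T1 P" "itO T2 P" "itA T2 P" "\<rho> P"
    by (rule int_bifunctor[OF n P])
  note g = G.glued[OF glued_pb[OF q1 glued_base[OF S(1) A(1)]] glued_pb[OF q2 glued_base[OF S(2) A(2)]]]
  note E1 = E1.e_iso[OF S A, folded P_def q1_def q2_def] and E2 = E2.e_iso[OF S RA, folded P_def q1_def q2_def]
  note qA = H1.pb_obj[OF q1 A(1)] H1.pb_obj[OF q2 A(2)]
  note a = D.comp_assoc[OF iso_hom[OF E2] E2.T.ten_hom[OF P iso_hom[OF theta_iso[OF q1 A(1)]] iso_hom[OF theta_iso[OF q2 A(2)]]]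
      iso_hom[OF G.\<eta>_iso[OF qA]]]
  show ?thesis
    using glued_iso_along[OF g, of "e1 S1 S2 A1 A2" "etO X1 S1 S2 A1 A2" "e2 S1 S2 (morO R S1 A1) (morO R S2 A2)"
        "etO X2 S1 S2 (morO R S1 A1) (morO R S2 A2)"] E1 E2 S A a
    by (simp add: \<sigma>_def to_external_def Let_def cmpr_gprod cmpr_gpb_base[OF q1] cmpr_gpb_base[OF q2]
        P_def[symmetric] q1_def[symmetric] q2_def[symmetric])
qed

text \<open>That \<open>u1 \<boxtimes> u2\<close> lifts is the naturality square of \<open>\<sigma>\<close>. It lifts since it is conjugate, under \<open>e\<close>, to \<open>q\<^sub>1\<^sup>*u1 \<otimes> q\<^sub>2\<^sup>*u2\<close>.\<close>

lemma to_external_natural: "ext_natural \<sigma>"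
  unfolding ext_natural_def bifunctor_natural_iso_iff
proof (intro ballI conjI allI impI)
  fix S1 S2 A1 A2
  assume "S1 \<in> Obj B" "S2 \<in> Obj B" "A1 \<in> Obj (Fib H1 S1)" "A2 \<in> Obj (Fib H1 S2)"
  from glued_objD(4)[OF glued_iso_obj(2)[OF to_external_iso[OF this]]]
  show "\<sigma> S1 S2 A1 A2 \<in> iso (Fib H2 (prd B S1 S2)) (etO X2 S1 S2 (morO R S1 A1) (morO R S2 A2))
      (morO R (prd B S1 S2) (etO X1 S1 S2 A1 A2))" by simp
next
  fix S1 S2 X Y X' Y' h k
  assume S: "S1 \<in> Obj B" "S2 \<in> Obj B" and u: "h \<in> hom (Fib H1 S1) X Y" "k \<in> hom (Fib H1 S2) X' Y'"
  interpret D1: category "Fib H1 S1" by (rule H1.fib_category[OF S(1)])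
  interpret D2: category "Fib H1 S2" by (rule H1.fib_category[OF S(2)])
  note A = D1.hom_obj(1)[OF u(1)] D2.hom_obj(1)[OF u(2)] and A' = D1.hom_obj(2)[OF u(1)] D2.hom_obj(2)[OF u(2)]
  note P = H1.prd_obj[OF S]
  note q = H1.prj1_hom[OF S] H1.prj2_hom[OF S]
  note Ru = mor_hom[OF S(1) u(1)] mor_hom[OF S(2) u(2)]
  interpret G: glued_bifunctor B H1 H2 R "prd B S1 S2" "prd B S1 S2" "prd B S1 S2" "itO T1 (prd B S1 S2)" "itA T1 (prd B S1 S2)"
    "itO T2 (prd B S1 S2)" "itA T2 (prd B S1 S2)" "\<rho> (prd B S1 S2)"
    by (rule int_bifunctor[OF n P])
  have "lifts (prd B S1 S2) (Glued (etO X1 S1 S2 X X') (etO X2 S1 S2 (morO R S1 X) (morO R S2 X')) (\<sigma> S1 S2 X X'))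
      (Glued (etO X1 S1 S2 Y Y') (etO X2 S1 S2 (morO R S1 Y) (morO R S2 Y')) (\<sigma> S1 S2 Y Y'))
      (etA X1 S1 S2 h k) (etA X2 S1 S2 (morA R S1 h) (morA R S2 k))"
    using E1.X.ext_hom[OF S u] E2.X.ext_hom[OF S Ru]
      E1.e_square[OF S u] E2.e_square[OF S Ru]
    by (intro lifts_transport[OF G.lifts[OF lifts_pb[OF q(1) lifts_base[OF S(1) u(1)]] lifts_pb[OF q(2) lifts_base[OF S(2) u(2)]]]
          glued_isoD(1)[OF to_external_iso[OF S A]] to_external_iso[OF S A']]) simp_all
  from liftsD(5)[OF this]
  show "morA R (prd B S1 S2) (etA X1 S1 S2 h k) \<cdot>\<^bsub>Fib H2 (prd B S1 S2)\<^esub> \<sigma> S1 S2 X X'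
      = \<sigma> S1 S2 Y Y' \<cdot>\<^bsub>Fib H2 (prd B S1 S2)\<^esub> etA X2 S1 S2 (morA R S1 h) (morA R S2 k)" by simp
qed

lemma to_external_corresponding:
  assumes m: "int_monoidal \<rho>"
  shows "corresponding_structures B H1 H2 R T1 X1 e1 T2 X2 e2 \<rho> \<sigma>"
proof
  show "int_natural \<rho>" by (rule n)
  show "ext_natural \<sigma>" by (rule to_external_natural)
next
  fix f T S A A'
  assume "f \<in> hom B T S" "A \<in> Obj (Fib H1 S)" "A' \<in> Obj (Fib H1 S)"
  then show "lifts T (gten \<rho> T (gpb f (gbase S A)) (gpb f (gbase S A'))) (gpb f (gten \<rho> S (gbase S A) (gbase S A')))
      (itM T1 f A A') (itM T2 f (morO R S A) (morO R S A'))"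
    using m lifts_itM_iff[OF n] by (simp add: int_monoidal_def)
next
  fix S1 S2 A1 A2
  assume S: "S1 \<in> Obj B" "S2 \<in> Obj B" and A: "A1 \<in> Obj (Fib H1 S1)" "A2 \<in> Obj (Fib H1 S2)"
  have "gext \<sigma> S1 S2 (gbase S1 A1) (gbase S2 A2)
      = Glued (etO X1 S1 S2 A1 A2) (etO X2 S1 S2 (morO R S1 A1) (morO R S2 A2)) (\<sigma> S1 S2 A1 A2)"
    using glued_bifunctor.cmpr_base[OF ext_bifunctor[OF to_external_natural S] A] by (simp add: gprod_def)
  then show "lifts (prd B S1 S2) (gext \<sigma> S1 S2 (gbase S1 A1) (gbase S2 A2))
        (gten \<rho> (prd B S1 S2) (gpb (prj1 B S1 S2) (gbase S1 A1)) (gpb (prj2 B S1 S2) (gbase S2 A2)))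
        (e1 S1 S2 A1 A2) (e2 S1 S2 (morO R S1 A1) (morO R S2 A2))"
    using glued_isoD(1)[OF to_external_iso[OF S A]] by simp
qed

end

context
  fixes \<rho> \<sigma>
  assumes n: "ext_natural \<sigma>"
  defines "\<rho> \<equiv> to_internal B H1 H2 R T1 T2 X1 e1 e2 \<sigma>"
begin

lemma to_internal_iso:
  assumes S: "S \<in> Obj B" and A: "A \<in> Obj (Fib H1 S)" "A' \<in> Obj (Fib H1 S)"
  shows "glued_iso S (Glued (itO T1 S A A') (itO T2 S (morO R S A) (morO R S A')) (\<rho> S A A'))
    (gpb (diag B S) (gext \<sigma> S S (gbase S A) (gbase S A')))
    (diag_comparison B H1 T1 e1 S A A') (diag_comparison B H2 T2 e2 S (morO R S A) (morO R S A'))"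
proof -
  note d = H1.diag(1)[OF S] and RA = mor_obj[OF S A(1)] mor_obj[OF S A(2)]
  interpret D: category "Fib H2 S" by (rule H2.fib_category[OF S])
  interpret G: glued_bifunctor B H1 H2 R S S "prd B S S" "etO X1 S S" "etA X1 S S" "etO X2 S S" "etA X2 S S" "\<sigma> S S"
    by (rule ext_bifunctor[OF n S S])
  note g = glued_pb[OF d G.glued[OF glued_base[OF S A(1)] glued_base[OF S A(2)]]]
  note D1 = E1.diag_comparison_iso[OF S A] and D2 = E2.diag_comparison_iso[OF S RA]
  note a = D.comp_assoc[OF iso_hom[OF D2] H2.pb_hom[OF d iso_hom[OF G.\<eta>_iso[OF A]]] iso_hom[OF theta_iso[OF d G.F1.obj[OF A]]]]
  show ?thesis
    using glued_iso_along[OF g, of "diag_comparison B H1 T1 e1 S A A'" "itO T1 S A A'"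
        "diag_comparison B H2 T2 e2 S (morO R S A) (morO R S A')" "itO T2 S (morO R S A) (morO R S A')"]
      D1 D2 S A a
    by (simp add: \<rho>_def to_internal_def Let_def cmpr_gpb[OF d] G.cmpr_base)
qed

text \<open>As in \<open>to_external_natural\<close>, with the comparison along the diagonal in place of \<open>e\<close>.\<close>

lemma to_internal_natural: "int_natural \<rho>"
  unfolding int_natural_def bifunctor_natural_iso_iff
proof (intro ballI conjI allI impI)
  fix S A A'
  assume "S \<in> Obj B" "A \<in> Obj (Fib H1 S)" "A' \<in> Obj (Fib H1 S)"
  from glued_objD(4)[OF glued_iso_obj(2)[OF to_internal_iso[OF this]]]
  show "\<rho> S A A' \<in> iso (Fib H2 S) (itO T2 S (morO R S A) (morO R S A')) (morO R S (itO T1 S A A'))" by simp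
next
  fix S X Y X' Y' h k
  assume S: "S \<in> Obj B" and u: "h \<in> hom (Fib H1 S) X Y" "k \<in> hom (Fib H1 S) X' Y'"
  interpret D1: category "Fib H1 S" by (rule H1.fib_category[OF S])
  note A = D1.hom_obj(1)[OF u(1)] D1.hom_obj(1)[OF u(2)] and A' = D1.hom_obj(2)[OF u(1)] D1.hom_obj(2)[OF u(2)]
  note d = H1.diag(1)[OF S]
  note Ru = mor_hom[OF S u(1)] mor_hom[OF S u(2)]
  interpret G: glued_bifunctor B H1 H2 R S S "prd B S S" "etO X1 S S" "etA X1 S S" "etO X2 S S" "etA X2 S S" "\<sigma> S S"
    by (rule ext_bifunctor[OF n S S])
  have "lifts S (Glued (itO T1 S X X') (itO T2 S (morO R S X) (morO R S X')) (\<rho> S X X'))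
      (Glued (itO T1 S Y Y') (itO T2 S (morO R S Y) (morO R S Y')) (\<rho> S Y Y'))
      (itA T1 S h k) (itA T2 S (morA R S h) (morA R S k))"
    using E1.T.ten_hom[OF S u] E2.T.ten_hom[OF S Ru]
      E1.diag_comparison_square[OF S u] E2.diag_comparison_square[OF S Ru]
    by (intro lifts_transport[OF lifts_pb[OF d G.lifts[OF lifts_base[OF S u(1)] lifts_base[OF S u(2)]]]
          glued_isoD(1)[OF to_internal_iso[OF S A]] to_internal_iso[OF S A']]) simp_all
  from liftsD(5)[OF this]
  show "morA R S (itA T1 S h k) \<cdot>\<^bsub>Fib H2 S\<^esub> \<rho> S X X'
      = \<rho> S Y Y' \<cdot>\<^bsub>Fib H2 S\<^esub> itA T2 S (morA R S h) (morA R S k)" by simp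
qed

lemma to_internal_iso_glued:
  assumes P: "glued_obj S P" and Q: "glued_obj S Q"
  shows "glued_iso S (gten \<rho> S P Q) (gpb (diag B S) (gext \<sigma> S S P Q))
    (diag_comparison B H1 T1 e1 S (lft P) (lft Q)) (diag_comparison B H2 T2 e2 S (rgt P) (rgt Q))"
proof -
  note p = glued_objD[OF P] and q = glued_objD[OF Q]
  note S = p(1)
  note d = H1.diag(1)[OF S]
  interpret G: glued_bifunctor B H1 H2 R S S "prd B S S" "etO X1 S S" "etA X1 S S" "etO X2 S S" "etA X2 S S" "\<sigma> S S"
    by (rule ext_bifunctor[OF n S S])
  interpret I: glued_bifunctor B H1 H2 R S S S "itO T1 S" "itA T1 S" "itO T2 S" "itA T2 S" "\<rho> S"
    by (rule int_bifunctor[OF to_internal_natural S])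
  note lp = glued_iso_base[OF P] and lq = glued_iso_base[OF Q]
  note k1 = E1.diag_comparison_iso[OF S p(2) q(2)] and k2 = E2.diag_comparison_iso[OF S p(3) q(3)]
  have b: "gten \<rho> S (gbase S (lft P)) (gbase S (lft Q)) = Glued (itO T1 S (lft P) (lft Q))
      (itO T2 S (morO R S (lft P)) (morO R S (lft Q))) (\<rho> S (lft P) (lft Q))"
    using I.cmpr_base[OF p(2) q(2)] by (simp add: gprod_def)
  have "lifts S (gten \<rho> S P Q) (gpb (diag B S) (gext \<sigma> S S P Q))
      (diag_comparison B H1 T1 e1 S (lft P) (lft Q)) (diag_comparison B H2 T2 e2 S (rgt P) (rgt Q))"
    using iso_hom[OF k1] iso_hom[OF k2]
      E1.diag_comparison_square[OF S iso_hom[OF glued_isoD(2)[OF lp]] iso_hom[OF glued_isoD(2)[OF lq]]]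
      E2.diag_comparison_square[OF S iso_hom[OF glued_isoD(3)[OF lp]] iso_hom[OF glued_isoD(3)[OF lq]]]
    by (intro lifts_transport[OF glued_isoD(1)[OF to_internal_iso[OF S p(2) q(2), folded b]]
          glued_isoD(1)[OF I.glued_iso[OF lp lq]] glued_iso_pb[OF d G.glued_iso[OF lp lq]]]) simp_all
  then show ?thesis using k1 k2 by (simp add: glued_iso_def)
qed

text \<open>\<open>comparison_tuple\<close> applies because \<open>h\<close> is \<open>(q\<^sub>1h \<times> q\<^sub>2h) \<Delta>\<close>.\<close>

lemma to_internal_lifts_comparison:
  assumes m: "ext_monoidal \<sigma>"
    and S: "S1 \<in> Obj B" "S2 \<in> Obj B" and A: "A1 \<in> Obj (Fib H1 S1)" "A2 \<in> Obj (Fib H1 S2)"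
    and h: "h \<in> hom B U (prd B S1 S2)"
  shows "lifts U (gten \<rho> U (gpb (prj1 B S1 S2 \<cdot>\<^bsub>B\<^esub> h) (gbase S1 A1)) (gpb (prj2 B S1 S2 \<cdot>\<^bsub>B\<^esub> h) (gbase S2 A2)))
    (gpb h (gext \<sigma> S1 S2 (gbase S1 A1) (gbase S2 A2)))
    (comparison B H1 T1 e1 h S1 S2 A1 A2) (comparison B H2 T2 e2 h S1 S2 (morO R S1 A1) (morO R S2 A2))"
proof -
  define f1 f2 d where "f1 = prj1 B S1 S2 \<cdot>\<^bsub>B\<^esub> h" and "f2 = prj2 B S1 S2 \<cdot>\<^bsub>B\<^esub> h" and "d = diag B U"
  note U = H1.hom_obj(1)[OF h]
  note q = H1.prj1_hom[OF S] H1.prj2_hom[OF S]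
  note f1 = H1.comp_hom[OF h q(1), folded f1_def] and f2 = H1.comp_hom[OF h q(2), folded f2_def]
  note d = H1.diag[OF U, folded d_def]
  define c where "c = cross B f1 f2"
  note c = H1.cross[OF f1 f2, folded c_def]
  have cd: "c \<cdot>\<^bsub>B\<^esub> d = h"
    using H1.product_ext[OF H1.comp_hom[OF d(1) c(1)] h S] H1.comp_assoc[OF d(1) c(1) q(1)] H1.comp_assoc[OF d(1) c(1) q(2)]
      H1.comp_assoc[OF d(1) H1.prj1_hom[OF U U] f1] H1.comp_assoc[OF d(1) H1.prj2_hom[OF U U] f2]
      H1.id_right[OF f1] H1.id_right[OF f2] by (simp add: c d f1_def f2_def)
  note g = glued_base[OF S(1) A(1)] glued_base[OF S(2) A(2)] and RA = mor_obj[OF S(1) A(1)] mor_obj[OF S(2) A(2)]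
  note G = glued_bifunctor.glued[OF ext_bifunctor[OF n S] g]
  have em: "lifts (prd B U U) (gext \<sigma> U U (gpb f1 (gbase S1 A1)) (gpb f2 (gbase S2 A2)))
         (gpb c (gext \<sigma> S1 S2 (gbase S1 A1) (gbase S2 A2)))
         (etM X1 f1 f2 A1 A2) (etM X2 f1 f2 (morO R S1 A1) (morO R S2 A2))"
    using m lifts_etM_iff[OF n f1 f2 A] f1 f2 A by (simp add: ext_monoidal_def c_def)
  note l = lifts_comp[OF glued_isoD(1)[OF to_internal_iso_glued[OF glued_pb[OF f1 g(1)] glued_pb[OF f2 g(2)], folded d_def]] lifts_pb[OF d(1) em]]
  note k1 = E1.comparison_tuple[OF f1 f2 A, folded d_def c_def, unfolded cd]
    and k2 = E2.comparison_tuple[OF f1 f2 RA, folded d_def c_def, unfolded cd]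
  note j1 = iso_hom[OF E1.comparison_iso[OF S h A], folded f1_def f2_def]
    and j2 = iso_hom[OF E2.comparison_iso[OF S h RA], folded f1_def f2_def]
  have "lifts U (gten \<rho> U (gpb f1 (gbase S1 A1)) (gpb f2 (gbase S2 A2)))
      (gpb h (gext \<sigma> S1 S2 (gbase S1 A1) (gbase S2 A2)))
    (comparison B H1 T1 e1 h S1 S2 A1 A2) (comparison B H2 T2 e2 h S1 S2 (morO R S1 A1) (morO R S2 A2))"
    using l j1 j2 k1 k2
    by (subst lifts_postcomp_iff[OF glued_iso_conn[OF d(1) c(1) G, unfolded cd], symmetric]) simp_all
  then show ?thesis by (simp add: f1_def f2_def)
qed

text \<open>The monoidality isomorphism comes from the comparison along \<open>\<Delta> f\<close> by \<open>diag_comparison_pullback\<close>, the equivalence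
  \<open>e\<close> from the comparison along the identity by \<open>comparison_id\<close>.\<close>

lemma to_internal_corresponding:
  assumes m: "ext_monoidal \<sigma>"
  shows "corresponding_structures B H1 H2 R T1 X1 e1 T2 X2 e2 \<rho> \<sigma>"
proof
  show "int_natural \<rho>" by (rule to_internal_natural)
  show "ext_natural \<sigma>" by (rule n)
next
  fix f T S A A'
  assume f: "f \<in> hom B T S" and A: "A \<in> Obj (Fib H1 S)" "A' \<in> Obj (Fib H1 S)"
  define d where "d = diag B S"
  note S = H1.hom_obj(2)[OF f] and T = H1.hom_obj(1)[OF f]
  note d = H1.diag[OF S, folded d_def]
  note df = H1.comp_hom[OF f d(1)]
  have qd: "prj1 B S S \<cdot>\<^bsub>B\<^esub> d \<cdot>\<^bsub>B\<^esub> f = f" "prj2 B S S \<cdot>\<^bsub>B\<^esub> d \<cdot>\<^bsub>B\<^esub> f = f"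
    using H1.comp_assoc[OF f d(1) H1.prj1_hom[OF S S]] H1.comp_assoc[OF f d(1) H1.prj2_hom[OF S S]] H1.id_left[OF f]
    by (simp_all add: d)
  note g = glued_base[OF S A(1)] glued_base[OF S A(2)] and RA = mor_obj[OF S A(1)] mor_obj[OF S A(2)]
  note G = glued_bifunctor.glued[OF ext_bifunctor[OF n S S] g]
  note l = lifts_comp[OF to_internal_lifts_comparison[OF m S S A df, unfolded qd] glued_isoD(1)[OF glued_iso_conn[OF f d(1) G]]]
  note D = glued_iso_pb[OF f to_internal_iso_glued[OF g, folded d_def]]
  show "lifts T (gten \<rho> T (gpb f (gbase S A)) (gpb f (gbase S A'))) (gpb f (gten \<rho> S (gbase S A) (gbase S A')))
      (itM T1 f A A') (itM T2 f (morO R S A) (morO R S A'))"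
    using l iso_hom[OF E1.T.mon_iso[OF f A]] iso_hom[OF E2.T.mon_iso[OF f RA]]
      E1.diag_comparison_pullback[OF S f A, folded d_def] E2.diag_comparison_pullback[OF S f RA, folded d_def]
    by (subst lifts_postcomp_iff[OF D, symmetric]) simp_all
next
  fix S1 S2 A1 A2
  assume S: "S1 \<in> Obj B" "S2 \<in> Obj B" and A: "A1 \<in> Obj (Fib H1 S1)" "A2 \<in> Obj (Fib H1 S2)"
  define P where "P = prd B S1 S2"
  note P = H1.prd_obj[OF S, folded P_def]
  note q = H1.prj1_hom[OF S, folded P_def] H1.prj2_hom[OF S, folded P_def]
  note g = glued_base[OF S(1) A(1)] glued_base[OF S(2) A(2)] and RA = mor_obj[OF S(1) A(1)] mor_obj[OF S(2) A(2)]
  note G = glued_bifunctor.glued[OF ext_bifunctor[OF n S] g, folded P_def]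
  interpret D1: category "Fib H1 P" by (rule H1.fib_category[OF P])
  interpret D2: category "Fib H2 P" by (rule H2.fib_category[OF P])
  note E1 = E1.e_iso[OF S A, folded P_def] and E2 = E2.e_iso[OF S RA, folded P_def]
  note l = to_internal_lifts_comparison[OF m S A, folded P_def, OF H1.id_hom[OF P], unfolded H1.id_right[OF q(1)] H1.id_right[OF q(2)]]
  have "lifts P (gten \<rho> P (gpb (prj1 B S1 S2) (gbase S1 A1)) (gpb (prj2 B S1 S2) (gbase S2 A2)))
      (gprod P (etO X1 S1 S2) (etO X2 S1 S2) (etA X2 S1 S2) (\<sigma> S1 S2) (gbase S1 A1) (gbase S2 A2))
      (inv_arr (Fib H1 P) (e1 S1 S2 A1 A2)) (inv_arr (Fib H2 P) (e2 S1 S2 (morO R S1 A1) (morO R S2 A2)))"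
    using D1.inv_arr(2)[OF E1] D2.inv_arr(2)[OF E2] l E1.comparison_id[OF S A, folded P_def]
      E2.comparison_id[OF S RA, folded P_def]
    by (subst lifts_postcomp_iff[OF glued_iso_idn[OF G], symmetric]) simp_all
  then have "glued_iso P (gten \<rho> P (gpb (prj1 B S1 S2) (gbase S1 A1)) (gpb (prj2 B S1 S2) (gbase S2 A2)))
      (gprod P (etO X1 S1 S2) (etO X2 S1 S2) (etA X2 S1 S2) (\<sigma> S1 S2) (gbase S1 A1) (gbase S2 A2))
      (inv_arr (Fib H1 P) (e1 S1 S2 A1 A2)) (inv_arr (Fib H2 P) (e2 S1 S2 (morO R S1 A1) (morO R S2 A2)))"
    using D1.inv_arr(1)[OF E1] D2.inv_arr(1)[OF E2] by (simp add: glued_iso_def)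
  from glued_isoD(1)[OF glued_iso_inv[OF this]]
  show "lifts (prd B S1 S2) (gext \<sigma> S1 S2 (gbase S1 A1) (gbase S2 A2))
        (gten \<rho> (prd B S1 S2) (gpb (prj1 B S1 S2) (gbase S1 A1)) (gpb (prj2 B S1 S2) (gbase S2 A2)))
        (e1 S1 S2 A1 A2) (e2 S1 S2 (morO R S1 A1) (morO R S2 A2))"
    using D1.inv_arr_inv[OF E1] D2.inv_arr_inv[OF E2] by (simp add: P_def[symmetric])
qed

end

end

context corresponding_structures
begin

lemma int_monoidal: "int_monoidal \<rho>"
  unfolding int_monoidal_def by (intro allI ballI) (rule lifts_itM_iff[OF \<rho>_natural, THEN iffD1, OF _ _ _ mon_base])

lemma ext_monoidal: "ext_monoidal \<sigma>"
  unfolding ext_monoidal_def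
proof (intro allI ballI, rule lifts_etM_iff[OF \<sigma>_natural, THEN iffD1])
  fix U1 S1 U2 S2 f1 f2 A1 A2
  assume f: "f1 \<in> hom B U1 S1" "f2 \<in> hom B U2 S2" and A: "A1 \<in> Obj (Fib H1 S1)" "A2 \<in> Obj (Fib H1 S2)"
  show "lifts (prd B U1 U2) (ext U1 U2 (gpb f1 (gbase S1 A1)) (gpb f2 (gbase S2 A2)))
      (gpb (cross B f1 f2) (ext S1 S2 (gbase S1 A1) (gbase S2 A2)))
      (etM X1 f1 f2 A1 A2) (etM X2 f1 f2 (morO R S1 A1) (morO R S2 A2))"
    using lifts_etM[OF f glued_base[OF H1.hom_obj(2)[OF f(1)] A(1)] glued_base[OF H1.hom_obj(2)[OF f(2)] A(2)]]
    by simp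
qed

text \<open>Both sides are third components that make \<open>e\<close> an isomorphism of glued objects.\<close>

lemma to_external_eq:
  assumes S: "S1 \<in> Obj B" "S2 \<in> Obj B" and A: "A1 \<in> Obj (Fib H1 S1)" "A2 \<in> Obj (Fib H1 S2)"
  shows "to_external B H1 H2 R T2 e1 e2 \<rho> S1 S2 A1 A2 = \<sigma> S1 S2 A1 A2"
  using glued_iso_cmpr[OF to_external_iso[OF \<rho>_natural S A]] cmpr_ext_base[OF S A]
    glued_iso_cmpr[OF iso_e[OF S glued_base[OF S(1) A(1)] glued_base[OF S(2) A(2)]]]
  by simp

text \<open>Both sides are third components that make the comparison along the diagonal an isomorphism of glued objects.\<close>

lemma to_internal_eq:
  assumes S: "S \<in> Obj B" and A: "A \<in> Obj (Fib H1 S)" "A' \<in> Obj (Fib H1 S)"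
  shows "to_internal B H1 H2 R T1 T2 X1 e1 e2 \<sigma> S A A' = \<rho> S A A'"
proof -
  note RA = mor_obj[OF S A(1)] mor_obj[OF S A(2)] and g = glued_base[OF S A(1)] glued_base[OF S A(2)]
  note d = H1.diag[OF S]
  have "glued_iso S (ten S (gbase S A) (gbase S A')) (gpb (diag B S) (ext S S (gbase S A) (gbase S A')))
      (diag_comparison B H1 T1 e1 S A A') (diag_comparison B H2 T2 e2 S (morO R S A) (morO R S A'))"
    using glued_iso_comp[OF iso_ten[OF S glued_iso_idn[OF g(1)] glued_iso_idn[OF g(2)]]
        iso_comparison[OF S S g d(1), unfolded d]]
    by (simp add: E1.diag_comparison_eq[OF S A] E2.diag_comparison_eq[OF S RA])
  then show ?thesis
    using glued_iso_cmpr[OF to_internal_iso[OF \<sigma>_natural S A]] glued_iso_cmpr cmpr_ten_base[OF S A] by simp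
qed

end

text \<open>Naturality and compatibility with \<open>m\<close> hold for both members of a corresponding pair, so only the optional
  axioms are left, and they have been matched one by one.\<close>

lemma (in corresponding_structures) member_iff:
  fixes ass com uni :: bool and v1 :: "'o \<Rightarrow> 'h1" and v2 w :: "'o \<Rightarrow> 'h2"
  assumes T1: "internal_structure ass com uni B H1 T1" and T2: "internal_structure ass com uni B H2 T2"
    and X1: "external_structure ass com uni B H1 X1" and X2: "external_structure ass com uni B H2 X2"
    and e1: "external_equivalence ass com uni B H1 X1 (E_ext B H1 T1) e1 v1"
    and e2: "external_equivalence ass com uni B H2 X2 (E_ext B H2 T2) e2 v2"
    and w: "uni \<Longrightarrow> section_iso B H2 (image_section B H2 R (itUnit T1)) (itUnit T2) w"
    and \<rho>: "\<forall>S A A'. \<not> (S \<in> Obj B \<and> A \<in> Obj (Fib H1 S) \<and> A' \<in> Obj (Fib H1 S)) \<longrightarrow> \<rho> S A A' = undefined"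
    and \<sigma>: "\<forall>S1 S2 A1 A2. \<not> (S1 \<in> Obj B \<and> S2 \<in> Obj B \<and> A1 \<in> Obj (Fib H1 S1) \<and> A2 \<in> Obj (Fib H1 S2))
        \<longrightarrow> \<sigma> S1 S2 A1 A2 = undefined"
  shows "\<rho> \<in> internal_tensor_structures_on ass com uni B H1 H2 R T1 T2 w \<longleftrightarrow>
    \<sigma> \<in> external_tensor_structures_on ass com uni B H1 H2 R X1 X2 (transport_unit_iso H2 R v1 v2 w)"
proof -
  have cong6: "(P1 \<and> P2 \<and> P3 \<and> A \<and> C \<and> U) = (Q1 \<and> Q2 \<and> Q3 \<and> A' \<and> C' \<and> U')"
    if "P1" "P2" "P3" "Q1" "Q2" "Q3" "A = A'" "C = C'" "U = U'" for P1 P2 P3 Q1 Q2 Q3 A A' C C' U U'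
    using that by simp
  have A: "corresponding_associative B H1 H2 R T1 X1 e1 T2 X2 e2 \<rho> \<sigma> com uni v1 v2" if ass
    using that T1 T2 X1 X2 e1 e2 corresponding_structures_axioms
    by (simp add: corresponding_associative_def corresponding_associative_axioms_def)
  have C: "corresponding_symmetric B H1 H2 R T1 X1 e1 T2 X2 e2 \<rho> \<sigma> ass uni v1 v2" if com
    using that T1 T2 X1 X2 e1 e2 corresponding_structures_axioms
    by (simp add: corresponding_symmetric_def corresponding_symmetric_axioms_def)
  have U: "corresponding_unitary B H1 H2 R T1 X1 e1 T2 X2 e2 \<rho> \<sigma> ass com v1 v2 w" if uni
    using that T1 T2 X1 X2 e1 e2 w corresponding_structures_axioms
    by (simp add: corresponding_unitary_def corresponding_unitary_axioms_def)
  show ?thesis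
    unfolding internal_tensor_structures_on_def external_tensor_structures_on_def mem_Collect_eq Let_def
    apply (rule cong6)
            apply (rule \<rho>)
           apply (rule \<rho>_natural[unfolded int_natural_def])
          apply (rule int_monoidal[unfolded int_monoidal_def])
         apply (rule \<sigma>)
        apply (rule \<sigma>_natural[unfolded ext_natural_def])
       apply (rule ext_monoidal[unfolded ext_monoidal_def])
    subgoal
      apply (rule imp_cong[OF refl], rule trans[OF _ trans[OF corresponding_associative.associative_iff[OF A]]])
      apply (intro ball_cong refl, rule corresponding_associative.ass_base_iff[OF A, symmetric]; assumption)
       apply assumption
      apply (intro ball_cong refl, rule corresponding_associative.eass_base_iff[OF A]; assumption)
      done
    subgoal
      apply (rule imp_cong[OF refl], rule trans[OF _ trans[OF corresponding_symmetric.symmetric_iff[OF C]]])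
      apply (intro ball_cong refl, rule corresponding_symmetric.com_base_iff[OF C, symmetric]; assumption)
       apply assumption
      apply (intro ball_cong refl, rule corresponding_symmetric.ecom_base_iff[OF C]; assumption)
      done
    subgoal
      apply (rule imp_cong[OF refl], rule trans[OF _ trans[OF corresponding_unitary.unitary_iff[OF U]]])
      apply (intro ball_cong conj_cong refl; (rule corresponding_unitary.unitor_base_iffs[OF U, symmetric]); assumption)
       apply assumption
      apply (intro ball_cong conj_cong refl; (rule corresponding_unitary.eunitor_base_iffs[OF U]); assumption)
      done
    done
qed

lemma tensor_equivalenceI:
  assumes "internal_structure ass com uni B H T" "external_structure ass com uni B H X"
    and "external_equivalence ass com uni B H X (E_ext B H T) e v"
  shows "tensor_equivalence B H T X e"
proof (rule tensor_equivalence.intro)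
  note e = assms(3)[unfolded external_equivalence_def Let_def]
  show "internal_tensor B H T" "external_tensor B H X"
    using assms(1,2) by (simp_all add: internal_structure_def external_structure_def)
  show "tensor_equivalence_axioms B H T X e"
    by (rule tensor_equivalence_axioms.intro)
      (rule e[THEN conjunct1, rule_format] e[THEN conjunct2, THEN conjunct1, rule_format]; assumption)+
qed

theorem theorem8p1:
  fixes B :: "('o, 'm) pcat"
    and H1 :: "('o, 'm, 'x1, 'h1) fibcat" and H2 :: "('o, 'm, 'x2, 'h2) fibcat"
    and R :: "('o, 'm, 'x1, 'h1, 'x2, 'h2) fibmor"
    and T1 :: "('o, 'm, 'x1, 'h1) itensor" and T2 :: "('o, 'm, 'x2, 'h2) itensor"
    and X1 :: "('o, 'm, 'x1, 'h1) etensor" and X2 :: "('o, 'm, 'x2, 'h2) etensor"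
    and e1 :: "'o \<Rightarrow> 'o \<Rightarrow> 'x1 \<Rightarrow> 'x1 \<Rightarrow> 'h1" and e2 :: "'o \<Rightarrow> 'o \<Rightarrow> 'x2 \<Rightarrow> 'x2 \<Rightarrow> 'h2"
    and v1 :: "'o \<Rightarrow> 'h1" and v2 :: "'o \<Rightarrow> 'h2" and w :: "'o \<Rightarrow> 'h2"
    and ass com uni :: bool
  assumes "category_with_products B"
    and "fibered_category B H1" and "fibered_category B H2"
    and "fibered_morphism B H1 H2 R"
    and "internal_structure ass com uni B H1 T1" and "internal_structure ass com uni B H2 T2"
    and "external_structure ass com uni B H1 X1" and "external_structure ass com uni B H2 X2"
    and "external_equivalence ass com uni B H1 X1 (E_ext B H1 T1) e1 v1"
    and "external_equivalence ass com uni B H2 X2 (E_ext B H2 T2) e2 v2"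
    and "uni \<Longrightarrow> section_iso B H2 (image_section B H2 R (itUnit T1)) (itUnit T2) w"
  shows "let
      I = internal_tensor_structures_on ass com uni B H1 H2 R T1 T2 w;
      E = external_tensor_structures_on ass com uni B H1 H2 R X1 X2 (transport_unit_iso H2 R v1 v2 w);
      \<Phi> = to_external B H1 H2 R T2 e1 e2;
      \<Psi> = to_internal B H1 H2 R T1 T2 X1 e1 e2
    in bij_betw \<Phi> I E \<and> bij_betw \<Psi> E I \<and>
       (\<forall>\<rho> \<in> I. \<Psi> (\<Phi> \<rho>) = \<rho>) \<and> (\<forall>\<sigma> \<in> E. \<Phi> (\<Psi> \<sigma>) = \<sigma>)"
proof -
  interpret fibered_morphism B H1 H2 R by fact
  interpret E1: tensor_equivalence B H1 T1 X1 e1 using tensor_equivalenceI assms by blast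
  interpret E2: tensor_equivalence B H2 T2 X2 e2 using tensor_equivalenceI assms by blast
  interpret equivalent_tensors B H1 H2 R T1 X1 e1 T2 X2 e2 ..
  define I where "I = internal_tensor_structures_on ass com uni B H1 H2 R T1 T2 w"
  define E where "E = external_tensor_structures_on ass com uni B H1 H2 R X1 X2 (transport_unit_iso H2 R v1 v2 w)"
  define \<Phi> where "\<Phi> = to_external B H1 H2 R T2 e1 e2"
  define \<Psi> where "\<Psi> = to_internal B H1 H2 R T1 T2 X1 e1 e2"
  have to_E: "\<Phi> \<rho> \<in> E \<and> \<Psi> (\<Phi> \<rho>) = \<rho>" if \<rho>: "\<rho> \<in> I" for \<rho>
  proof -
    \<comment> \<open>\<open>undefined\<close> outside the index range makes equality of families an equality of functions\<close>
    have und: "\<forall>S A A'. \<not> (S \<in> Obj B \<and> A \<in> Obj (Fib H1 S) \<and> A' \<in> Obj (Fib H1 S)) \<longrightarrow> \<rho> S A A' = undefined"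
      and n: "int_natural \<rho>"
      using \<rho> by (simp_all add: I_def internal_tensor_structures_on_def int_natural_def)
    have m: "int_monoidal \<rho>"
      unfolding int_monoidal_def
      by (rule \<rho>[unfolded I_def internal_tensor_structures_on_def mem_Collect_eq,
            THEN conjunct2, THEN conjunct2, THEN conjunct1])
    interpret corresponding_structures B H1 H2 R T1 X1 e1 T2 X2 e2 \<rho> "\<Phi> \<rho>"
      unfolding \<Phi>_def by (rule to_external_corresponding[OF n m])
    have "\<Phi> \<rho> \<in> E"
      using \<rho> member_iff[OF assms(5-11) und] by (simp add: I_def E_def \<Phi>_def to_external_def)
    moreover have "\<Psi> (\<Phi> \<rho>) S A A' = \<rho> S A A'" for S A A'
    proof (cases "S \<in> Obj B \<and> A \<in> Obj (Fib H1 S) \<and> A' \<in> Obj (Fib H1 S)")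
      case True
      then show ?thesis using to_internal_eq by (simp add: \<Psi>_def)
    next
      case False
      then show ?thesis using und unfolding \<Psi>_def to_internal_def if_not_P[OF False] by (metis (no_types))
    qed
    ultimately show ?thesis by blast
  qed
  have to_I: "\<Psi> \<sigma> \<in> I \<and> \<Phi> (\<Psi> \<sigma>) = \<sigma>" if \<sigma>: "\<sigma> \<in> E" for \<sigma>
  proof -
    have und: "\<forall>S1 S2 A1 A2. \<not> (S1 \<in> Obj B \<and> S2 \<in> Obj B \<and> A1 \<in> Obj (Fib H1 S1) \<and> A2 \<in> Obj (Fib H1 S2))
        \<longrightarrow> \<sigma> S1 S2 A1 A2 = undefined"
      and n: "ext_natural \<sigma>"
      using \<sigma> by (simp_all add: E_def external_tensor_structures_on_def ext_natural_def)
    have m: "ext_monoidal \<sigma>"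
      unfolding ext_monoidal_def
      by (rule \<sigma>[unfolded E_def external_tensor_structures_on_def mem_Collect_eq Let_def,
            THEN conjunct2, THEN conjunct2, THEN conjunct1])
    interpret corresponding_structures B H1 H2 R T1 X1 e1 T2 X2 e2 "\<Psi> \<sigma>" \<sigma>
      unfolding \<Psi>_def by (rule to_internal_corresponding[OF n m])
    have "\<Psi> \<sigma> \<in> I"
      using \<sigma> member_iff[OF assms(5-11) _ und] by (simp add: I_def E_def \<Psi>_def to_internal_def)
    moreover have "\<Phi> (\<Psi> \<sigma>) S1 S2 A1 A2 = \<sigma> S1 S2 A1 A2" for S1 S2 A1 A2
    proof (cases "S1 \<in> Obj B \<and> S2 \<in> Obj B \<and> A1 \<in> Obj (Fib H1 S1) \<and> A2 \<in> Obj (Fib H1 S2)")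
      case True
      then show ?thesis using to_external_eq by (simp add: \<Phi>_def)
    next
      case False
      then show ?thesis using und unfolding \<Phi>_def to_external_def if_not_P[OF False] by (metis (no_types))
    qed
    ultimately show ?thesis by blast
  qed
  have "bij_betw \<Phi> I E" "bij_betw \<Psi> E I"
    using to_E to_I by (auto intro!: bij_betw_byWitness[of _ \<Psi>] bij_betw_byWitness[of _ \<Phi>])
  then show ?thesis
    unfolding Let_def I_def[symmetric] E_def[symmetric] \<Phi>_def[symmetric] \<Psi>_def[symmetric]
    using to_E to_I by blast
qed

end
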